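(* We have $P(3)=5$. Moreover, up to similarity, there are exactly five optimal configurations for $k=3$, namely the following five-point sets: (1) the four vertices of a square together with the center of the square; (2) the five vertices of a regular pentagon; (3) four of the five vertices of a regular pentagon together with the intersection point of the two diagonals of the convex quadrilateral (an isosceles trapezoid) that these four vertices form; (4) four of the five vertices of a regular pentagon together with the intersection point of the two lines containing the two non-parallel sides (legs) of the isosceles trapezoid that these four vertices form; (5) the vertices $A,B,C$ of an isosceles triangle with $\angle ACB=\frac{3\pi}{5}$ and $\angle CAB=\angle CBA=\frac{\pi}{5}$, together with the two points $D,E$ on the side $\overline{AB}$, lying in the order $A,D,E,B$, for which $\angle ACD=\angle DCE=\angle ECB=\frac{\pi}{5}$.
   Context: For a set $\mathcal{P} \subset \mathbb{R}^2$, let $A(\mathcal{P})$ be the number of distinct values in the open interval $(0,\pi)$ taken by the angle magnitudes $|\angle abc|$ (the angle at $b$ between the rays from $b$ through $a$ and from $b$ through $c$, measured in $[0,\pi]$), where $a,b,c$ range over triples of distinct points of $\mathcal{P}$. In particular, angles equal to $0$ or $\pi$ are not counted. For an integer $k\ge 1$, define $$P(k) := \max\{\#\mathcal{P} : \mathcal{P}\subseteq \mathbb{R}^2,\ \text{not all points of } \mathcal{P} \text{ are collinear},\ A(\mathcal{P}) \leq k\}.$$ An optimal configuration for $k$ is a set $\mathcal{P}\subseteq\mathbb{R}^2$, not all of whose points are collinear, with $A(\mathcal{P})\le k$ and $\#\mathcal{P}=P(k)$. Configurations are considered up to similarity, i.e. up to rigid motions (including reflections) and dilations of the plane. *)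

theory Defs
  imports "HOL-Analysis.Analysis"
begin

(* The angle at b, in [0, pi]; only meaningful when a and c differ from b. *)
definition angle :: "real^2 \<Rightarrow> real^2 \<Rightarrow> real^2 \<Rightarrow> real" where
  "angle a b c = arccos (((a - b) \<bullet> (c - b)) / (norm (a - b) * norm (c - b)))"

(* card maps infinite sets to 0, so the sizes of possibly infinite sets are taken in enat. *)
definition ecard :: "'a set \<Rightarrow> enat" where
  "ecard S = (if finite S then enat (card S) else \<infinity>)"

definition angles :: "(real^2) set \<Rightarrow> real set" where
  "angles S = {angle a b c | a b c.
      a \<in> S \<and> b \<in> S \<and> c \<in> S \<and> a \<noteq> b \<and> b \<noteq> c \<and> a \<noteq> c} \<inter> {0<..<pi}"

definition num_angles :: "(real^2) set \<Rightarrow> enat" where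
  "num_angles S = ecard (angles S)"

(* A supremum in enat exists unconditionally; a finite supremum of a nonempty set of
   extended naturals is attained, hence is a maximum. *)
definition max_points :: "nat \<Rightarrow> enat" where
  "max_points k = (SUP S \<in> {S. \<not> collinear S \<and> num_angles S \<le> enat k}. ecard S)"

definition optimal :: "nat \<Rightarrow> (real^2) set \<Rightarrow> bool" where
  "optimal k S \<longleftrightarrow> \<not> collinear S \<and> num_angles S \<le> enat k \<and> ecard S = max_points k"

(* Orthogonal transformations include reflections. *)
definition similarity_rel :: "((real^2) set \<times> (real^2) set) set" where
  "similarity_rel = {(S, T). \<exists>r t f. r > 0 \<and> orthogonal_transformation f \<and>
      T = (\<lambda>x. t + r *\<^sub>R f x) ` S}"

(* v enumerates, counterclockwise and periodically with period n, the vertices of a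
   regular n-gon with centre z. *)
definition regular_polygon :: "nat \<Rightarrow> real^2 \<Rightarrow> (nat \<Rightarrow> real^2) \<Rightarrow> bool" where
  "regular_polygon n z v \<longleftrightarrow> n \<ge> 3 \<and> (\<exists>r \<theta>. r > 0 \<and>
      (\<forall>i. v i = z + r *\<^sub>R vector [cos (\<theta> + 2 * pi * real i / real n),
                                    sin (\<theta> + 2 * pi * real i / real n)]))"

definition square_with_center :: "(real^2) set \<Rightarrow> bool" where
  "square_with_center S \<longleftrightarrow> (\<exists>z v. regular_polygon 4 z v \<and> S = insert z (v ` {..<4}))"

definition pentagon :: "(real^2) set \<Rightarrow> bool" where
  "pentagon S \<longleftrightarrow> (\<exists>z v. regular_polygon 5 z v \<and> S = v ` {..<5})"

(* In the next two definitions v m is the omitted vertex. The remaining vertices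
   v (m+1), ..., v (m+4), in this cyclic order, form an isosceles trapezoid whose parallel
   sides are v (m+2) v (m+3) and v (m+4) v (m+1) and whose legs are v (m+1) v (m+2)
   and v (m+3) v (m+4). *)

definition trapezoid_with_diagonals_point :: "(real^2) set \<Rightarrow> bool" where
  "trapezoid_with_diagonals_point S \<longleftrightarrow> (\<exists>z v m x. regular_polygon 5 z v \<and> m < 5 \<and>
      closed_segment (v (m+1)) (v (m+3)) \<inter> closed_segment (v (m+2)) (v (m+4)) = {x} \<and>
      S = {v (m+1), v (m+2), v (m+3), v (m+4), x})"

definition trapezoid_with_legs_point :: "(real^2) set \<Rightarrow> bool" where
  "trapezoid_with_legs_point S \<longleftrightarrow> (\<exists>z v m x. regular_polygon 5 z v \<and> m < 5 \<and>
      affine hull {v (m+1), v (m+2)} \<inter> affine hull {v (m+3), v (m+4)} = {x} \<and>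
      S = {v (m+1), v (m+2), v (m+3), v (m+4), x})"

definition trisected_isosceles_triangle :: "(real^2) set \<Rightarrow> bool" where
  "trisected_isosceles_triangle S \<longleftrightarrow> (\<exists>A B C D E.
      \<not> collinear {A, B, C} \<and>
      angle A C B = 3 * pi / 5 \<and> angle C A B = pi / 5 \<and> angle C B A = pi / 5 \<and>
      D \<in> open_segment A B \<and> E \<in> open_segment D B \<and>
      angle A C D = pi / 5 \<and> angle D C E = pi / 5 \<and> angle E C B = pi / 5 \<and>
      S = {A, B, C, D, E})"

end

theory Submission
  imports Defs
begin

text \<open>
  Let \<open>S\<close> be a set of points, not all on one line, whose set of angles has at most three
  elements. Two facts about angles do most of the work.

  Angles add. If a point of \<open>S\<close> sees four others in successive directions within a half-plane,
  with gaps \<open>p, q, r\<close>, then \<open>p, q, r, p + q, q + r, p + q + r\<close> are all angles of \<open>S\<close>, and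
  three values suffice only if \<open>p = q = r\<close> and the angles of \<open>S\<close> are
  \<open>p, 2 * p, 3 * p\<close> (lemma \<open>four_rays\<close>). A fifth direction would give a fourth angle.

  Points strictly inside triangles are impossible. If \<open>D\<close> lies inside \<open>A B C\<close>, then each of the six
  angles at the corners is the smallest of a chain of three angles, so all six equal
  \<open>pi / 6\<close>, the triangle is equilateral with centre \<open>D\<close>, and a fifth point creates a right angle, an
  angle below \<open>pi / 6\<close> or a triangle with too large an angle sum (lemma \<open>no_interior_point\<close>).

  Now take five points of \<open>S\<close>. If no three are on a line, the absence of interior points puts them in
  convex position, and \<open>four_rays\<close> at the vertices makes them a regular pentagon. If four are
  on a line, \<open>four_rays\<close> at the fifth point gives the trisected triangle. Otherwise there are
  \<open>D\<close> between \<open>A\<close> and \<open>B\<close>, and two points \<open>X, Y\<close> off the line \<open>A B\<close>. If \<open>X, Y\<close> lie on different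
  sides, then \<open>D\<close> is on \<open>X Y\<close>, since otherwise it would be an interior point; so \<open>D\<close> is the crossing
  point of the diagonals of a quadrilateral, and the angles allow a square or a trapezoid. If they lie on the same side, then
  the line \<open>X Y\<close> passes through \<open>A\<close> or \<open>B\<close>, since otherwise there would be an interior point or a
  convex quadrilateral with \<open>D\<close> on a side, which the angles exclude; this gives the trapezoid with the
  common point of its legs.

  For six points the same alternative, applied to all collinear triples, is contradictory by
  itself, apart from five points that are seen in successive directions from a sixth (lemma \<open>not_six_points\<close>).

  To pass from angles to similarity classes, each five-point set is recorded by two of its points and
  the base angles over them of the other three, which lie on one side of the base. These data determine
  the set up to similarity (lemma \<open>framed_similar\<close>) and yield a normal form with coordinates in terms of the
  golden ratio and \<open>sin (pi / 5)\<close>. There the angles can be read off, each geometric description in the theorem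
  can be matched with its normal form, and the five classes are told apart by the presence of a right angle, by
  the number of points lying between two others, and by whether four points are collinear.
\<close>

section \<open>Angles and oriented areas in the plane\<close>

definition cross2 :: "real^2 \<Rightarrow> real^2 \<Rightarrow> real" where
  "cross2 u v = u$1 * v$2 - u$2 * v$1"

text \<open>Twice the signed area of the triangle \<open>a b c\<close>. All order information (sides of lines, order of
  rays, betweenness) is expressed by signs of this quantity, so that it can be combined by linear arithmetic.\<close>
definition orient :: "real^2 \<Rightarrow> real^2 \<Rightarrow> real^2 \<Rightarrow> real" where
  "orient a b c = cross2 (b - a) (c - a)"

definition vangle :: "real^2 \<Rightarrow> real^2 \<Rightarrow> real" where
  "vangle u v = arccos ((u \<bullet> v) / (norm u * norm v))"

lemma angle_vangle: "angle a b c = vangle (a - b) (c - b)"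
  by (simp add: angle_def vangle_def)

lemma inner2: "(u::real^2) \<bullet> v = u$1 * v$1 + u$2 * v$2"
  by (simp add: inner_vec_def sum_2)

lemma norm2_sq: "(norm (u::real^2))\<^sup>2 = u$1 * u$1 + u$2 * u$2"
  by (simp add: power2_norm_eq_inner inner2)

lemma vec2_eq_iff: "(u::real^2) = v \<longleftrightarrow> u$1 = v$1 \<and> u$2 = v$2"
  by (simp add: vec_eq_iff forall_2)

lemma cross2_zero [simp]: "cross2 0 v = 0" "cross2 u 0 = 0"
  by (simp_all add: cross2_def)

lemma cos_ratio_bounds:
  fixes u v :: "real^2"
  shows "- 1 \<le> u \<bullet> v / (norm u * norm v)" "u \<bullet> v / (norm u * norm v) \<le> 1"
proof -
  have "\<bar>u \<bullet> v / (norm u * norm v)\<bar> \<le> 1"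
    using Cauchy_Schwarz_ineq2[of u v] by (auto simp: abs_mult divide_le_eq_1)
  then show "- 1 \<le> u \<bullet> v / (norm u * norm v)" "u \<bullet> v / (norm u * norm v) \<le> 1" by linarith+
qed

lemma vangle_bounds: "0 \<le> vangle u v" "vangle u v \<le> pi"
  unfolding vangle_def by (intro arccos_lbound arccos_ubound cos_ratio_bounds)+

lemma cos_vangle:
  assumes "u \<noteq> 0" "v \<noteq> 0"
  shows "norm u * norm v * cos (vangle u v) = u \<bullet> v"
proof -
  have "cos (vangle u v) = (u \<bullet> v) / (norm u * norm v)"
    unfolding vangle_def by (intro cos_arccos cos_ratio_bounds)
  then show ?thesis using assms by simp
qed

lemma sin_vangle:
  assumes "u \<noteq> 0" "v \<noteq> 0"
  shows "norm u * norm v * sin (vangle u v) = \<bar>cross2 u v\<bar>"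
proof -
  have "(norm u * norm v * sin (vangle u v))\<^sup>2 =
      (norm u * norm v)\<^sup>2 - (norm u * norm v * cos (vangle u v))\<^sup>2"
    unfolding power_mult_distrib sin_squared_eq by (simp add: right_diff_distrib)
  also have "\<dots> = (norm u)\<^sup>2 * (norm v)\<^sup>2 - (u \<bullet> v)\<^sup>2"
    using cos_vangle[OF assms] by (simp add: power_mult_distrib)
  also have "\<dots> = (cross2 u v)\<^sup>2"
    unfolding norm2_sq inner2 cross2_def by (simp add: power2_eq_square algebra_simps)
  finally have "(norm u * norm v * sin (vangle u v))\<^sup>2 = (\<bar>cross2 u v\<bar>)\<^sup>2" by simp
  moreover have "0 \<le> norm u * norm v * sin (vangle u v)"
    using vangle_bounds[of u v] by (simp add: sin_ge_zero)
  ultimately show ?thesis using power2_eq_imp_eq abs_ge_zero by blast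
qed

lemma vangle_eqI:
  assumes "u \<noteq> 0" "v \<noteq> 0" "0 \<le> x" "x \<le> pi" "norm u * norm v * cos x = u \<bullet> v"
  shows "vangle u v = x"
proof -
  have "norm u * norm v * cos x = norm u * norm v * cos (vangle u v)" using cos_vangle[of u v] assms by simp
  then have "cos x = cos (vangle u v)" using assms by simp
  then show ?thesis using vangle_bounds[of u v] assms by (metis arccos_cos)
qed

lemma vangle_commute: "vangle u v = vangle v u"
  by (simp add: vangle_def inner_commute mult.commute)

lemma vangle_minus_right: "u \<noteq> 0 \<Longrightarrow> v \<noteq> 0 \<Longrightarrow> vangle u (- v) = pi - vangle u v"
  using vangle_bounds[of u v] cos_vangle[of u v] by (intro vangle_eqI) (auto simp: algebra_simps)

lemma vangle_minus_both: "vangle (- u) (- v) = vangle u v"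
  by (simp add: vangle_def)

lemma vangle_scale_left: "0 < r \<Longrightarrow> vangle (r *\<^sub>R u) v = vangle u v"
  by (simp add: vangle_def)

lemma cross2_nonzero: "cross2 u v \<noteq> 0 \<Longrightarrow> u \<noteq> 0 \<and> v \<noteq> 0"
  by (auto simp: cross2_def)

lemma vangle_strict_bounds:
  assumes "cross2 u v \<noteq> 0" shows "0 < vangle u v" "vangle u v < pi"
proof -
  have "sin (vangle u v) \<noteq> 0" using sin_vangle[of u v] cross2_nonzero[OF assms] assms by auto
  then have "vangle u v \<noteq> 0" "vangle u v \<noteq> pi" by auto
  then show "0 < vangle u v" "vangle u v < pi" using vangle_bounds[of u v] by auto
qed

text \<open>The addition theorems, applied to \<open>cos\<close> and \<open>sin\<close> of the two angles and cleared of denominators,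
  are polynomial identities in the coordinates; the sign conditions let \<open>sin_vangle\<close> drop its absolute value.\<close>
lemma vangle_add_aux:
  assumes "0 < cross2 u v" "0 < cross2 v w" "w \<noteq> 0"
  shows "norm u * norm w * sin (vangle u v + vangle v w) = cross2 u w"
    and "norm u * norm w * cos (vangle u v + vangle v w) = u \<bullet> w"
proof -
  have nz: "u \<noteq> 0" "v \<noteq> 0" "w \<noteq> 0" using assms cross2_nonzero by auto
  define a b where "a = vangle u v" and "b = vangle v w"
  have A: "norm u * norm v * cos a = u \<bullet> v" "norm u * norm v * sin a = cross2 u v"
      "norm v * norm w * cos b = v \<bullet> w" "norm v * norm w * sin b = cross2 v w"
    using cos_vangle[of u v] cos_vangle[of v w] sin_vangle[of u v] sin_vangle[of v w] nz assms
    by (auto simp: a_def b_def)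
  have "(norm v)\<^sup>2 * (norm u * norm w * sin (a + b)) =
     (norm u * norm v * sin a) * (norm v * norm w * cos b) + (norm u * norm v * cos a) * (norm v * norm w * sin b)"
    by (simp add: sin_add algebra_simps power2_eq_square)
  also have "\<dots> = (norm v)\<^sup>2 * cross2 u w"
    unfolding A norm2_sq inner2 cross2_def by (simp add: algebra_simps)
  finally show "norm u * norm w * sin (vangle u v + vangle v w) = cross2 u w" using nz by (simp add: a_def b_def)
  have "(norm v)\<^sup>2 * (norm u * norm w * cos (a + b)) =
     (norm u * norm v * cos a) * (norm v * norm w * cos b) - (norm u * norm v * sin a) * (norm v * norm w * sin b)"
    by (simp add: cos_add algebra_simps power2_eq_square)
  also have "\<dots> = (norm v)\<^sup>2 * (u \<bullet> w)"
    unfolding A norm2_sq inner2 cross2_def by (simp add: algebra_simps)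
  finally show "norm u * norm w * cos (vangle u v + vangle v w) = u \<bullet> w" using nz by (simp add: a_def b_def)
qed

text \<open>The sum of the two angles is below \<open>2 * pi\<close> and has a positive sine, so it is below \<open>pi\<close>, where
  the cosine determines it.\<close>
lemma vangle_add:
  assumes "0 < cross2 u v" "0 < cross2 v w" "0 < cross2 u w"
  shows "vangle u w = vangle u v + vangle v w"
proof -
  have nz: "u \<noteq> 0" "w \<noteq> 0" using assms cross2_nonzero by auto
  define x where "x = vangle u v + vangle v w"
  have b: "0 < x" "x < 2 * pi"
    using vangle_strict_bounds[of u v] vangle_strict_bounds[of v w] assms by (auto simp: x_def)
  have "0 < sin x" using vangle_add_aux(1)[OF assms(1,2) nz(2)] assms(3) nz unfolding x_def
    by (metis norm_ge_zero zero_less_mult_pos zero_less_norm_iff mult_pos_pos)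
  then have "x < pi" using b sin_le_zero[of x] by force
  then show ?thesis using vangle_add_aux(2)[OF assms(1,2) nz(2)] nz b
    unfolding x_def[symmetric] by (intro vangle_eqI) auto
qed

text \<open>The converse: an angle sum below \<open>pi\<close> forces the orientation of the outer rays, which saves a case
  distinction when the position of the outer points is not known beforehand.\<close>
lemma cross2_pos_of_vangle_sum:
  assumes "0 < cross2 u v" "0 < cross2 v w" "vangle u v + vangle v w < pi"
  shows "0 < cross2 u w"
proof -
  have nz: "u \<noteq> 0" "w \<noteq> 0" using assms cross2_nonzero by auto
  have "0 < sin (vangle u v + vangle v w)"
    using vangle_strict_bounds[of u v] vangle_strict_bounds[of v w] assms by (intro sin_gt_zero) auto
  then show ?thesis using vangle_add_aux(1)[OF assms(1,2) nz(2)] nz by (metis mult_pos_pos zero_less_norm_iff)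
qed

lemma orient_coords: "orient a b c = (b$1 - a$1) * (c$2 - a$2) - (b$2 - a$2) * (c$1 - a$1)"
  by (simp add: orient_def cross2_def)

lemma orient_perms:
  "orient b c a = orient a b c" "orient c a b = orient a b c"
  "orient a c b = - orient a b c" "orient b a c = - orient a b c" "orient c b a = - orient a b c"
  by (simp_all add: orient_coords algebra_simps)

lemma orient_same [simp]: "orient a a b = 0" "orient a b a = 0" "orient b a a = 0"
  by (simp_all add: orient_coords algebra_simps)

lemma angle_commute: "angle a b c = angle c b a"
  by (simp add: angle_vangle vangle_commute)

lemma angle_bounds:
  assumes "orient a b c \<noteq> 0" shows "0 < angle a b c" "angle a b c < pi"
proof -
  have "cross2 (a - b) (c - b) \<noteq> 0" using assms by (auto simp: orient_coords cross2_def algebra_simps)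
  then show "0 < angle a b c" "angle a b c < pi" by (auto simp: angle_vangle vangle_strict_bounds)
qed

lemma angle_add:
  assumes "0 < orient c a d" "0 < orient c d b" "0 < orient c a b"
  shows "angle a c b = angle a c d + angle d c b"
  using assms vangle_add by (simp add: angle_vangle orient_def)

lemma orient_pos_of_angle_sum:
  assumes "0 < orient c a d" "0 < orient c d b" "angle a c d + angle d c b < pi"
  shows "0 < orient c a b"
  using assms cross2_pos_of_vangle_sum by (simp add: angle_vangle orient_def)

text \<open>Additivity for the vectors \<open>b - a\<close>, \<open>c - a\<close> and \<open>c - b\<close>: the middle one lies between the other
  two because it is their sum.\<close>
lemma triangle_sum_pos:
  assumes "0 < orient a b c"
  shows "angle b a c + angle a b c + angle a c b = pi"
proof -
  define u v where "u = b - a" and "v = c - a"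
  have p: "0 < cross2 u v" using assms by (simp add: orient_def u_def v_def)
  have q: "cross2 v (v - u) = cross2 u v" "cross2 u (v - u) = cross2 u v"
    by (simp_all add: cross2_def algebra_simps)
  have nz: "u \<noteq> 0" "v - u \<noteq> 0" using p q cross2_nonzero[of u "v - u"] cross2_nonzero[of u v] by auto
  have "vangle u (v - u) = vangle u v + vangle v (v - u)"
    using p q by (intro vangle_add) auto
  moreover have "vangle u (v - u) = pi - vangle (- u) (v - u)"
    using vangle_minus_right[of "v - u" u] nz vangle_commute[of "v-u"] by auto
  moreover have "angle b a c = vangle u v" "angle a b c = vangle (- u) (v - u)"
    by (simp_all add: angle_vangle u_def v_def)
  moreover have "angle a c b = vangle v (v - u)"
    using vangle_minus_both[of v "v - u"] by (simp add: angle_vangle u_def v_def)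
  ultimately show ?thesis by simp
qed

lemma triangle_sum:
  assumes "orient a b c \<noteq> 0"
  shows "angle b a c + angle a b c + angle a c b = pi"
proof (cases "0 < orient a b c")
  case False
  then have "0 < orient a c b" using assms orient_perms[of a b c] by linarith
  from triangle_sum_pos[OF this] show ?thesis by (simp add: angle_commute)
qed (rule triangle_sum_pos)

text \<open>Both sides times the length of \<open>a b\<close> are twice the area of the triangle.\<close>
lemma law_of_sines:
  assumes "orient a b c \<noteq> 0"
  shows "dist c a * sin (angle c a b) = dist c b * sin (angle c b a)"
proof -
  have 1: "cross2 (c - a) (b - a) \<noteq> 0" "cross2 (c - b) (a - b) \<noteq> 0"
    using assms by (auto simp: orient_coords cross2_def algebra_simps)
  have 2: "\<bar>cross2 (c - a) (b - a)\<bar> = \<bar>cross2 (c - b) (a - b)\<bar>"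
    by (simp add: cross2_def algebra_simps abs_if)
  have nz: "norm (b - a) \<noteq> 0" using cross2_nonzero[OF 1(1)] by auto
  have "norm (b - a) * (norm (c - a) * sin (vangle (c - a) (b - a)))
      = norm (b - a) * (norm (c - b) * sin (vangle (c - b) (a - b)))"
    using sin_vangle[of "c - a" "b - a"] sin_vangle[of "c - b" "a - b"]
      cross2_nonzero[OF 1(1)] cross2_nonzero[OF 1(2)] 2
    by (simp add: norm_minus_commute[of a b] mult_ac)
  then show ?thesis using nz by (simp add: angle_vangle dist_norm)
qed

lemma open_segment_param:
  fixes a b d :: "real^2"
  shows "d \<in> open_segment a b \<longleftrightarrow> a \<noteq> b \<and> (\<exists>t. 0 < t \<and> t < 1 \<and> d = a + t *\<^sub>R (b - a))"
  unfolding in_segment by (simp add: algebra_simps)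

text \<open>A point between \<open>a\<close> and \<open>b\<close> splits the area of every triangle over \<open>a b\<close> in a fixed proportion, so signs
  carry over from \<open>a b c\<close> to both parts.\<close>
lemma orient_open_segment:
  assumes "d \<in> open_segment a b"
  obtains t where "0 < t" "t < 1" "\<And>c. orient a d c = t * orient a b c"
    "\<And>c. orient d b c = (1 - t) * orient a b c"
proof -
  obtain t where t: "0 < t" "t < 1" "d = a + t *\<^sub>R (b - a)" using assms open_segment_param by auto
  have d: "d$1 = a$1 + t * (b$1 - a$1)" "d$2 = a$2 + t * (b$2 - a$2)" by (simp_all add: t(3))
  show ?thesis using t(1,2) by (intro that[of t]) (auto simp: orient_coords d algebra_simps)
qed

lemma open_segment_orient_pos:
  assumes "d \<in> open_segment a b" "0 < orient a b c"
  shows "0 < orient a d c" "0 < orient d b c"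
  using assms by (auto elim!: orient_open_segment)

lemma open_segment_orient_nonzero:
  assumes "d \<in> open_segment a b" "orient a b c \<noteq> 0"
  shows "orient a d c \<noteq> 0" "orient d b c \<noteq> 0"
  using assms by (auto elim!: orient_open_segment)

lemma angle_same_ray:
  assumes "d \<in> open_segment a b"
  shows "angle d a c = angle b a c"
  using assms vangle_scale_left by (auto simp: open_segment_param angle_vangle)

lemma angle_straight:
  assumes "d \<in> open_segment a b" "c \<noteq> d"
  shows "angle a d c + angle c d b = pi"
proof -
  obtain t where t: "0 < t" "t < 1" "d = a + t *\<^sub>R (b - a)" and "a \<noteq> b"
    using assms open_segment_param by auto
  have 1: "a - d = t *\<^sub>R - (b - a)" "b - d = (1 - t) *\<^sub>R (b - a)"
    using t by (auto simp: algebra_simps)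
  have "angle a d c = vangle (- (b - a)) (c - d)"
    unfolding angle_vangle 1(1) using t by (simp only: vangle_scale_left)
  moreover have "angle c d b = vangle (b - a) (c - d)"
    unfolding angle_vangle vangle_commute[of "c - d"] 1(2) using t by (simp add: vangle_scale_left)
  ultimately show ?thesis using vangle_minus_right[of "c - d" "b - a"] \<open>a \<noteq> b\<close> assms(2)
    by (simp add: vangle_commute)
qed

lemma angle_add_segment:
  assumes "d \<in> open_segment a b" "orient a b c \<noteq> 0"
  shows "angle a c b = angle a c d + angle d c b"
proof (cases "0 < orient a b c")
  case True
  show ?thesis using open_segment_orient_pos[OF assms(1) True] True
      orient_perms[of a d c] orient_perms[of d b c] orient_perms[of a b c]
    by (intro angle_add) auto
next
  case False
  then have p: "0 < orient b a c" using assms(2) orient_perms[of a b c] by linarith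
  have "d \<in> open_segment b a" using assms(1) open_segment_commute by auto
  from open_segment_orient_pos[OF this p] p
  have "angle b c a = angle b c d + angle d c a"
    using orient_perms[of b d c] orient_perms[of d a c] orient_perms[of b a c] by (intro angle_add) auto
  then show ?thesis by (simp add: angle_commute)
qed

section \<open>Sets with at most three angles\<close>

lemma orient_distinct: "orient a b c \<noteq> 0 \<Longrightarrow> a \<noteq> b \<and> b \<noteq> c \<and> a \<noteq> c"
  by auto

text \<open>The form in which the bound on the number of angles is used: any three angles in increasing order are all
  the angles, so every other angle equals one of them.\<close>
lemma three_element_chain:
  fixes T :: "real set"
  assumes "finite T" "card T \<le> 3" "p \<in> T" "q \<in> T" "r \<in> T" "p < q" "q < r"
  shows "T = {p, q, r}"
proof -
  have "card {p, q, r} = 3" using assms by auto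
  then show ?thesis using assms card_seteq[of T "{p, q, r}"] by auto
qed

lemma three_element_chain_Min:
  fixes T :: "real set"
  assumes "finite T" "card T \<le> 3" "p \<in> T" "q \<in> T" "r \<in> T" "p < q" "q < r"
  shows "Min T = p"
  unfolding three_element_chain[OF assms] using assms by (intro Min_eqI) auto

text \<open>Both \<open>p < p + q < p + q + r\<close> and \<open>r < q + r < p + q + r\<close> exhaust the set, so \<open>p\<close> and \<open>r\<close> are its
  minimum, and \<open>q\<close>, which is smaller than \<open>p + q\<close>, can only be \<open>p\<close>.\<close>
lemma three_sums_equal:
  fixes T :: "real set"
  assumes T: "finite T" "card T \<le> 3" and pos: "0 < p" "0 < q" "0 < r"
    and mem: "p \<in> T" "q \<in> T" "r \<in> T" "p + q \<in> T" "q + r \<in> T" "p + q + r \<in> T"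
  shows "q = p" "r = p" "T = {p, 2 * p, 3 * p}"
proof -
  have 1: "T = {p, p + q, p + q + r}" using pos mem by (intro three_element_chain[OF T]) auto
  have 2: "T = {r, q + r, p + q + r}" using pos mem by (intro three_element_chain[OF T]) auto
  have "r \<in> {p, p + q, p + q + r}" "p \<in> {r, q + r, p + q + r}" "q \<in> {p, p + q, p + q + r}"
    unfolding 1[symmetric] 2[symmetric] using mem by simp_all
  then have "(r = p \<or> r = p + q \<or> r = p + q + r) \<and> (p = r \<or> p = q + r \<or> p = p + q + r)
      \<and> (q = p \<or> q = p + q \<or> q = p + q + r)" by simp
  then have eq: "q = p \<and> r = p" using pos by argo
  then show "q = p" "r = p" by auto
  show "T = {p, 2 * p, 3 * p}" unfolding 1 using eq by simp
qed

locale few_angles =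
  fixes S :: "(real^2) set"
  assumes fin: "finite (angles S)" and card3: "card (angles S) \<le> 3"
begin

lemma angle_mem:
  assumes "a \<in> S" "b \<in> S" "c \<in> S" "orient a b c \<noteq> 0"
  shows "angle a b c \<in> angles S" "angle b a c \<in> angles S" "angle a c b \<in> angles S"
    "angle c b a \<in> angles S" "angle c a b \<in> angles S" "angle b c a \<in> angles S"
proof -
  have 1: "angle x y z \<in> angles S" if "x \<in> S" "y \<in> S" "z \<in> S" "orient x y z \<noteq> 0" for x y z
    using that orient_distinct[OF that(4)] angle_bounds[OF that(4)] unfolding angles_def by auto
  have "orient b a c \<noteq> 0" "orient a c b \<noteq> 0" "orient c b a \<noteq> 0" "orient c a b \<noteq> 0" "orient b c a \<noteq> 0"
    using assms(4) orient_perms[of a b c] by auto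
  then show "angle a b c \<in> angles S" "angle b a c \<in> angles S" "angle a c b \<in> angles S"
    "angle c b a \<in> angles S" "angle c a b \<in> angles S" "angle b c a \<in> angles S"
    using 1 assms by auto
qed

lemma angles_pos: "x \<in> angles S \<Longrightarrow> 0 < x" "x \<in> angles S \<Longrightarrow> x < pi"
  by (auto simp: angles_def)

lemmas chain = three_element_chain[OF fin card3]
lemmas chain_Min = three_element_chain_Min[OF fin card3]

section \<open>Points inside a triangle\<close>

text \<open>The angle at \<open>A\<close> exceeds its parts, and the angle \<open>B D C\<close> exceeds the angle at \<open>A\<close>. So each of the six small
  angles starts a chain of three angles, hence is the minimum; as they sum to \<open>pi\<close>, they are \<open>pi / 6\<close>.\<close>
lemma interior_angles:
  assumes S: "A \<in> S" "B \<in> S" "C \<in> S" "D \<in> S"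
    and o: "0 < orient A B D" "0 < orient B C D" "0 < orient C A D"
  shows "angle B A D = pi / 6" "angle D A C = pi / 6" "angle C B D = pi / 6"
    "angle D B A = pi / 6" "angle A C D = pi / 6" "angle D C B = pi / 6"
    "angles S = {pi / 6, pi / 3, 2 * pi / 3}"
proof -
  have o4: "0 < orient A B C"
    using o by (simp add: orient_coords algebra_simps)
  define a1 a2 b1 b2 c1 c2 where "a1 = angle B A D" and "a2 = angle D A C" and "b1 = angle C B D"
    and "b2 = angle D B A" and "c1 = angle A C D" and "c2 = angle D C B"
  note defs = a1_def a2_def b1_def b2_def c1_def c2_def
  have nz: "orient A B D \<noteq> 0" "orient B C D \<noteq> 0" "orient C A D \<noteq> 0" "orient A B C \<noteq> 0" using o o4 by auto
  have small: "a1 \<in> angles S" "a2 \<in> angles S" "b1 \<in> angles S" "b2 \<in> angles S" "c1 \<in> angles S" "c2 \<in> angles S"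
    unfolding defs using angle_mem[OF S(1,2,4) nz(1)] angle_mem[OF S(2,3,4) nz(2)] angle_mem[OF S(3,1,4) nz(3)] by auto
  have A: "angle B A C = a1 + a2" unfolding defs
    using o o4 orient_perms[of C A D] by (intro angle_add) auto
  have B: "angle C B A = b1 + b2" unfolding defs
    using o o4 orient_perms[of A B D] orient_perms[of A B C] by (intro angle_add) auto
  have C: "angle A C B = c1 + c2" unfolding defs
    using o o4 orient_perms[of B C D] orient_perms[of A B C] by (intro angle_add) auto
  have mid: "a1 + a2 \<in> angles S" "b1 + b2 \<in> angles S" "c1 + c2 \<in> angles S"
    using angle_mem[OF S(1,2,3) nz(4)] A B C by auto
  have sum: "a1 + a2 + b1 + b2 + c1 + c2 = pi"
    using triangle_sum[OF nz(4)] A B C angle_commute[of A B C] by linarith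
  \<comment> \<open>for instance, \<open>B D C\<close> is the angle at \<open>A\<close> enlarged by \<open>A B D\<close> and \<open>A C D\<close>\<close>
  have big: "angle A D B = pi - a1 - b2" "angle B D C = pi - b1 - c2" "angle C D A = pi - c1 - a2"
    unfolding defs
    using triangle_sum[OF nz(1)] triangle_sum[OF nz(2)] triangle_sum[OF nz(3)]
      angle_commute[of A B D] angle_commute[of B C D] angle_commute[of C A D] by linarith+
  have large: "pi - a1 - b2 \<in> angles S" "pi - b1 - c2 \<in> angles S" "pi - c1 - a2 \<in> angles S"
    using angle_mem[OF S(1,2,4) nz(1)] angle_mem[OF S(2,3,4) nz(2)] angle_mem[OF S(3,1,4) nz(3)] big by auto
  note p = small[THEN angles_pos(1)]
  have lt: "a1 + a2 < pi - b1 - c2" "b1 + b2 < pi - c1 - a2" "c1 + c2 < pi - a1 - b2"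
    using p sum by linarith+
  have t: "angles S = {a1, a1 + a2, pi - b1 - c2}"
    by (rule chain[OF small(1) mid(1) large(2)]) (use p lt in linarith)+
  have "Min (angles S) = a1" "Min (angles S) = a2"
    by (rule chain_Min[OF small(1) mid(1) large(2)] chain_Min[OF small(2) mid(1) large(2)]; use p lt in linarith)+
  moreover have "Min (angles S) = b1" "Min (angles S) = b2"
    by (rule chain_Min[OF small(3) mid(2) large(3)] chain_Min[OF small(4) mid(2) large(3)]; use p lt in linarith)+
  moreover have "Min (angles S) = c1" "Min (angles S) = c2"
    by (rule chain_Min[OF small(5) mid(3) large(1)] chain_Min[OF small(6) mid(3) large(1)]; use p lt in linarith)+
  ultimately have all: "a1 = pi / 6 \<and> a2 = pi / 6 \<and> b1 = pi / 6 \<and> b2 = pi / 6 \<and> c1 = pi / 6 \<and> c2 = pi / 6"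
    using sum by linarith
  then show "angle B A D = pi / 6" "angle D A C = pi / 6" "angle C B D = pi / 6"
    "angle D B A = pi / 6" "angle A C D = pi / 6" "angle D C B = pi / 6"
    unfolding defs by auto
  have "a1 = pi / 6" "a1 + a2 = pi / 3" "pi - b1 - c2 = 2 * pi / 3" using all by linarith+
  then show "angles S = {pi / 6, pi / 3, 2 * pi / 3}" unfolding t by (simp only:)
qed

text \<open>The sector \<open>A D B\<close> has angle \<open>2 * pi / 3\<close>, so \<open>X\<close> halves it, and then \<open>A D X\<close> is equilateral. Hence
  \<open>A\<close> sees \<open>X\<close> and \<open>C\<close> at the angle \<open>pi / 3 + pi / 6\<close>, a right angle.\<close>
lemma interior_no_point_in_sector:
  assumes S: "A \<in> S" "B \<in> S" "C \<in> S" "D \<in> S" "X \<in> S"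
    and o: "0 < orient A B D" "0 < orient B C D" "0 < orient C A D"
    and X: "0 < orient D A X" "0 < orient D X B"
  shows False
proof -
  note ia = interior_angles[OF S(1-4) o]
  have nz: "orient A B D \<noteq> 0" "orient D A X \<noteq> 0" "orient D X B \<noteq> 0" using o X by auto
  have "angle A D B = 2 * pi / 3"
    using triangle_sum[OF nz(1)] ia(1,4) angle_commute[of A B D] by simp
  moreover have "angle A D B = angle A D X + angle X D B"
    using o X orient_perms[of A B D] by (intro angle_add) auto
  ultimately have "angle A D X + angle X D B = 2 * pi / 3" by simp
  moreover have "angle A D X \<in> angles S" "angle X D B \<in> angles S"
    using angle_mem[OF S(4,1,5) nz(2)] angle_mem[OF S(4,5,2) nz(3)] by auto
  ultimately have 1: "angle A D X = pi / 3" unfolding ia(7) using pi_gt_zero by auto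
  have "angle X A D \<in> angles S" "angle A X D \<in> angles S" using angle_mem[OF S(4,1,5) nz(2)] by auto
  moreover have "angle X A D + angle A X D = 2 * pi / 3"
    using triangle_sum[OF nz(2)] 1 angle_commute[of A X D] angle_commute[of X A D] by simp
  ultimately have 2: "angle X A D = pi / 3" unfolding ia(7) using pi_gt_zero by auto
  have p: "0 < orient A X D" "0 < orient A D C" using X o orient_perms[of D A X] orient_perms[of C A D] by auto
  have s: "angle X A D + angle D A C = pi / 2" using 2 ia(2) by simp
  have p3: "0 < orient A X C" using orient_pos_of_angle_sum[OF p] s pi_gt_zero by linarith
  have "angle X A C = pi / 2" using angle_add[OF p p3] s by simp
  moreover have "angle X A C \<in> angles S" using angle_mem[of A X C] S p3 by auto
  ultimately show False unfolding ia(7) using pi_gt_zero by auto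
qed

text \<open>If \<open>X\<close> is between \<open>D\<close> and \<open>A\<close>, the line \<open>B X\<close> cuts the smallest angle \<open>D B A\<close>. If \<open>X\<close> is beyond \<open>A\<close>, the
  triangle \<open>D X B\<close> has angle sum at least \<open>2 * pi / 3 + pi / 3 + pi / 6\<close>.\<close>
lemma interior_no_point_on_ray:
  assumes S: "A \<in> S" "B \<in> S" "C \<in> S" "D \<in> S" "X \<in> S"
    and o: "0 < orient A B D" "0 < orient B C D" "0 < orient C A D"
    and X: "X = D + t *\<^sub>R (A - D)" "0 < t" "X \<noteq> A"
  shows False
proof -
  note ia = interior_angles[OF S(1-4) o]
  have AD: "A \<noteq> D" using o by auto
  have nz: "orient A B D \<noteq> 0" using o by auto
  have onz: "orient D A B \<noteq> 0" using orient_perms[of A B D] nz by auto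
  have ge: "pi / 6 \<le> x" if "x \<in> angles S" for x
  proof -
    have "x = pi / 6 \<or> x = pi / 3 \<or> x = 2 * pi / 3" using that unfolding ia(7) by simp
    then show ?thesis using pi_gt_zero by linarith
  qed
  consider "t < 1" | "t > 1" using X by force
  then show False
  proof cases
    case 1
    then have seg: "X \<in> open_segment D A" using X AD by (auto simp: open_segment_param)
    have "angle D B A = angle D B X + angle X B A" using angle_add_segment[OF seg onz] .
    moreover have "pi / 6 \<le> angle D B X" "pi / 6 \<le> angle X B A"
      using angle_mem[OF S(4,5,2)] angle_mem[OF S(5,1,2)] open_segment_orient_nonzero[OF seg onz] ge by auto
    moreover have "angle D B A = pi / 6" by (rule ia(4))
    ultimately show False using pi_gt_zero by linarith
  next
    case 2
    have "A = D + (1 / t) *\<^sub>R (X - D)" using X by simp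
    moreover have "X \<noteq> D" using X AD by auto
    ultimately have seg: "A \<in> open_segment D X" using 2 unfolding open_segment_param
      by (metis divide_less_eq_1_pos less_trans zero_less_divide_1_iff zero_less_one)
    obtain u where "orient D A B = u * orient D X B" using orient_open_segment[OF seg] by metis
    then have onz2: "orient D X B \<noteq> 0" using onz by auto
    have "angle D B X = angle D B A + angle A B X" using angle_add_segment[OF seg onz2] .
    moreover have "pi / 6 \<le> angle A B X"
      using angle_mem[OF S(1,5,2)] open_segment_orient_nonzero[OF seg onz2] ge by auto
    moreover have "pi / 6 \<le> angle D X B" using angle_mem[OF S(4,5,2) onz2] ge by auto
    moreover have "angle X D B = 2 * pi / 3"
      using triangle_sum[OF nz] ia(1,4) angle_commute[of A B D] angle_same_ray[OF seg, of B] by simp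
    ultimately show False using triangle_sum[OF onz2] ia(4) pi_gt_zero by (simp add: angle_commute[of D B X])
  qed
qed

lemma on_ray:
  assumes "orient D A X = 0" "0 < orient D A B" "0 < orient D X B"
  shows "\<exists>t>0. X = D + t *\<^sub>R (A - D)"
proof -
  define t where "t = orient D X B / orient D A B"
  have "X = D + t *\<^sub>R (A - D)"
  proof -
    have "orient D A B * (X$1 - D$1) = orient D X B * (A$1 - D$1) + orient D A X * (B$1 - D$1)"
      "orient D A B * (X$2 - D$2) = orient D X B * (A$2 - D$2) + orient D A X * (B$2 - D$2)"
      by (simp_all add: orient_coords algebra_simps)
    then have "X$1 - D$1 = t * (A$1 - D$1)" "X$2 - D$2 = t * (A$2 - D$2)"
      using assms by (simp_all add: t_def field_simps)
    then show ?thesis by (simp add: vec2_eq_iff)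
  qed
  moreover have "0 < t" using assms by (simp add: t_def)
  ultimately show ?thesis by blast
qed

text \<open>The rays from \<open>D\<close> to \<open>A\<close>, \<open>B\<close>, \<open>C\<close> and the three open sectors between them cover the plane, so a fifth
  point falls under one of the two preceding lemmas, up to a cyclic change of names. The location is
  read off from the signs of \<open>x, y, z\<close>, which satisfy a linear relation with positive coefficients.\<close>
lemma no_interior_point:
  assumes S: "A \<in> S" "B \<in> S" "C \<in> S" "D \<in> S" "X \<in> S"
    and X: "X \<noteq> A" "X \<noteq> B" "X \<noteq> C" "X \<noteq> D"
    and o: "0 < orient A B D" "0 < orient B C D" "0 < orient C A D"
  shows False
proof -
  define x y z where "x = orient D A X" and "y = orient D B X" and "z = orient D C X"
  have p: "0 < orient D A B" "0 < orient D B C" "0 < orient D C A"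
    using o orient_perms[of A B D] orient_perms[of B C D] orient_perms[of C A D] by auto
  have sw: "orient D X B = - y" "orient D X C = - z" "orient D X A = - x"
    using orient_perms[of D B X] orient_perms[of D C X] orient_perms[of D A X] by (auto simp: x_def y_def z_def)
  \<comment> \<open>the signs of \<open>x, y, z\<close> cannot all agree unless all vanish\<close>
  have sum: "orient D B C * x + orient D C A * y + orient D A B * z = 0"
    by (simp add: x_def y_def z_def orient_coords algebra_simps)
  have s1: "\<not> (0 < x \<and> y < 0)" using interior_no_point_in_sector[OF S o] sw by (auto simp: x_def)
  have s2: "\<not> (0 < y \<and> z < 0)" using interior_no_point_in_sector[OF S(2,3,1,4,5) o(2,3,1)] sw by (auto simp: y_def)
  have s3: "\<not> (0 < z \<and> x < 0)" using interior_no_point_in_sector[OF S(3,1,2,4,5) o(3,1,2)] sw by (auto simp: z_def)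
  have r1: "\<not> (x = 0 \<and> y < 0)" using on_ray[of D A X B] interior_no_point_on_ray[OF S o] p sw X by (auto simp: x_def)
  have r2: "\<not> (y = 0 \<and> z < 0)" using on_ray[of D B X C] interior_no_point_on_ray[OF S(2,3,1,4,5) o(2,3,1)] p sw X by (auto simp: y_def)
  have r3: "\<not> (z = 0 \<and> x < 0)" using on_ray[of D C X A] interior_no_point_on_ray[OF S(3,1,2,4,5) o(3,1,2)] p sw X by (auto simp: z_def)
  have nn: "0 \<le> x" "0 \<le> y" "0 \<le> z"
  proof -
    have neg: "x < 0 \<Longrightarrow> z < 0" "z < 0 \<Longrightarrow> y < 0" "y < 0 \<Longrightarrow> x < 0" using s1 s2 s3 r1 r2 r3 by linarith+
    have "\<not> (x < 0 \<and> y < 0 \<and> z < 0)"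
    proof
      assume "x < 0 \<and> y < 0 \<and> z < 0"
      then have "orient D B C * x < 0" "orient D C A * y < 0" "orient D A B * z < 0" using p by (auto simp: mult_pos_neg)
      then show False using sum by linarith
    qed
    then show "0 \<le> x" "0 \<le> y" "0 \<le> z" using neg by linarith+
  qed
  have "x = 0" "y = 0"
  proof -
    have "0 \<le> orient D B C * x" "0 \<le> orient D C A * y" "0 \<le> orient D A B * z" using nn p by auto
    then have "orient D B C * x = 0" "orient D C A * y = 0" using sum by linarith+
    then show "x = 0" "y = 0" using p by auto
  qed
  then have "orient D A B * (X$1 - D$1) = 0" "orient D A B * (X$2 - D$2) = 0"
    unfolding x_def y_def by (simp_all add: orient_coords) algebra+
  then have "X = D" using p by (simp add: vec2_eq_iff)
  then show False using X by simp
qed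

section \<open>Successive directions from one point\<close>

lemma four_rays:
  assumes S: "Q \<in> S" "R1 \<in> S" "R2 \<in> S" "R3 \<in> S" "R4 \<in> S"
    and o: "0 < orient Q R1 R2" "0 < orient Q R1 R3" "0 < orient Q R1 R4"
      "0 < orient Q R2 R3" "0 < orient Q R2 R4" "0 < orient Q R3 R4"
  shows "angle R2 Q R3 = angle R1 Q R2" "angle R3 Q R4 = angle R1 Q R2"
    "angle R1 Q R3 = 2 * angle R1 Q R2" "angle R2 Q R4 = 2 * angle R1 Q R2"
    "angle R1 Q R4 = 3 * angle R1 Q R2"
    "angles S = {angle R1 Q R2, 2 * angle R1 Q R2, 3 * angle R1 Q R2}"
proof -
  define p q r where "p = angle R1 Q R2" and "q = angle R2 Q R3" and "r = angle R3 Q R4"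
  have add: "angle R1 Q R3 = p + q" "angle R2 Q R4 = q + r" "angle R1 Q R4 = p + (q + r)"
    using angle_add[of Q R1 R2 R3] angle_add[of Q R2 R3 R4] angle_add[of Q R1 R2 R4] o
    by (auto simp: p_def q_def r_def)
  have m: "angle X Q Y \<in> angles S" if "0 < orient Q X Y" "X \<in> S" "Y \<in> S" for X Y
    using angle_mem[of Q X Y] that S by auto
  have mem: "p \<in> angles S" "q \<in> angles S" "r \<in> angles S" "p + q \<in> angles S" "q + r \<in> angles S" "p + q + r \<in> angles S"
    using m[OF o(1)] m[OF o(2)] m[OF o(3)] m[OF o(4)] m[OF o(5)] m[OF o(6)] S add by (auto simp: p_def q_def r_def add.assoc)
  have pos: "0 < p" "0 < q" "0 < r" using mem angles_pos by auto
  from three_sums_equal[OF fin card3 pos mem] add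
  show "angle R2 Q R3 = angle R1 Q R2" "angle R3 Q R4 = angle R1 Q R2"
    "angle R1 Q R3 = 2 * angle R1 Q R2" "angle R2 Q R4 = 2 * angle R1 Q R2"
    "angle R1 Q R4 = 3 * angle R1 Q R2"
    "angles S = {angle R1 Q R2, 2 * angle R1 Q R2, 3 * angle R1 Q R2}"
    by (auto simp: p_def q_def r_def)
qed

lemma no_five_rays:
  assumes S: "Q \<in> S" "R1 \<in> S" "R2 \<in> S" "R3 \<in> S" "R4 \<in> S" "R5 \<in> S"
    and o: "0 < orient Q R1 R2" "0 < orient Q R1 R3" "0 < orient Q R1 R4"
      "0 < orient Q R2 R3" "0 < orient Q R2 R4" "0 < orient Q R3 R4"
      "0 < orient Q R1 R5" "0 < orient Q R4 R5"
  shows False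
proof -
  note f = four_rays[OF S(1-5) o(1-6)]
  have "angle R1 Q R5 = angle R1 Q R4 + angle R4 Q R5"
    using o by (intro angle_add) auto
  moreover have "angle R1 Q R5 \<in> angles S" "angle R4 Q R5 \<in> angles S" "angle R1 Q R2 \<in> angles S"
    using angle_mem[of Q R1 R5] angle_mem[of Q R4 R5] angle_mem[of Q R1 R2] S o by auto
  ultimately show False using f(5) angles_pos(1) unfolding f(6) by fastforce
qed

end

section \<open>Collinear triples and the regular pentagon\<close>

lemma open_segment_shrink:
  fixes a b c d :: "real^2"
  assumes "c \<in> open_segment a b" "d \<in> open_segment c b"
  shows "d \<in> open_segment a b"
proof -
  obtain t where t: "0 < t" "t < 1" "c = a + t *\<^sub>R (b - a)" and "a \<noteq> b"
    using assms open_segment_param by auto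
  obtain u where u: "0 < u" "u < 1" "d = c + u *\<^sub>R (b - c)" using assms open_segment_param by auto
  have "d = a + (t + u * (1 - t)) *\<^sub>R (b - a)"
    unfolding u(3) t(3) by (simp add: vec2_eq_iff algebra_simps)
  moreover have "u * (1 - t) < 1 * (1 - t)" using t u by (intro mult_strict_right_mono) auto
  then have "t + u * (1 - t) < 1" by (simp add: algebra_simps)
  moreover have "0 < t + u * (1 - t)" using t u by (simp add: add_pos_pos)
  ultimately show ?thesis using \<open>a \<noteq> b\<close> open_segment_param by blast
qed

text \<open>For three consecutive angles along a straight line. If \<open>x < z\<close>, then \<open>x < z < y + z\<close> exhausts the set and
  leaves only \<open>x = y = pi / 4\<close>, \<open>z = pi / 2\<close>.\<close>
lemma half_turn_split:
  fixes T :: "real set"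
  assumes T: "finite T" "card T \<le> 3" and pos: "0 < x" "0 < y" "0 < z" and sum: "x + y + z = pi"
    and mem: "x \<in> T" "y \<in> T" "z \<in> T" "x + y \<in> T" "y + z \<in> T"
  shows "x = z \<or> T = {pi / 4, pi / 2, 3 * pi / 4}"
proof -
  have *: "T = {pi / 4, pi / 2, 3 * pi / 4}"
    if "0 < x" "0 < y" "x + y + z = pi" "x \<in> T" "y \<in> T" "z \<in> T" "x + y \<in> T" "y + z \<in> T" "x < z" for x y z
  proof -
    have t: "T = {x, z, y + z}" using that by (intro three_element_chain[OF T]) auto
    have "x + y \<in> {x, z, y + z}" "y \<in> {x, z, y + z}" unfolding t[symmetric] using that by simp_all
    then have "(x + y = x \<or> x + y = z \<or> x + y = y + z) \<and> (y = x \<or> y = z \<or> y = y + z)" by simp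
    then have "x = pi / 4" "z = pi / 2" "y + z = 3 * pi / 4" using that(1,2,3,9) by argo+
    then show ?thesis unfolding t by (simp only:)
  qed
  consider "x < z" | "x = z" | "z < x" by linarith
  then show ?thesis
  proof cases
    case 3 then show ?thesis using *[of z y x] assms by (simp add: add.commute)
  qed (use * assms in auto)
qed

text \<open>The arithmetic behind \<open>two_sides\<close>: \<open>x\<close>, \<open>y\<close> are the angles \<open>A D E\<close>, \<open>E D C\<close> and \<open>x'\<close>, \<open>y'\<close> the
  angles \<open>A E D\<close>, \<open>D E B\<close>. Unless all angles are multiples of \<open>pi / 4\<close>, which is excluded directly, the
  straight angles at \<open>D\<close> and \<open>E\<close> are split symmetrically; then \<open>x \<noteq> x'\<close> would give the four angles \<open>x, x', pi - x, pi - x'\<close>, and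
  the angles are \<open>x, pi - 2 * x, pi - x\<close>, among which \<open>3 * x - pi\<close> must occur.\<close>
lemma two_sides_arith:
  fixes T :: "real set"
  assumes T: "finite T" "card T \<le> 3" and pos: "\<forall>v\<in>T. 0 < v"
    and mem: "x \<in> T" "y \<in> T" "pi - x - y \<in> T" "x + y \<in> T" "pi - x \<in> T"
    and mem': "x' \<in> T" "y' \<in> T" "pi - x' - y' \<in> T" "x' + y' \<in> T" "pi - x' \<in> T"
    and mem2: "pi - x - x' \<in> T" "x' - y \<in> T" "x - y' \<in> T"
  shows "x = 2 * pi / 5" "x' = 2 * pi / 5" "y = pi / 5" "y' = pi / 5" "T = {pi / 5, 2 * pi / 5, 3 * pi / 5}"
proof -
  note p = mem[THEN bspec[OF pos]] mem'[THEN bspec[OF pos]] mem2[THEN bspec[OF pos]]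
  have not4: "T \<noteq> {pi / 4, pi / 2, 3 * pi / 4}"
  proof
    assume t: "T = {pi / 4, pi / 2, 3 * pi / 4}"
    have d: "v = pi / 4 \<or> v = pi / 2 \<or> v = 3 * pi / 4" if "v \<in> T" for v using that unfolding t by simp
    show False using d[OF mem(1)] d[OF mem(2)] d[OF mem'(1)] d[OF mem'(2)] d[OF mem2(1)] p by argo
  qed
  have "x = pi - x - y" using half_turn_split[OF T, of x y "pi - x - y"] p mem not4 by auto
  moreover have "x' = pi - x' - y'" using half_turn_split[OF T, of x' y' "pi - x' - y'"] p mem' not4 by auto
  ultimately have y: "y = pi - 2 * x" "y' = pi - 2 * x'" by auto
  \<comment> \<open>four different angles \<open>u < v < pi - v < pi - u\<close> would be too many\<close>
  have no: "\<not> u < v" if "u \<in> T" "v \<in> T" "pi - v \<in> T" "pi - u \<in> T" "v < pi - v" for u v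
  proof
    assume "u < v"
    then have t: "T = {u, v, pi - v}" using that by (intro three_element_chain[OF T]) auto
    have "pi - u \<in> {u, v, pi - v}" unfolding t[symmetric] using that by simp
    then show False using that \<open>u < v\<close> by auto
  qed
  have eq: "x = x'" using no[of x x'] no[of x' x] mem mem' y p by argo
  have "x \<noteq> pi - 2 * x" using p y eq by argo
  have T3: "T = {x, pi - 2 * x, pi - x}"
  proof (cases "x < pi - 2 * x")
    case True
    then show ?thesis using mem y p by (intro three_element_chain[OF T]) auto
  next
    case False
    then have "T = {pi - 2 * x, x, pi - x}" using \<open>x \<noteq> pi - 2 * x\<close> mem y p by (intro three_element_chain[OF T]) auto
    then show ?thesis by (simp add: insert_commute)
  qed
  have "x' - y \<in> {x, pi - 2 * x, pi - x}" unfolding T3[symmetric] using mem2 by simp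
  then have "x' - y = x \<or> x' - y = pi - 2 * x \<or> x' - y = pi - x" by simp
  then have x: "x = 2 * pi / 5" using y eq p by argo
  then show "x = 2 * pi / 5" "x' = 2 * pi / 5" "y = pi / 5" "y' = pi / 5" using eq y by auto
  have "pi - 2 * x = pi / 5" "pi - x = 3 * pi / 5" using x by auto
  then show "T = {pi / 5, 2 * pi / 5, 3 * pi / 5}" using T3 x by (simp only: insert_commute)
qed

context few_angles
begin

text \<open>From \<open>Q\<close> the four points are seen at equal gaps \<open>a\<close>. The angles at \<open>L2\<close> and \<open>L3\<close> are the exterior angles
  \<open>a + \<alpha>\<close> and \<open>a + \<beta>\<close> and their supplements; requiring all of them to be multiples of \<open>a\<close> up to \<open>3 * a\<close>
  leaves only \<open>\<alpha> = \<beta> = a\<close>.\<close>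
lemma four_on_line_pos:
  assumes S: "Q \<in> S" "L1 \<in> S" "L2 \<in> S" "L3 \<in> S" "L4 \<in> S"
    and o: "0 < orient Q L1 L4" and seg: "L2 \<in> open_segment L1 L4" "L3 \<in> open_segment L2 L4"
  shows "angle Q L1 L4 = pi / 5" "angle Q L4 L1 = pi / 5"
    "angle L1 Q L2 = pi / 5" "angle L2 Q L3 = pi / 5" "angle L3 Q L4 = pi / 5"
proof -
  have seg3: "L3 \<in> open_segment L1 L4" using open_segment_shrink[OF seg] .
  have o1: "0 < orient L1 L4 Q" using o orient_perms[of Q L1 L4] by linarith
  note o2 = open_segment_orient_pos[OF seg(1) o1]
  note o3 = open_segment_orient_pos[OF seg(2) o2(2)]
  note o4 = open_segment_orient_pos[OF seg3 o1]
  have ray: "0 < orient Q L1 L2" "0 < orient Q L1 L3" "0 < orient Q L1 L4" "0 < orient Q L2 L3" "0 < orient Q L2 L4"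
    "0 < orient Q L3 L4"
    using o o2 o3 o4 orient_perms[of Q L1 L2] orient_perms[of Q L1 L3] orient_perms[of Q L2 L3] orient_perms[of Q L2 L4]
      orient_perms[of Q L3 L4] by linarith+
  note f = four_rays[OF S ray]
  define a \<alpha> \<beta> where "a = angle L1 Q L2" and "\<alpha> = angle Q L1 L4" and "\<beta> = angle Q L4 L1"
  have nz: "orient Q L1 L4 \<noteq> 0" "orient Q L1 L2 \<noteq> 0" "orient Q L3 L4 \<noteq> 0" "orient Q L2 L4 \<noteq> 0" "orient Q L1 L3 \<noteq> 0" using ray by auto
  have sum: "\<alpha> + \<beta> + 3 * a = pi" using triangle_sum[OF nz(1)] f(5) by (simp add: a_def \<alpha>_def \<beta>_def)
  have s2: "angle Q L2 L1 = pi - a - \<alpha>"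
    using triangle_sum[OF nz(2)] angle_same_ray[OF seg(1), of Q] angle_commute[of Q L1 L2] angle_commute[of Q L1 L4]
    by (simp add: a_def \<alpha>_def)
  have s3: "angle Q L3 L4 = pi - a - \<beta>"
    using triangle_sum[OF nz(3)] angle_same_ray[of L3 L4 L1 Q] seg3 angle_commute[of Q L4 L3] angle_commute[of Q L4 L1] f(2)
    by (simp add: a_def \<beta>_def open_segment_commute)
  have "Q \<noteq> L2" "Q \<noteq> L3" using ray by auto
  then have s4: "angle Q L2 L4 = a + \<alpha>" "angle Q L3 L1 = a + \<beta>"
    using angle_straight[OF seg(1), of Q] angle_straight[OF seg3, of Q] s2 s3 angle_commute[of L1 L2 Q] angle_commute[of L1 L3 Q]
      angle_commute[of L4 L3 Q] by auto
  have mem: "\<alpha> \<in> angles S" "\<beta> \<in> angles S" "pi - a - \<alpha> \<in> angles S" "pi - a - \<beta> \<in> angles S" "a + \<alpha> \<in> angles S" "a + \<beta> \<in> angles S"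
    "a \<in> angles S"
    using angle_mem[OF S(1,2,5) nz(1)] angle_mem[OF S(1,2,3) nz(2)] angle_mem[OF S(1,4,5) nz(3)]
      angle_mem[OF S(1,3,5) nz(4)] angle_mem[OF S(1,2,4) nz(5)] s2 s3 s4
    by (auto simp: \<alpha>_def \<beta>_def a_def)
  have d: "v = a \<or> v = 2 * a \<or> v = 3 * a" if "v \<in> angles S" for v using that unfolding f(6) a_def by simp
  have "a = pi / 5 \<and> \<alpha> = pi / 5 \<and> \<beta> = pi / 5"
    using mem[THEN d] mem[THEN angles_pos(1)] sum by argo
  then show "angle Q L1 L4 = pi / 5" "angle Q L4 L1 = pi / 5"
    "angle L1 Q L2 = pi / 5" "angle L2 Q L3 = pi / 5" "angle L3 Q L4 = pi / 5"
    using f by (auto simp: a_def \<alpha>_def \<beta>_def)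
qed

text \<open>All angles of the figure are linear in the angles at \<open>D\<close> and \<open>E\<close>; for instance \<open>D C E\<close> is \<open>x' - y\<close>.
  This turns the hypothesis on the number of angles into the previous arithmetic statement.\<close>
lemma two_sides:
  assumes S: "A \<in> S" "B \<in> S" "C \<in> S" "D \<in> S" "E \<in> S"
    and o: "orient A B C \<noteq> 0" and D: "D \<in> open_segment A B" and E: "E \<in> open_segment A C"
  shows "angle A B C = 2 * pi / 5" "angle A C B = 2 * pi / 5" "angle D C B = pi / 5" "angle E B C = pi / 5"
proof -
  have oAC: "orient A C B \<noteq> 0" using o orient_perms[of A B C] by auto
  note oD = open_segment_orient_nonzero[OF D o]
  note oE = open_segment_orient_nonzero[OF E oAC]
  have oACD: "orient A C D \<noteq> 0" using oD(1) orient_perms[of A C D] by auto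
  have oABE: "orient A B E \<noteq> 0" using oE(1) orient_perms[of A B E] by auto
  note oE' = open_segment_orient_nonzero[OF E oACD]
  note oD' = open_segment_orient_nonzero[OF D oABE]
  define x y x' y' where "x = angle A D E" and "y = angle E D C" and "x' = angle A E D" and "y' = angle D E B"
  have DE: "D \<noteq> E" "D \<noteq> C" "E \<noteq> B" using oE' oD oE by auto
  have 1: "angle A D C = x + y" using angle_add_segment[OF E oACD] by (simp add: x_def y_def)
  have 2: "angle A E B = x' + y'" using angle_add_segment[OF D oABE] by (simp add: x'_def y'_def)
  have 3: "angle E D B = pi - x" using angle_straight[OF D, of E] DE by (simp add: x_def)
  have 4: "angle D E C = pi - x'" using angle_straight[OF E, of D] DE by (simp add: x'_def)
  have 5: "angle C D B = pi - x - y" using angle_straight[OF D, of C] DE 1 by simp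
  have 6: "angle B E C = pi - x' - y'" using angle_straight[OF E, of B] DE 2 by simp
  have 7: "angle D A E = pi - x - x'"
    using triangle_sum[OF oD'(1)] angle_commute[of D A E] by (simp add: x_def x'_def)
  have 8: "angle D C E = x' - y"
    using triangle_sum[OF oE'(2)] 4 angle_commute[of C D E] angle_commute[of C E D] angle_commute[of E C D] by (simp add: y_def)
  have 9: "angle D B E = x - y'"
    using triangle_sum[OF oD'(2)] 3 angle_commute[of B D E] angle_commute[of B E D] by (simp add: y'_def)
  have mem: "x \<in> angles S" "y \<in> angles S" "pi - x - y \<in> angles S" "x + y \<in> angles S" "pi - x \<in> angles S"
    using angle_mem[OF S(1,4,5) oD'(1)] angle_mem[OF S(5,3,4) oE'(2)] angle_mem[OF S(4,2,3) oD(2)]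
      angle_mem[OF S(1,4,3) oD(1)] angle_mem[OF S(4,2,5) oD'(2)] 1 3 5 by (auto simp: x_def y_def)
  have mem': "x' \<in> angles S" "y' \<in> angles S" "pi - x' - y' \<in> angles S" "x' + y' \<in> angles S" "pi - x' \<in> angles S"
    using angle_mem[OF S(1,4,5) oD'(1)] angle_mem[OF S(5,3,4) oE'(2)] angle_mem[OF S(5,3,2) oE(2)]
      angle_mem[OF S(1,5,2) oE(1)] angle_mem[OF S(4,2,5) oD'(2)] 2 4 6 by (auto simp: x'_def y'_def)
  have mem2: "pi - x - x' \<in> angles S" "x' - y \<in> angles S" "x - y' \<in> angles S"
    using angle_mem[OF S(1,4,5) oD'(1)] angle_mem[OF S(5,3,4) oE'(2)] angle_mem[OF S(4,2,5) oD'(2)] 7 8 9 by auto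
  have "\<forall>v\<in>angles S. 0 < v" using angles_pos by auto
  note r = two_sides_arith[OF fin card3 this mem mem' mem2]
  have d: "v = pi / 5 \<or> v = 2 * pi / 5 \<or> v = 3 * pi / 5" if "v \<in> angles S" for v using that unfolding r(5) by simp
  have 10: "angle A C B = angle A C D + angle D C B" using angle_add_segment[OF D o] .
  have 11: "angle A B C = angle A B E + angle E B C" using angle_add_segment[OF E oAC] .
  have 12: "angle A C D = pi / 5" "angle A B E = pi / 5"
    using 8 9 r angle_same_ray[of E C A D] angle_same_ray[of D B A E] D E angle_commute[of A C D] angle_commute[of D C E]
    by (auto simp: open_segment_commute)
  have 13: "angle A B C + angle A C B = 4 * pi / 5"
    using triangle_sum[OF o] 7 r angle_same_ray[OF D, of E] angle_same_ray[OF E, of B] angle_commute[of B A E] angle_commute[of C A B] by simp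
  have "angle A B C \<in> angles S" "angle A C B \<in> angles S" using angle_mem[OF S(1,2,3) o] by auto
  note ABC = this[THEN d]
  have "angle D C B \<in> angles S" "angle E B C \<in> angles S"
    using angle_mem[OF S(4,2,3) oD(2)] angle_mem[OF S(5,3,2) oE(2)] by auto
  note DCB = this[THEN d]
  show "angle A B C = 2 * pi / 5" "angle A C B = 2 * pi / 5" "angle D C B = pi / 5" "angle E B C = pi / 5"
    using 10 11 12 13 ABC DCB pi_gt_zero by argo+
qed

text \<open>Both \<open>X\<close> and \<open>Y\<close> see the other four points in successive directions, which fixes every angle as a
  multiple of \<open>a = pi / 5\<close>. These angles pass every test on angle sums; the contradiction is metric: two isosceles
  triangles give \<open>Y D = Y A = Y X\<close>, while the angles of the triangle \<open>D X Y\<close> opposite to \<open>Y X\<close> and \<open>Y D\<close>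
  are \<open>pi / 5\<close> and \<open>2 * pi / 5\<close>.\<close>
lemma no_point_on_quadrilateral_side:
  assumes S: "A \<in> S" "B \<in> S" "X \<in> S" "Y \<in> S" "D \<in> S"
    and o: "0 < orient A B X" "0 < orient A B Y" "0 < orient A X Y" "0 < orient B X Y"
    and D: "D \<in> open_segment A B"
  shows False
proof -
  obtain t where t: "0 < t" "t < 1" "D = A + t *\<^sub>R (B - A)" using D open_segment_param by auto
  have "orient D X Y = (1 - t) * orient A X Y + t * orient B X Y"
    unfolding t(3) by (simp add: orient_coords algebra_simps)
  then have oD: "0 < orient D X Y" using t o by (simp add: add_pos_pos)
  note oX = open_segment_orient_pos[OF D o(1)]
  note oY = open_segment_orient_pos[OF D o(2)]
  have rY: "0 < orient Y A D" "0 < orient Y A B" "0 < orient Y A X" "0 < orient Y D B" "0 < orient Y D X" "0 < orient Y B X"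
    using oY o oD orient_perms[of A D Y] orient_perms[of A B Y] orient_perms[of A X Y]
      orient_perms[of D B Y] orient_perms[of D X Y] orient_perms[of B X Y] by linarith+
  have rX: "0 < orient X Y A" "0 < orient X Y D" "0 < orient X Y B" "0 < orient X A D" "0 < orient X A B" "0 < orient X D B"
    using oX o oD orient_perms[of A D X] orient_perms[of A B X] orient_perms[of A X Y]
      orient_perms[of D B X] orient_perms[of D X Y] orient_perms[of B X Y] by linarith+
  note fY = four_rays[OF S(4,1,5,2,3) rY]
  note fX = four_rays[OF S(3,4,1,5,2) rX]
  define a where "a = angle A Y D"
  have apos: "0 < a" using angle_bounds[of A Y D] rY orient_perms[of A D Y] orient_perms[of A Y D] by (auto simp: a_def)
  have a'pos: "0 < angle Y X A" using angle_bounds[of Y X A] rX orient_perms[of X Y A] by auto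
  have aa: "angle Y X A = a"
  proof -
    have "a = Min (angles S)" unfolding fY(6) using apos by (intro Min_eqI[symmetric]) (auto simp: a_def)
    moreover have "angle Y X A = Min (angles S)" unfolding fX(6) using a'pos by (intro Min_eqI[symmetric]) auto
    ultimately show ?thesis by simp
  qed
  have T: "angles S = {a, 2 * a, 3 * a}" using fY(6) by (simp add: a_def)
  have nz: "orient D X Y \<noteq> 0" "orient A D Y \<noteq> 0" "orient A X Y \<noteq> 0" "orient D B X \<noteq> 0" "orient A D X \<noteq> 0" "orient D B Y \<noteq> 0"
    using oD oY oX o by auto
  define x y z where "x = angle A D Y" and "y = angle Y D X" and "z = angle X D B"
  have e: "angle D Y X = 2 * a" "angle Y X D = 2 * a" using fY(4) fX(3) aa by (auto simp: a_def)
  have y: "y = pi - 4 * a" using triangle_sum[OF nz(1)] e angle_commute[of X D Y] angle_commute[of D X Y]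
    by (simp add: y_def)
  have DXY: "X \<noteq> D" "Y \<noteq> D" using nz by auto
  have b: "angle B D Y = z + y"
    using angle_add[of D B X Y] oX oY oD orient_perms[of D B X] orient_perms[of D B Y] angle_commute[of X D B] angle_commute[of Y D X]
    by (simp add: y_def z_def)
  have x: "x = pi - (z + y)" using angle_straight[OF D DXY(2)] b angle_commute[of B D Y] by (simp add: x_def)
  have ADX: "angle A D X = x + y" using angle_straight[OF D DXY(1)] x by (simp add: z_def)
  have mem: "x \<in> angles S" "y \<in> angles S" "z \<in> angles S" "x + y \<in> angles S" "z + y \<in> angles S"
    using angle_mem[OF S(1,5,4) nz(2)] angle_mem[OF S(5,3,4) nz(1)] angle_mem[OF S(5,2,3) nz(4)]
      angle_mem[OF S(1,5,3) nz(5)] angle_mem[OF S(5,2,4) nz(6)] ADX b by (auto simp: x_def y_def z_def)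
  have d: "v = a \<or> v = 2 * a \<or> v = 3 * a" if "v \<in> angles S" for v using that unfolding T by simp
  \<comment> \<open>the triangle \<open>D X Y\<close> has angles \<open>2 * a\<close>, \<open>2 * a\<close>, \<open>y\<close>; multiples of \<open>a\<close> with the right sums exist only for \<open>a = pi / 5\<close>\<close>
  have val: "a = pi / 5 \<and> x = 2 * pi / 5 \<and> y = pi / 5"
    using mem[THEN d] x y apos by argo
  have len1: "dist Y D = dist Y A"
  proof -
    have "angle D A Y = 2 * pi / 5"
      using triangle_sum[OF nz(2)] val by (simp add: x_def a_def)
    then have 1: "angle Y A D = 2 * pi / 5" by (simp only: angle_commute[of Y A D])
    have 2: "angle Y D A = 2 * pi / 5" using val by (simp add: x_def angle_commute[of Y])
    have "orient A D Y \<noteq> 0" by (rule nz)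
    from law_of_sines[OF this] have "dist Y A * sin (2 * pi / 5) = dist Y D * sin (2 * pi / 5)"
      by (simp only: 1 2)
    moreover have "sin (2 * pi / 5) \<noteq> 0" using sin_gt_zero[of "2 * pi / 5"] pi_gt_zero by linarith
    ultimately show ?thesis by simp
  qed
  have len2: "dist Y A = dist Y X"
  proof -
    have 1: "angle Y X A = pi / 5" using aa val by simp
    moreover have "angle A Y X = 3 * pi / 5" using fY(5) val by (simp add: a_def)
    ultimately have 2: "angle Y A X = pi / 5"
      using triangle_sum[OF nz(3)] angle_commute[of X A Y] angle_commute[of A X Y] by simp
    from law_of_sines[OF nz(3)] have "dist Y A * sin (pi / 5) = dist Y X * sin (pi / 5)"
      by (simp only: 1 2)
    moreover have "sin (pi / 5) \<noteq> 0" using sin_gt_zero[of "pi / 5"] pi_gt_zero by linarith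
    ultimately show ?thesis by simp
  qed
  have "angle Y D X = pi / 5" "angle Y X D = 2 * pi / 5" using e val by (auto simp: y_def)
  with law_of_sines[OF nz(1)] have "dist Y D * sin (pi / 5) = dist Y X * sin (2 * pi / 5)"
    by (simp only:)
  moreover have "sin (pi / 5) < sin (2 * pi / 5)" by (intro sin_monotone_2pi) (use pi_gt_zero in linarith)+
  ultimately show False using len1 len2 DXY nz by auto
qed

text \<open>Each vertex trisects its angle with the same gap, since that gap is the smallest angle of the set. The triangle
  \<open>P Q1 Q2\<close>, with angles \<open>a\<close>, \<open>3 * a\<close> and \<open>a\<close>, gives \<open>a = pi / 5\<close>.\<close>
lemma pentagon_angles:
  assumes S: "P \<in> S" "Q1 \<in> S" "Q2 \<in> S" "Q3 \<in> S" "Q4 \<in> S"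
    and o: "0 < orient P Q1 Q2" "0 < orient P Q1 Q3" "0 < orient P Q1 Q4"
      "0 < orient P Q2 Q3" "0 < orient P Q2 Q4" "0 < orient P Q3 Q4"
    and c: "0 < orient Q1 Q2 Q3" "0 < orient Q1 Q2 Q4" "0 < orient Q1 Q3 Q4" "0 < orient Q2 Q3 Q4"
  shows "angle Q2 P Q1 = pi / 5" "angle Q3 P Q1 = 2 * pi / 5" "angle Q4 P Q1 = 3 * pi / 5"
    "angle Q2 Q1 P = 3 * pi / 5" "angle Q3 Q1 P = 2 * pi / 5" "angle Q4 Q1 P = pi / 5"
proof -
  note f0 = four_rays[OF S o]
  have r1: "0 < orient Q1 Q2 P" "0 < orient Q1 Q3 P" "0 < orient Q1 Q4 P"
    using o orient_perms[of P Q1 Q2] orient_perms[of P Q1 Q3] orient_perms[of P Q1 Q4] by linarith+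
  note f1 = four_rays[OF S(2,3,4,5,1) c(1,2) r1(1) c(3) r1(2,3)]
  have r2: "0 < orient Q2 Q3 P" "0 < orient Q2 Q4 P" "0 < orient Q2 Q3 Q1" "0 < orient Q2 Q4 Q1" "0 < orient Q2 P Q1"
    using o c orient_perms[of P Q2 Q3] orient_perms[of P Q2 Q4] orient_perms[of Q1 Q2 Q3] orient_perms[of Q1 Q2 Q4]
      orient_perms[of P Q1 Q2] by linarith+
  note f2 = four_rays[OF S(3,4,5,1,2) c(4) r2(1,3,2,4,5)]
  have pos: "0 < angle Q1 P Q2" "0 < angle Q2 Q1 Q3" "0 < angle Q3 Q2 Q4"
    using angle_bounds[of Q1 P Q2] angle_bounds[of Q2 Q1 Q3] angle_bounds[of Q3 Q2 Q4] o c
     orient_perms[of P Q1 Q2] orient_perms[of Q1 Q2 Q3] orient_perms[of Q2 Q3 Q4] by auto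
  have "angle Q1 P Q2 = Min (angles S)" unfolding f0(6) using pos by (intro Min_eqI[symmetric]) auto
  moreover have "angle Q2 Q1 Q3 = Min (angles S)" unfolding f1(6) using pos by (intro Min_eqI[symmetric]) auto
  moreover have "angle Q3 Q2 Q4 = Min (angles S)" unfolding f2(6) using pos by (intro Min_eqI[symmetric]) auto
  ultimately have eq: "angle Q2 Q1 Q3 = angle Q1 P Q2" "angle Q3 Q2 Q4 = angle Q1 P Q2" by auto
  have nz: "orient P Q1 Q2 \<noteq> 0" using o by auto
  have a: "angle Q1 P Q2 = pi / 5"
    using triangle_sum[OF nz] f1(5) f2(2) eq angle_commute[of P Q1 Q2] angle_commute[of P Q2 Q1] by simp
  show "angle Q2 P Q1 = pi / 5" "angle Q3 P Q1 = 2 * pi / 5" "angle Q4 P Q1 = 3 * pi / 5"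
    "angle Q2 Q1 P = 3 * pi / 5" "angle Q3 Q1 P = 2 * pi / 5" "angle Q4 Q1 P = pi / 5"
    using a eq f0 f1 by (auto simp: angle_commute[of Q2 P Q1] angle_commute[of Q3 P Q1] angle_commute[of Q4 P Q1])
qed

end

section \<open>Quadrilaterals with the crossing point of the diagonals\<close>

text \<open>The hypotheses are invariant under a cyclic change of \<open>A, B, C, D\<close> (lemma \<open>rotate\<close>), so facts are stated for the
  side \<open>A B\<close> and obtained for the other sides by interpretation.\<close>
locale crossing_diagonals = few_angles +
  fixes A B C D E :: "real^2"
  assumes in_S: "A \<in> S" "B \<in> S" "C \<in> S" "D \<in> S" "E \<in> S"
    and E_AC: "E \<in> open_segment A C" and E_BD: "E \<in> open_segment B D"
    and nondegenerate: "orient A B C \<noteq> 0"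
begin

lemma rotate: "crossing_diagonals S B C D A E"
proof unfold_locales
  have "orient A C B \<noteq> 0" using nondegenerate orient_perms[of A B C] by auto
  from open_segment_orient_nonzero(2)[OF E_AC this] have "orient B E C \<noteq> 0" using orient_perms[of E C B] by auto
  moreover obtain t where "orient B E C = t * orient B D C" using orient_open_segment[OF E_BD] by metis
  ultimately show "orient B C D \<noteq> 0" using orient_perms[of B C D] by auto
  show "E \<in> open_segment C A" using E_AC by (simp add: open_segment_commute)
qed (fact in_S E_BD)+

lemma nonzero: "orient A B E \<noteq> 0"
  using open_segment_orient_nonzero(1)[OF E_AC, of B] nondegenerate orient_perms[of A B C] orient_perms[of A B E] by auto

lemma side_sum: "angle E A B + angle E B A + angle A E B = pi"
  using triangle_sum[OF nonzero] by (simp add: angle_commute[of E A B] angle_commute[of E B A])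

lemma side_angles:
  "angle E A B \<in> angles S" "angle E B A \<in> angles S" "angle A E B \<in> angles S"
  using angle_mem[OF in_S(1,2,5) nonzero] by auto

lemma next_angle: "angle B E C = pi - angle A E B"
proof -
  have "B \<noteq> E" using nonzero by auto
  then show ?thesis using angle_straight[OF E_AC, of B] by simp
qed

lemma vertex_angle: "angle A B C = angle E B A + angle E B C"
  using angle_add_segment[OF E_AC, of B] nondegenerate orient_perms[of A B C] angle_commute[of A B E] by auto

lemma vertex_angle_mem: "angle E B A + angle E B C \<in> angles S"
  using angle_mem[OF in_S(1,2,3) nondegenerate] vertex_angle by simp

lemma diagonal_angle: "angle C A B = angle E A B" "angle A C B = angle E C B"
  using angle_same_ray[OF E_AC, of B] angle_same_ray[of E C A B] E_AC by (auto simp: open_segment_commute)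

lemma sines: "dist E A * sin (angle E A B) = dist E B * sin (angle E B A)"
  using law_of_sines[OF nonzero] .

lemma E_distinct: "E \<noteq> A" "E \<noteq> B"
  using nonzero by auto

end

context crossing_diagonals
begin

text \<open>Otherwise the angles are \<open>p1, p2, pi / 2\<close>, none larger than a right angle, so all four corners are right angles
  and each of the four triangles at \<open>E\<close> has the same base angles in the same cyclic order. By the law of sines the
  distances from \<open>E\<close> to \<open>A, B, C, D, A\<close> would form a geometric progression with ratio different from 1.\<close>
lemma right_isosceles:
  assumes w: "angle A E B = pi / 2"
  shows "angle E A B = angle E B A"
proof (rule ccontr)
  assume ne: "\<not> ?thesis"
  interpret B: crossing_diagonals S B C D A E by (rule rotate)
  interpret C: crossing_diagonals S C D A B E by (rule B.rotate)
  interpret D: crossing_diagonals S D A B C E by (rule C.rotate)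
  define p1 p2 q1 q2 r1 r2 s1 s2 where "p1 = angle E A B" and "p2 = angle E B A" and "q1 = angle E B C"
    and "q2 = angle E C B" and "r1 = angle E C D" and "r2 = angle E D C" and "s1 = angle E D A" and "s2 = angle E A D"
  note defs = p1_def p2_def q1_def q2_def r1_def r2_def s1_def s2_def
  have sums: "p1 + p2 = pi / 2" "q1 + q2 = pi / 2" "r1 + r2 = pi / 2" "s1 + s2 = pi / 2"
    using side_sum B.side_sum C.side_sum D.side_sum w next_angle B.next_angle C.next_angle unfolding defs by linarith+
  have mem: "p1 \<in> angles S" "p2 \<in> angles S" "q1 \<in> angles S" "q2 \<in> angles S" "r1 \<in> angles S" "r2 \<in> angles S"
    "s1 \<in> angles S" "s2 \<in> angles S" "pi / 2 \<in> angles S"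
    using side_angles B.side_angles C.side_angles D.side_angles w unfolding defs by auto
  note pos = mem[THEN angles_pos(1)]
  have T: "angles S = {p1, p2, pi / 2}"
  proof (cases "p1 < p2")
    case True
    then show ?thesis using mem pos sums by (intro chain) auto
  next
    case False
    then have "p2 < p1" using ne by (auto simp: p1_def p2_def)
    then have "angles S = {p2, p1, pi / 2}" using mem pos sums by (intro chain) auto
    then show ?thesis by (simp add: insert_commute)
  qed
  have le: "v \<le> pi / 2" if "v \<in> angles S" for v
  proof -
    have "v = p1 \<or> v = p2 \<or> v = pi / 2" using that unfolding T by simp
    then show ?thesis using pos sums by argo
  qed
  have "p2 + q1 \<le> pi / 2" "q2 + r1 \<le> pi / 2" "r2 + s1 \<le> pi / 2" "s2 + p1 \<le> pi / 2"
    using le[OF vertex_angle_mem] le[OF B.vertex_angle_mem] le[OF C.vertex_angle_mem] le[OF D.vertex_angle_mem]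
    unfolding defs by linarith+
  then have eq: "q1 = p1" "q2 = p2" "r1 = p1" "r2 = p2" "s1 = p1" "s2 = p2" using sums by linarith+
  have "dist E A * sin p1 = dist E B * sin p2" "dist E B * sin p1 = dist E C * sin p2"
    "dist E C * sin p1 = dist E D * sin p2" "dist E D * sin p1 = dist E A * sin p2"
    using sines B.sines C.sines D.sines eq[unfolded defs] by (auto simp: p1_def p2_def)
  then have "(dist E A + dist E B + dist E C + dist E D) * sin p1 = (dist E A + dist E B + dist E C + dist E D) * sin p2"
    by (simp add: distrib_right)
  moreover have "0 < dist E A + dist E B + dist E C + dist E D"
    using E_distinct by (simp add: add_pos_nonneg)
  ultimately have "sin p1 = sin p2" by simp
  moreover have "- (pi / 2) \<le> p1" "p1 \<le> pi / 2" "- (pi / 2) \<le> p2" "p2 \<le> pi / 2" using pos sums by linarith+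
  ultimately have "p1 = p2" using sin_inj_pi by blast
  then show False using ne by (simp add: p1_def p2_def)
qed

lemma right_crossing:
  assumes w: "angle A E B = pi / 2"
  shows "angle E A B = pi / 4" "angle E B A = pi / 4" "angle C A B = pi / 4" "angle C B A = pi / 2"
    "angle D A B = pi / 2" "angle D B A = pi / 4"
proof -
  interpret B: crossing_diagonals S B C D A E by (rule rotate)
  interpret C: crossing_diagonals S C D A B E by (rule B.rotate)
  interpret D: crossing_diagonals S D A B C E by (rule C.rotate)
  have w': "angle B E C = pi / 2" "angle C E D = pi / 2" "angle D E A = pi / 2"
    using w next_angle B.next_angle C.next_angle by simp_all
  have 1: "angle E A B = pi / 4" "angle E B A = pi / 4" using right_isosceles[OF w] side_sum w by auto
  have 2: "angle E B C = pi / 4" using B.right_isosceles[OF w'(1)] B.side_sum w'(1) by auto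
  have 3: "angle E A D = pi / 4" using D.right_isosceles[OF w'(3)] D.side_sum w'(3) by auto
  show "angle E A B = pi / 4" "angle E B A = pi / 4" by (rule 1)+
  show "angle C A B = pi / 4" using diagonal_angle 1 by simp
  show "angle C B A = pi / 2" using vertex_angle 1 2 by (simp add: angle_commute[of C B A])
  show "angle D A B = pi / 2" using D.vertex_angle 1 3 by simp
  show "angle D B A = pi / 4" using D.diagonal_angle 1 by (simp add: angle_commute[of D B A] angle_commute[of E B A])
qed

text \<open>The triangles over \<open>B C\<close> and \<open>D A\<close> have base angles with sum \<open>w\<close>, the smaller crossing angle; as they are below \<open>w\<close>,
  they are all equal. So \<open>q1 < w < pi - w\<close> are all the angles, and the corners leave only \<open>q1 = pi / 5\<close>. Angles alone
  do not exclude a parallelogram with these values; the law of sines does.\<close>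
lemma acute_crossing:
  assumes w: "angle A E B < pi / 2"
  shows "angle E B C = pi / 5" "angle E C B = pi / 5" "angle E A D = pi / 5" "angle E D A = pi / 5"
    "angle A B C = 3 * pi / 5 \<and> angle D C B = 3 * pi / 5 \<or> angle C D A = 3 * pi / 5 \<and> angle B A D = 3 * pi / 5"
proof -
  interpret B: crossing_diagonals S B C D A E by (rule rotate)
  interpret C: crossing_diagonals S C D A B E by (rule B.rotate)
  interpret D: crossing_diagonals S D A B C E by (rule C.rotate)
  define p1 p2 q1 q2 r1 r2 s1 s2 w where "p1 = angle E A B" and "p2 = angle E B A" and "q1 = angle E B C"
    and "q2 = angle E C B" and "r1 = angle E C D" and "r2 = angle E D C" and "s1 = angle E D A" and "s2 = angle E A D"
    and "w = angle A E B"
  note defs = p1_def p2_def q1_def q2_def r1_def r2_def s1_def s2_def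
  have sums: "p1 + p2 = pi - w" "q1 + q2 = w" "r1 + r2 = pi - w" "s1 + s2 = w"
    using side_sum B.side_sum C.side_sum D.side_sum next_angle B.next_angle C.next_angle unfolding defs w_def by linarith+
  have mem: "p1 \<in> angles S" "p2 \<in> angles S" "q1 \<in> angles S" "q2 \<in> angles S" "r1 \<in> angles S" "r2 \<in> angles S"
    "s1 \<in> angles S" "s2 \<in> angles S" "w \<in> angles S" "pi - w \<in> angles S"
    using side_angles B.side_angles C.side_angles D.side_angles next_angle unfolding defs w_def by auto
  note pos = mem[THEN angles_pos(1)]
  have wlt: "w < pi / 2" using assms by (simp add: w_def)
  have T: "angles S = {q1, w, pi - w}" using mem pos sums wlt by (intro chain) auto
  have d: "v = q1 \<or> v = w \<or> v = pi - w" if "v \<in> angles S" for v using that unfolding T by simp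
  have q: "q2 = q1" "s1 = q1" "s2 = q1" "w = 2 * q1"
    using d[OF mem(4)] d[OF mem(7)] d[OF mem(8)] pos sums wlt by argo+
  have v: "p2 + q1 \<in> angles S" "q2 + r1 \<in> angles S" "r2 + s1 \<in> angles S" "s2 + p1 \<in> angles S"
    using vertex_angle_mem B.vertex_angle_mem C.vertex_angle_mem D.vertex_angle_mem unfolding defs by auto
  have p: "q1 = pi / 5 \<and> (p1 = pi / 5 \<and> p2 = 2 * pi / 5 \<or> p1 = 2 * pi / 5 \<and> p2 = pi / 5)"
    using d[OF mem(1)] d[OF mem(2)] d[OF v(1)] d[OF v(4)] pos sums q wlt by argo
  have r: "r1 = pi / 5 \<and> r2 = 2 * pi / 5 \<or> r1 = 2 * pi / 5 \<and> r2 = pi / 5"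
    using d[OF mem(5)] d[OF mem(6)] d[OF v(2)] d[OF v(3)] pos sums q p wlt by argo
  define \<sigma> \<tau> where "\<sigma> = sin (pi / 5)" and "\<tau> = sin (2 * pi / 5)"
  have st: "0 < \<sigma>" "\<sigma> < \<tau>" unfolding \<sigma>_def \<tau>_def
    by (rule sin_gt_zero sin_monotone_2pi; use pi_gt_zero in linarith)+
  have len: "dist E B = dist E C" "dist E D = dist E A"
    using B.sines D.sines st p q by (auto simp: defs[symmetric] \<sigma>_def)
  have no: False if "dist E A * x = dist E B * y" "dist E C * x = dist E D * y" "x \<noteq> y" for x y
  proof -
    have "(dist E A + dist E B) * x = (dist E A + dist E B) * y" using that len by (simp add: distrib_right)
    moreover have "0 < dist E A + dist E B" using E_distinct by (simp add: add_pos_nonneg)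
    ultimately show False using that(3) by simp
  qed
  have l: "dist E A * sin p1 = dist E B * sin p2" "dist E C * sin r1 = dist E D * sin r2"
    using sines C.sines by (simp_all add: defs)
  \<comment> \<open>equal choices on both legs would make the figure a parallelogram that is not a rectangle but has \<open>E B = E C\<close>\<close>
  have n1: "\<not> (p1 = pi / 5 \<and> p2 = 2 * pi / 5 \<and> r1 = pi / 5 \<and> r2 = 2 * pi / 5)"
    using no[of \<sigma> \<tau>] l st unfolding \<sigma>_def \<tau>_def by force
  have n2: "\<not> (p1 = 2 * pi / 5 \<and> p2 = pi / 5 \<and> r1 = 2 * pi / 5 \<and> r2 = pi / 5)"
    using no[of \<tau> \<sigma>] l st unfolding \<sigma>_def \<tau>_def by force
  have "p2 = 2 * pi / 5 \<and> r1 = 2 * pi / 5 \<or> r2 = 2 * pi / 5 \<and> p1 = 2 * pi / 5" using n1 n2 p r by argo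
  moreover have "angle A B C = p2 + q1" "angle D C B = q2 + r1" "angle C D A = r2 + s1" "angle B A D = s2 + p1"
    using vertex_angle B.vertex_angle C.vertex_angle D.vertex_angle
    by (simp_all add: defs angle_commute[of D C B] angle_commute[of B A D])
  ultimately show "angle A B C = 3 * pi / 5 \<and> angle D C B = 3 * pi / 5 \<or> angle C D A = 3 * pi / 5 \<and> angle B A D = 3 * pi / 5"
    using p q by argo
  show "angle E B C = pi / 5" "angle E C B = pi / 5" "angle E A D = pi / 5" "angle E D A = pi / 5"
    using p q by (auto simp: defs)
qed

end

section \<open>Order of points on lines and around a point\<close>

text \<open>Betweenness on a line, recognised from a point off the line.\<close>
lemma between_of_orient:
  assumes "orient a b c = 0" "0 < orient Q a b" "0 < orient Q b c"
  shows "b \<in> open_segment a c"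
proof -
  have s: "orient Q a c = orient Q a b + orient Q b c"
    using assms(1) by (simp add: orient_coords algebra_simps)
  then have pos: "0 < orient Q a c" using assms by simp
  define t where "t = orient Q a b / orient Q a c"
  have "orient Q a c * (b$1 - a$1) = orient Q a b * (c$1 - a$1) - orient a b c * (Q$1 - a$1)"
    "orient Q a c * (b$2 - a$2) = orient Q a b * (c$2 - a$2) - orient a b c * (Q$2 - a$2)"
    by (simp_all add: orient_coords algebra_simps)
  then have "b$1 - a$1 = t * (c$1 - a$1)" "b$2 - a$2 = t * (c$2 - a$2)"
    using assms(1) pos by (simp_all add: t_def field_simps)
  then have "b = a + t *\<^sub>R (c - a)" by (simp add: vec2_eq_iff)
  moreover have "0 < t" "t < 1" using s assms pos by (simp_all add: t_def)
  moreover have "a \<noteq> c" using pos by auto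
  ultimately show ?thesis using open_segment_param by blast
qed

lemma same_ray_cases:
  assumes "orient A X Y = 0" "0 < orient A B X * orient A B Y" "X \<noteq> Y"
  shows "X \<in> open_segment A Y \<or> Y \<in> open_segment A X"
proof -
  have *: "Y \<in> open_segment A X \<or> t \<ge> 1" if "0 < t" "Y = A + t *\<^sub>R (X - A)" "X \<noteq> A" for t X Y
    using that open_segment_param by force
  define t where "t = orient A B Y / orient A B X"
  have nz: "orient A B X \<noteq> 0" using assms(2) by auto
  have "orient A B X * (Y$1 - A$1) = orient A B Y * (X$1 - A$1) - orient A X Y * (B$1 - A$1)"
    "orient A B X * (Y$2 - A$2) = orient A B Y * (X$2 - A$2) - orient A X Y * (B$2 - A$2)"
    by (simp_all add: orient_coords algebra_simps)
  then have "Y$1 - A$1 = t * (X$1 - A$1)" "Y$2 - A$2 = t * (X$2 - A$2)"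
    using assms(1) nz by (simp_all add: t_def field_simps)
  then have Y: "Y = A + t *\<^sub>R (X - A)" by (simp add: vec2_eq_iff)
  have t: "0 < t" using assms(2) by (auto simp: t_def zero_less_divide_iff zero_less_mult_iff)
  have "t \<noteq> 1" using Y assms(3) by auto
  have X: "X = A + (1 / t) *\<^sub>R (Y - A)" using Y t by simp
  have XA: "X \<noteq> A" "Y \<noteq> A" using assms(2) by auto
  show ?thesis using *[OF t Y XA(1)] *[of "1 / t", OF _ X XA(2)] t \<open>t \<noteq> 1\<close> by auto
qed

lemma orient_zero_line:
  assumes "orient a b c = 0" "orient a b d = 0" "a \<noteq> b"
  shows "orient a c d = 0"
proof -
  have "(b$1 - a$1) * orient a c d = 0" "(b$2 - a$2) * orient a c d = 0"
    using assms(1,2) unfolding orient_coords by algebra+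
  then show ?thesis using assms(3) by (auto simp: vec2_eq_iff)
qed

lemma orient_zero_line3:
  assumes "orient a b c = 0" "orient a b d = 0" "orient a b e = 0" "a \<noteq> b"
  shows "orient c d e = 0"
proof -
  have "orient a c d = 0" "orient a d e = 0" "orient a c e = 0" using assms orient_zero_line by blast+
  moreover have "orient c d e = orient a c d + orient a d e - orient a c e" by (simp add: orient_coords algebra_simps)
  ultimately show ?thesis by simp
qed

text \<open>Links \<open>collinear\<close> with signed areas over a fixed base.\<close>
lemma collinear_orient:
  assumes "a \<in> S" "b \<in> S" "a \<noteq> b"
  shows "collinear S \<longleftrightarrow> (\<forall>c\<in>S. orient a b c = 0)"
proof
  assume "collinear S"
  then obtain u where u: "\<And>x y. x \<in> S \<Longrightarrow> y \<in> S \<Longrightarrow> \<exists>c. x - y = c *\<^sub>R u" unfolding collinear_def by blast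
  show "\<forall>c\<in>S. orient a b c = 0"
  proof
    fix c assume "c \<in> S"
    then obtain k l where kl: "b - a = k *\<^sub>R u" "c - a = l *\<^sub>R u" using u assms by meson
    show "orient a b c = 0" by (simp add: orient_def kl cross2_def)
  qed
next
  assume o: "\<forall>c\<in>S. orient a b c = 0"
  have on: "\<exists>t. c = a + t *\<^sub>R (b - a)" if "c \<in> S" for c
  proof (cases "a$1 = b$1")
    case True
    then have ne: "b$2 - a$2 \<noteq> 0" using assms by (auto simp: vec2_eq_iff)
    have "(b$2 - a$2) * (c$1 - a$1) = 0" using o that True by (auto simp: orient_coords)
    then have "c$1 = a$1" using ne by simp
    then have "c = a + ((c$2 - a$2) / (b$2 - a$2)) *\<^sub>R (b - a)"
      using ne True by (simp add: vec2_eq_iff)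
    then show ?thesis by blast
  next
    case False
    then have ne: "b$1 - a$1 \<noteq> 0" by auto
    have "(b$1 - a$1) * (c$2 - a$2) = (b$2 - a$2) * (c$1 - a$1)" using o that by (auto simp: orient_coords)
    then have "c$2 - a$2 = (c$1 - a$1) / (b$1 - a$1) * (b$2 - a$2)" using ne by (simp add: field_simps)
    then have "c = a + ((c$1 - a$1) / (b$1 - a$1)) *\<^sub>R (b - a)"
      using ne by (simp add: vec2_eq_iff)
    then show ?thesis by blast
  qed
  show "collinear S" unfolding collinear_def
  proof (rule exI[of _ "b - a"], intro ballI)
    fix x y assume "x \<in> S" "y \<in> S"
    then obtain s t where st: "x = a + s *\<^sub>R (b - a)" "y = a + t *\<^sub>R (b - a)" using on by meson
    have "x - y = (s - t) *\<^sub>R (b - a)" unfolding st by (simp add: algebra_simps)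
    then show "\<exists>c. x - y = c *\<^sub>R (b - a)" by blast
  qed
qed

text \<open>Sorting by a relation that is a strict linear order only on the given set, as is the order of rays around a point.\<close>
lemma ex_sorted_list:
  assumes "finite T" and tot: "\<And>x y. x \<in> T \<Longrightarrow> y \<in> T \<Longrightarrow> x \<noteq> y \<Longrightarrow> R x y \<or> R y x"
    and trans: "\<And>x y z. x \<in> T \<Longrightarrow> y \<in> T \<Longrightarrow> z \<in> T \<Longrightarrow> R x y \<Longrightarrow> R y z \<Longrightarrow> R x z"
  shows "\<exists>xs. set xs = T \<and> distinct xs \<and> sorted_wrt R xs"
  using assms
proof (induction T rule: finite_induct)
  case empty
  show ?case by simp
next
  case (insert x T)
  have "\<exists>xs. set xs = T \<and> distinct xs \<and> sorted_wrt R xs"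
  proof (rule insert.IH)
    show "R y z \<or> R z y" if "y \<in> T" "z \<in> T" "y \<noteq> z" for y z using insert.prems(1) that by simp
    show "R y w" if "y \<in> T" "z \<in> T" "w \<in> T" "R y z" "R z w" for y z w using insert.prems(2)[of y z w] that by simp
  qed
  then obtain xs where xs: "set xs = T" "distinct xs" "sorted_wrt R xs" by blast
  have 1: "x \<noteq> y \<and> (R x y \<or> R y x)" if "y \<in> T" for y using insert.prems(1)[of x y] insert.hyps that by auto
  \<comment> \<open>insertion of \<open>x\<close>: the list splits into the parts before and after \<open>x\<close>\<close>
  define l where "l = filter (\<lambda>y. R y x) xs"
  define r where "r = filter (\<lambda>y. \<not> R y x) xs"
  have l: "set l \<subseteq> T" "\<forall>y\<in>set l. R y x" "sorted_wrt R l" "distinct l" unfolding l_def using xs by (auto intro: sorted_wrt_filter)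
  have r: "set r \<subseteq> T" "\<forall>y\<in>set r. R x y" "sorted_wrt R r" "distinct r" unfolding r_def using xs 1 by (auto intro: sorted_wrt_filter)
  have "set l \<union> set r = T" "set l \<inter> set r = {}" using xs by (auto simp: l_def r_def)
  moreover have "R y z" if "y \<in> set l" "z \<in> set r" for y z
    using insert.prems(2)[of y x z] that l r by blast
  ultimately have "set (l @ x # r) = insert x T \<and> distinct (l @ x # r) \<and> sorted_wrt R (l @ x # r)"
    using l r insert.hyps by (auto simp: sorted_wrt_append)
  then show ?case by blast
qed

section \<open>Configurations recorded by base angles\<close>

text \<open>The other points are recorded by their angles at \<open>P\<close> and \<open>Q\<close>. The sign of \<open>\<epsilon>\<close> says on which side of \<open>P Q\<close> they
  lie, so that mirror images are treated alike.\<close>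
definition framed :: "(real \<times> real) list \<Rightarrow> (real^2) set \<Rightarrow> bool" where
  "framed ps S \<longleftrightarrow> (\<exists>P Q Xs \<epsilon>. S = {P, Q} \<union> set Xs \<and>
     list_all2 (\<lambda>X (\<alpha>, \<beta>). 0 < \<epsilon> * orient P Q X \<and> angle X P Q = \<alpha> \<and> angle X Q P = \<beta>) Xs ps)"

lemma framedI3:
  assumes "S = {P, Q, X, Y, Z}"
    "0 < \<epsilon> * orient P Q X" "angle X P Q = fst p" "angle X Q P = snd p"
    "0 < \<epsilon> * orient P Q Y" "angle Y P Q = fst q" "angle Y Q P = snd q"
    "0 < \<epsilon> * orient P Q Z" "angle Z P Q = fst r" "angle Z Q P = snd r"
  shows "framed [p, q, r] S"
  unfolding framed_def using assms
  by (intro exI[of _ P] exI[of _ Q] exI[of _ "[X, Y, Z]"] exI[of _ \<epsilon>]) (auto simp: case_prod_beta)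

text \<open>The bases are chosen so that no other point lies on the line of the base: a side of the
  square, a side of the pentagon, the short base of the trapezoid with the crossing point of its diagonals,
  the long base of the trapezoid with the common point of its legs, and a leg of the trisected triangle.\<close>
abbreviation "square_frame \<equiv> [(pi / 4, pi / 4), (pi / 4, pi / 2), (pi / 2, pi / 4)]"
abbreviation "pentagon_frame \<equiv> [(pi / 5, 3 * pi / 5), (2 * pi / 5, 2 * pi / 5), (3 * pi / 5, pi / 5)]"
abbreviation "diagonals_frame \<equiv> [(3 * pi / 5, pi / 5), (pi / 5, 3 * pi / 5), (pi / 5, pi / 5)]"
abbreviation "legs_frame \<equiv> [(2 * pi / 5, 2 * pi / 5), (2 * pi / 5, pi / 5), (pi / 5, 2 * pi / 5)]"
abbreviation "trisected_frame \<equiv> [(pi / 5, 3 * pi / 5), (pi / 5, pi / 5), (pi / 5, 2 * pi / 5)]"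

abbreviation "frames \<equiv> {square_frame, pentagon_frame, diagonals_frame, legs_frame, trisected_frame}"

definition classified :: "(real^2) set \<Rightarrow> bool" where
  "classified S \<longleftrightarrow> (\<exists>f\<in>frames. framed f S)"

text \<open>The two alternatives of \<open>acute_crossing\<close> differ by a half turn of the labels; this is the one in which \<open>B C\<close> is the
  short base.\<close>
lemma crossing_framed_diagonals:
  assumes "crossing_diagonals S A B C D E" and S: "S = {A, B, C, D, E}"
    and a: "angle E B C = pi / 5" "angle E C B = pi / 5" "angle A B C = 3 * pi / 5" "angle D C B = 3 * pi / 5"
  shows "framed diagonals_frame S"
proof -
  interpret crossing_diagonals S A B C D E by fact
  have "orient B C A \<noteq> 0" using nondegenerate orient_perms[of A B C] by auto
  then have p: "0 < orient B C A * orient B C A" by (simp add: zero_less_mult_iff linorder_neq_iff disj_commute)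
  obtain t where "0 < t" "t < 1" "orient E C B = (1 - t) * orient A C B" using orient_open_segment[OF E_AC] by metis
  then have "orient B C E = (1 - t) * orient B C A" using orient_perms(5)[of B C E] orient_perms(5)[of B C A] by simp
  moreover obtain u where u: "0 < u" "orient B E C = u * orient B D C" using orient_open_segment[OF E_BD] by metis
  then have "orient B C D = (1 / u) * orient B C E" using orient_perms(3)[of B C E] orient_perms(3)[of B C D] by (simp add: field_simps)
  ultimately have q: "0 < orient B C A * orient B C E" "0 < orient B C A * orient B C D"
    using p u \<open>t < 1\<close> by (auto simp: zero_less_mult_iff zero_less_divide_iff mult_less_0_iff divide_less_0_iff)
  have d: "angle D B C = pi / 5" "angle A C B = pi / 5"
    using a diagonal_angle angle_same_ray[OF E_BD, of C] by auto
  show ?thesis using a d p q S by (intro framedI3[where P = B and Q = C and X = A and Y = D and Z = E and \<epsilon> = "orient B C A"]) auto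
qed

lemma crossing_classified:
  assumes "crossing_diagonals S A B C D E" and S: "S = {A, B, C, D, E}"
  shows "framed square_frame S \<or> framed diagonals_frame S"
proof -
  have acute: "framed diagonals_frame S" if c: "crossing_diagonals S A B C D E" "angle A E B < pi / 2"
    and S: "S = {A, B, C, D, E}" for A B C D
  proof -
    interpret crossing_diagonals S A B C D E by fact
    note ac = acute_crossing[OF c(2)]
    interpret B: crossing_diagonals S B C D A E by (rule rotate)
    interpret C: crossing_diagonals S C D A B E by (rule B.rotate)
    from ac(5) show ?thesis
    proof
      assume "angle A B C = 3 * pi / 5 \<and> angle D C B = 3 * pi / 5"
      then show ?thesis using ac S by (intro crossing_framed_diagonals[OF c(1)]) auto
    next
      assume "angle C D A = 3 * pi / 5 \<and> angle B A D = 3 * pi / 5"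
      then show ?thesis using ac S by (intro crossing_framed_diagonals[OF B.rotate]) auto
    qed
  qed
  interpret crossing_diagonals S A B C D E by fact
  interpret B: crossing_diagonals S B C D A E by (rule rotate)
  interpret C: crossing_diagonals S C D A B E by (rule B.rotate)
  interpret D: crossing_diagonals S D A B C E by (rule C.rotate)
  consider "angle A E B < pi / 2" | "angle A E B > pi / 2" | "angle A E B = pi / 2" by linarith
  then show ?thesis
  proof cases
    case 1
    then show ?thesis using acute[OF assms(1) _ S] by simp
  next
    case 2
    then have "angle B E C < pi / 2" using next_angle by simp
    then have "framed diagonals_frame S" using S by (intro acute[OF rotate]) auto
    then show ?thesis by simp
  next
    case 3
    note r = right_crossing[OF 3]
    have p: "0 < orient A B E * orient A B E" using nonzero by (simp add: zero_less_mult_iff linorder_neq_iff disj_commute)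
    obtain t where "0 < t" "orient A E B = t * orient A C B" using orient_open_segment[OF E_AC] by metis
    then have c: "orient A B C = (1 / t) * orient A B E" using orient_perms(3)[of A B E] orient_perms(3)[of A B C] by (simp add: field_simps)
    have "E \<in> open_segment B D" by (rule E_BD)
    then obtain u where "0 < u" "orient B E A = u * orient B D A" using orient_open_segment by metis
    then have d: "orient A B D = (1 / u) * orient A B E" using orient_perms(1)[of B E A] orient_perms(1)[of B D A] by (simp add: field_simps)
    have "0 < orient A B E * orient A B C" "0 < orient A B E * orient A B D"
      using p c d \<open>0 < t\<close> \<open>0 < u\<close> by (auto simp: zero_less_mult_iff zero_less_divide_iff divide_less_0_iff)
    then have "framed square_frame S"
      using r p S by (intro framedI3[where P = A and Q = B and X = E and Y = C and Z = D and \<epsilon> = "orient A B E"]) auto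
    then show ?thesis by simp
  qed
qed

context few_angles
begin

lemma two_sides_classified:
  assumes S: "S = {A, B, C, D, E}"
    and o: "orient A B C \<noteq> 0" and D: "D \<in> open_segment A B" and E: "E \<in> open_segment A C"
  shows "framed legs_frame S"
proof -
  have "A \<in> S" "B \<in> S" "C \<in> S" "D \<in> S" "E \<in> S" using S by auto
  note t = two_sides[OF this o D E]
  have p: "0 < orient B C A * orient B C A" using o orient_perms[of A B C]
    by (simp add: zero_less_mult_iff linorder_neq_iff disj_commute)
  obtain u where u: "u < 1" "orient D B C = (1 - u) * orient A B C" using orient_open_segment[OF D] by metis
  obtain v where v: "v < 1" "orient E C B = (1 - v) * orient A C B" using orient_open_segment[OF E] by metis
  have "orient B C D = (1 - u) * orient B C A"
    using u orient_perms(1)[of B C D] orient_perms(1)[of B C A] by simp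
  moreover have "orient B C E = (1 - v) * orient B C A"
    using v orient_perms(5)[of B C E] orient_perms(5)[of B C A] by simp
  ultimately have q: "0 < orient B C A * orient B C D" "0 < orient B C A * orient B C E"
    using u v p by (auto simp: zero_less_mult_iff mult_less_0_iff)
  have "angle D B C = 2 * pi / 5" "angle E C B = 2 * pi / 5"
    using angle_same_ray[of D B A C] angle_same_ray[of E C A B] D E t by (auto simp: open_segment_commute)
  then show ?thesis using p q t S
    by (intro framedI3[where P = B and Q = C and X = A and Y = D and Z = E and \<epsilon> = "orient B C A"]) auto
qed

lemma four_on_line_classified:
  assumes S: "S = {Q, L1, L2, L3, L4}"
    and o: "0 < orient Q L1 L4" and seg: "L2 \<in> open_segment L1 L4" "L3 \<in> open_segment L2 L4"
  shows "framed trisected_frame S"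
proof -
  have "Q \<in> S" "L1 \<in> S" "L2 \<in> S" "L3 \<in> S" "L4 \<in> S" using S by auto
  note f = four_on_line_pos[OF this o seg]
  have seg3: "L3 \<in> open_segment L1 L4" using open_segment_shrink[OF seg] .
  have o1: "0 < orient L1 L4 Q" using o orient_perms[of Q L1 L4] by linarith
  note o2 = open_segment_orient_pos[OF seg(1) o1]
  note o3 = open_segment_orient_pos[OF seg(2) o2(2)]
  note o4 = open_segment_orient_pos[OF seg3 o1]
  have ray: "0 < orient Q L1 L2" "0 < orient Q L1 L3" "0 < orient Q L2 L3" "0 < orient Q L2 L4" "0 < orient Q L3 L4"
    using o o2 o3 o4 orient_perms[of Q L1 L2] orient_perms[of Q L1 L3] orient_perms[of Q L2 L3] orient_perms[of Q L2 L4]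
      orient_perms[of Q L3 L4] by linarith+
  have "angle L1 Q L3 = 2 * pi / 5" "angle L1 Q L4 = 3 * pi / 5"
    using angle_add[of Q L1 L2 L3] angle_add[of Q L1 L3 L4] ray o f by auto
  moreover have "angle L2 L1 Q = pi / 5" "angle L3 L1 Q = pi / 5" "angle L4 L1 Q = pi / 5"
    using f(1) angle_same_ray[OF seg(1), of Q] angle_same_ray[OF seg3, of Q] angle_commute[of Q L1 L4] by auto
  moreover have "angle L4 Q L1 = angle L1 Q L4" "angle L3 Q L1 = angle L1 Q L3" "angle L2 Q L1 = angle L1 Q L2"
    by (rule angle_commute)+
  moreover have "0 < (-1) * orient L1 Q L4" "0 < (-1) * orient L1 Q L3" "0 < (-1) * orient L1 Q L2"
    using ray o orient_perms[of L1 Q L4] orient_perms[of L1 Q L3] orient_perms[of L1 Q L2] by auto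
  ultimately show ?thesis using f S
    by (intro framedI3[where P = L1 and Q = Q and X = L4 and Y = L2 and Z = L3 and \<epsilon> = "-1"]) auto
qed

text \<open>If \<open>X\<close> comes before \<open>Y\<close> in the order around \<open>A\<close>, then the sign of \<open>orient B X Y\<close> decides between two forbidden
  cases: \<open>A B X Y\<close> is a convex quadrilateral with \<open>D\<close> on a side, or \<open>X\<close> is inside the triangle \<open>A B Y\<close>.\<close>
lemma same_side:
  assumes S: "A \<in> S" "B \<in> S" "D \<in> S" "X \<in> S" "Y \<in> S" "X \<noteq> Y"
    and D: "D \<in> open_segment A B" and o: "0 < orient A B X * orient A B Y"
  shows "orient A X Y = 0 \<or> orient B X Y = 0"
proof -
  have *: "orient A X Y = 0 \<or> orient B X Y = 0"
    if S: "A \<in> S" "B \<in> S" "D \<in> S" "X \<in> S" "Y \<in> S"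
      and D: "D \<in> open_segment A B" and o: "0 < orient A B X" "0 < orient A B Y" for A B X Y
  proof -
    have pos: "orient B X Y \<le> 0" if "0 < orient A X Y" "0 < orient A B X" "0 < orient A B Y" "X \<in> S" "Y \<in> S" for X Y
    proof (rule ccontr)
      assume "\<not> orient B X Y \<le> 0"
      then show False using no_point_on_quadrilateral_side[OF S(1,2) that(4,5) S(3) that(2,3,1) _ D] by simp
    qed
    have neg: "0 \<le> orient B X Y" if "0 < orient A X Y" "0 < orient A B X" "0 < orient A B Y" "X \<in> S" "Y \<in> S" for X Y
    proof (rule ccontr)
      assume n: "\<not> 0 \<le> orient B X Y"
      have "0 < orient B Y X" "0 < orient Y A X" using n that orient_perms[of B X Y] orient_perms[of A X Y] by auto
      moreover have "D \<noteq> A" "D \<noteq> B" "D \<noteq> X" "D \<noteq> Y"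
        using open_segment_orient_pos[OF D that(2)] open_segment_orient_pos[OF D that(3)] D by (auto simp: open_segment_def)
      ultimately show False using no_interior_point[of A B Y X D] S that by auto
    qed
    consider "0 < orient A X Y" | "0 < orient A Y X" | "orient A X Y = 0" using orient_perms[of A X Y] by linarith
    then show ?thesis
    proof cases
      case 1 then show ?thesis using pos[of X Y] neg[of X Y] o S by auto
    next
      case 2 then show ?thesis using pos[of Y X] neg[of Y X] o S orient_perms[of B X Y] by auto
    qed simp
  qed
  show ?thesis
  proof (cases "0 < orient A B X")
    case True
    then show ?thesis using *[OF S(1-5) D] o by (simp add: zero_less_mult_iff)
  next
    case False
    then have "orient A B X < 0" "orient A B Y < 0" using o by (auto simp: zero_less_mult_iff)
    then have "0 < orient B A X" "0 < orient B A Y" using orient_perms[of A B X] orient_perms[of A B Y] by auto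
    then show ?thesis using *[OF S(2,1,3,4,5)] D by (auto simp: open_segment_commute)
  qed
qed

text \<open>If \<open>D\<close> is not on \<open>X Y\<close>, it is strictly inside one of the triangles \<open>A Y X\<close> and \<open>B X Y\<close>.\<close>
lemma opposite_sides:
  assumes S: "A \<in> S" "B \<in> S" "D \<in> S" "X \<in> S" "Y \<in> S"
    and D: "D \<in> open_segment A B" and o: "0 < orient A B X" "orient A B Y < 0"
  shows "orient X Y D = 0"
proof -
  note oX = open_segment_orient_pos[OF D o(1)]
  have D': "D \<in> open_segment B A" using D by (simp add: open_segment_commute)
  have "0 < orient B A Y" using o(2) orient_perms[of A B Y] by auto
  note oY = open_segment_orient_pos[OF D' this]
  have ne: "A \<noteq> B" "A \<noteq> X" "A \<noteq> Y" "B \<noteq> X" "B \<noteq> Y" "X \<noteq> Y" "D \<noteq> A" "D \<noteq> B" "D \<noteq> X" "D \<noteq> Y"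
    using o oX oY by auto
  have "\<not> 0 < orient Y X D"
  proof
    assume p: "0 < orient Y X D"
    moreover have "0 < orient A Y D" "0 < orient X A D"
      using oX oY orient_perms[of A Y D] orient_perms[of D A Y] orient_perms[of A D X] by auto
    ultimately show False using no_interior_point[of A Y X D B] S ne by auto
  qed
  moreover have "\<not> 0 < orient X Y D"
  proof
    assume p: "0 < orient X Y D"
    moreover have "0 < orient B X D" "0 < orient Y B D"
      using oX oY orient_perms[of B D Y] orient_perms[of D B X] by auto
    ultimately show False using no_interior_point[of B X Y D A] S ne by auto
  qed
  ultimately show ?thesis using orient_perms[of X Y D] by linarith
qed

end

section \<open>Five points and six points\<close>

lemma few_angles_subset:
  assumes "few_angles S" "T \<subseteq> S" shows "few_angles T"
proof -
  have "angles T \<subseteq> angles S" using assms(2) unfolding angles_def by blast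
  then show ?thesis using assms(1) unfolding few_angles_def
    by (meson card_mono finite_subset le_trans)
qed

lemma ex_lex_least:
  fixes S :: "(real^2) set"
  assumes "finite S" "S \<noteq> {}"
  shows "\<exists>P\<in>S. \<forall>Q\<in>S - {P}. P$1 < Q$1 \<or> P$1 = Q$1 \<and> P$2 < Q$2"
  using assms
proof (induction S rule: finite_ne_induct)
  case (singleton x)
  then show ?case by simp
next
  case (insert x S)
  then obtain P where P: "P \<in> S" "\<forall>Q\<in>S - {P}. P$1 < Q$1 \<or> P$1 = Q$1 \<and> P$2 < Q$2" by blast
  have "x \<noteq> P" using P insert by auto
  then have "x$1 \<noteq> P$1 \<or> x$2 \<noteq> P$2" by (auto simp: vec2_eq_iff)
  then consider "P$1 < x$1 \<or> P$1 = x$1 \<and> P$2 < x$2" | "x$1 < P$1 \<or> x$1 = P$1 \<and> x$2 < P$2"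
    by linarith
  then show ?case
  proof cases
    case 1
    then have "\<forall>Q\<in>insert x S - {P}. P$1 < Q$1 \<or> P$1 = Q$1 \<and> P$2 < Q$2" using P by auto
    then show ?thesis using P by blast
  next
    case 2
    then have "x$1 < Q$1 \<or> x$1 = Q$1 \<and> x$2 < Q$2" if "Q \<in> S" for Q
    proof (cases "Q = P")
      case False
      then have "P$1 < Q$1 \<or> P$1 = Q$1 \<and> P$2 < Q$2" using P that by simp
      then show ?thesis using 2 by linarith
    qed (use 2 in simp)
    then show ?thesis by blast
  qed
qed

text \<open>Around the lexicographically least point all others lie in a half-plane, in which turning to the left is
  transitive. Taking this extreme point as origin replaces any use of convex hulls.\<close>
lemma ex_radial_order:
  fixes S :: "(real^2) set"
  assumes S: "finite S" "S \<noteq> {}"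
    and gen: "\<And>x y z. x \<in> S \<Longrightarrow> y \<in> S \<Longrightarrow> z \<in> S \<Longrightarrow> x \<noteq> y \<Longrightarrow> y \<noteq> z \<Longrightarrow> x \<noteq> z \<Longrightarrow> orient x y z \<noteq> 0"
  shows "\<exists>P\<in>S. \<exists>qs. set qs = S - {P} \<and> distinct qs \<and> sorted_wrt (\<lambda>q r. 0 < orient P q r) qs"
proof -
  obtain P where P: "P \<in> S" "\<forall>Q\<in>S - {P}. P$1 < Q$1 \<or> P$1 = Q$1 \<and> P$2 < Q$2"
    using ex_lex_least[OF S] by blast
  have "\<exists>qs. set qs = S - {P} \<and> distinct qs \<and> sorted_wrt (\<lambda>q r. 0 < orient P q r) qs"
  proof (rule ex_sorted_list)
    fix x y assume "x \<in> S - {P}" "y \<in> S - {P}" "x \<noteq> y"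
    then have "orient P x y \<noteq> 0" using gen[of P x y] P by auto
    then show "0 < orient P x y \<or> 0 < orient P y x" using orient_perms[of P x y] by linarith
  next
    fix x y z assume m: "x \<in> S - {P}" "y \<in> S - {P}" "z \<in> S - {P}" and o: "0 < orient P x y" "0 < orient P y z"
    define u v w where "u = x - P" and "v = y - P" and "w = z - P"
    have pos: "0 < u$1 \<or> 0 = u$1 \<and> 0 < u$2" "0 < v$1 \<or> 0 = v$1 \<and> 0 < v$2" "0 < w$1 \<or> 0 = w$1 \<and> 0 < w$2"
      using P m by (auto simp: u_def v_def w_def)
    have o': "0 < cross2 u v" "0 < cross2 v w" using o by (auto simp: orient_def u_def v_def w_def)
    have id: "u$1 * cross2 v w + w$1 * cross2 u v = v$1 * cross2 u w" by (simp add: cross2_def algebra_simps)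
    have "0 < v$1"
    proof (rule ccontr)
      assume "\<not> 0 < v$1"
      then have v: "v$1 = 0" "0 < v$2" using pos by auto
      have "0 \<le> w$1" using pos by auto
      then have "0 \<le> w$1 * v$2" using v by simp
      then show False using o'(2) v by (simp add: cross2_def mult.commute)
    qed
    moreover have "0 \<le> u$1" "0 \<le> w$1" using pos by auto
    moreover have "u$1 \<noteq> 0 \<or> w$1 \<noteq> 0"
    proof (rule ccontr)
      assume "\<not> (u$1 \<noteq> 0 \<or> w$1 \<noteq> 0)"
      then have "u$1 = 0" "0 < u$2" using pos by auto
      then have "cross2 u v \<le> 0" using \<open>0 < v$1\<close> by (simp add: cross2_def)
      then show False using o' by simp
    qed
    ultimately have "0 < u$1 * cross2 v w + w$1 * cross2 u v"
      using o' by (metis add_nonneg_pos add_pos_nonneg less_eq_real_def mult_pos_pos mult_zero_left)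
    then have "0 < cross2 u w" unfolding id using \<open>0 < v$1\<close> by (simp add: zero_less_mult_iff)
    then show "0 < orient P x z" by (simp add: orient_def u_def w_def)
  qed (use S in simp)
  then show ?thesis using P by blast
qed

text \<open>A line can be described by any two of its points.\<close>
lemma orient_zero_base:
  assumes "orient a b x = 0" "orient a b y = 0" "a \<noteq> b" "x \<noteq> y" "orient x y c = 0"
  shows "orient a b c = 0"
proof -
  have "orient x y a = 0" "orient x y b = 0"
    using orient_zero_line3[OF assms(1,2) _ assms(3)] by simp_all
  then show ?thesis using orient_zero_line3[of x y a b c] assms by simp
qed

lemma ex_line_order:
  fixes T :: "(real^2) set"
  assumes "finite T" and T: "\<And>x. x \<in> T \<Longrightarrow> orient a b x = 0" and Q: "orient a b Q \<noteq> 0"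
  shows "\<exists>ls. set ls = T \<and> distinct ls \<and> sorted_wrt (\<lambda>x y. 0 < orient Q x y) ls"
proof (rule ex_sorted_list)
  have ab: "a \<noteq> b" using Q by auto
  show "0 < orient Q x y \<or> 0 < orient Q y x" if "x \<in> T" "y \<in> T" "x \<noteq> y" for x y
  proof -
    have "orient x y Q \<noteq> 0" using orient_zero_base[OF T T ab, of x y Q] that Q by auto
    then show ?thesis using orient_perms[of x y Q] by linarith
  qed
  show "0 < orient Q x z" if m: "x \<in> T" "y \<in> T" "z \<in> T" and o: "0 < orient Q x y" "0 < orient Q y z" for x y z
  proof -
    have "orient x y z = 0" using orient_zero_line3[OF T T T ab] m by blast
    then show ?thesis using o by (simp add: orient_coords algebra_simps)
  qed
qed fact

lemma ex_points_on_line: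
  fixes S :: "(real^2) set"
  assumes S: "finite S" "\<not> collinear S" and ab: "a \<in> S" "b \<in> S" "a \<noteq> b"
    and T: "T = {x \<in> S. orient a b x = 0}"
  obtains Q ls where "Q \<in> S - T" "set ls = T" "length ls = card T" "distinct ls"
    "sorted_wrt (\<lambda>x y. 0 < orient Q x y) ls"
    "\<And>x y z. x \<in> T \<Longrightarrow> y \<in> T \<Longrightarrow> z \<in> T \<Longrightarrow> orient x y z = 0"
    "\<And>x y z. x \<in> T \<Longrightarrow> y \<in> T \<Longrightarrow> x \<noteq> y \<Longrightarrow> z \<in> S - T \<Longrightarrow> orient x y z \<noteq> 0"
    "card (S - T) = card S - card T" "card T < card S"
proof -
  have "T \<subseteq> S" "finite T" using S by (auto simp: T)
  obtain Q where Q: "Q \<in> S" "orient a b Q \<noteq> 0" using S(2) collinear_orient[OF ab] by auto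
  then have QT: "Q \<in> S - T" by (simp add: T)
  obtain ls where ls: "set ls = T" "distinct ls" "sorted_wrt (\<lambda>x y. 0 < orient Q x y) ls"
    using ex_line_order[OF \<open>finite T\<close> _ Q(2)] by (auto simp: T)
  have "length ls = card T" using ls distinct_card by metis
  moreover have "orient x y z = 0" if "x \<in> T" "y \<in> T" "z \<in> T" for x y z
    using orient_zero_line3[of a b x y z] that ab by (auto simp: T)
  moreover have "orient x y z \<noteq> 0" if "x \<in> T" "y \<in> T" "x \<noteq> y" "z \<in> S - T" for x y z
    using orient_zero_base[of a b x y z] that ab by (auto simp: T)
  moreover have "card (S - T) = card S - card T" using \<open>T \<subseteq> S\<close> \<open>finite T\<close> by (simp add: card_Diff_subset)
  moreover have "card T < card S" using S(1) QT \<open>T \<subseteq> S\<close> by (intro psubset_card_mono) auto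
  ultimately show thesis using that QT ls by blast
qed

context few_angles
begin

text \<open>\<open>R\<close> is between \<open>Q\<close> and \<open>T\<close> as seen from \<open>P\<close>; on the wrong side of \<open>Q T\<close> it would be inside the triangle \<open>P Q T\<close>.\<close>
lemma radial_convex:
  assumes S: "P \<in> S" "Q \<in> S" "R \<in> S" "T \<in> S" "X \<in> S" "X \<noteq> P" "X \<noteq> Q" "X \<noteq> R" "X \<noteq> T"
    and o: "0 < orient P Q R" "0 < orient P Q T" "0 < orient P R T" "orient Q R T \<noteq> 0"
  shows "0 < orient Q R T"
proof (rule ccontr)
  assume "\<not> 0 < orient Q R T"
  then have "0 < orient Q T R" using o orient_perms[of Q R T] by linarith
  moreover have "0 < orient T P R" using o orient_perms[of P R T] by linarith
  ultimately show False using no_interior_point[of P Q T R X] S o by auto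
qed

lemma general_position_classified:
  assumes S: "finite S" "card S = 5"
    and gen: "\<And>x y z. x \<in> S \<Longrightarrow> y \<in> S \<Longrightarrow> z \<in> S \<Longrightarrow> x \<noteq> y \<Longrightarrow> y \<noteq> z \<Longrightarrow> x \<noteq> z \<Longrightarrow> orient x y z \<noteq> 0"
  shows "framed pentagon_frame S"
proof -
  obtain P qs where P: "P \<in> S" "set qs = S - {P}" "distinct qs" "sorted_wrt (\<lambda>q r. 0 < orient P q r) qs"
    using ex_radial_order[OF S(1) _ gen] S by fastforce
  have "length qs = card (S - {P})" using P distinct_card by metis
  then have "length qs = 4" using P S by simp
  then obtain Q1 Q2 Q3 Q4 where qs: "qs = [Q1, Q2, Q3, Q4]" by (auto simp: length_Suc_conv numeral_eq_Suc)
  have SS: "S = {P, Q1, Q2, Q3, Q4}" using P qs by auto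
  have m: "P \<in> S" "Q1 \<in> S" "Q2 \<in> S" "Q3 \<in> S" "Q4 \<in> S" using SS by auto
  have o: "0 < orient P Q1 Q2" "0 < orient P Q1 Q3" "0 < orient P Q1 Q4"
      "0 < orient P Q2 Q3" "0 < orient P Q2 Q4" "0 < orient P Q3 Q4" using P(4) qs by auto
  have ne: "Q1 \<noteq> Q2" "Q1 \<noteq> Q3" "Q1 \<noteq> Q4" "Q2 \<noteq> Q3" "Q2 \<noteq> Q4" "Q3 \<noteq> Q4" "P \<noteq> Q1" "P \<noteq> Q2" "P \<noteq> Q3" "P \<noteq> Q4"
    using o by auto
  have c: "0 < orient Q1 Q2 Q3" "0 < orient Q1 Q2 Q4" "0 < orient Q1 Q3 Q4" "0 < orient Q2 Q3 Q4"
    using radial_convex[OF m(1,2,3,4,5)] radial_convex[OF m(1,2,3,5,4)] radial_convex[OF m(1,2,4,5,3)]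
      radial_convex[OF m(1,3,4,5,2)] o ne m gen by auto
  note pa = pentagon_angles[OF m o c]
  show ?thesis using pa o SS
    by (intro framedI3[where P = P and Q = Q1 and X = Q2 and Y = Q3 and Z = Q4 and \<epsilon> = 1]) auto
qed

text \<open>In both cases the line \<open>X Y\<close> passes through one of the three collinear points, and the sides on which \<open>X\<close> and \<open>Y\<close> lie tell
  whether it is the middle one.\<close>
lemma pair_through:
  assumes S: "A \<in> S" "B \<in> S" "D \<in> S" "X \<in> S" "Y \<in> S" "X \<noteq> Y"
    and D: "D \<in> open_segment A B" and o: "orient A B X \<noteq> 0" "orient A B Y \<noteq> 0"
  shows "0 < orient A B X * orient A B Y \<and> (orient A X Y = 0 \<or> orient B X Y = 0) \<or>
    orient A B X * orient A B Y < 0 \<and> orient D X Y = 0"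
proof -
  consider "0 < orient A B X * orient A B Y" | "0 < orient A B X" "orient A B Y < 0" | "orient A B X < 0" "0 < orient A B Y"
    using o by (auto simp: zero_less_mult_iff linorder_neq_iff)
  then show ?thesis
  proof cases
    case 1
    then show ?thesis using same_side[OF S D 1] by simp
  next
    case 2
    then show ?thesis using opposite_sides[OF S(1-5) D 2] orient_perms[of D X Y] by (auto simp: mult_pos_neg)
  next
    case 3
    then show ?thesis using opposite_sides[OF S(1,2,3,5,4) D 3(2,1)] orient_perms[of Y X D] orient_perms[of D X Y]
      by (auto simp: mult_neg_pos)
  qed
qed

lemma collinear_triple_classified:
  assumes S: "S = {A, B, D, X, Y}" "X \<noteq> Y"
    and D: "D \<in> open_segment A B" and o: "orient A B X \<noteq> 0" "orient A B Y \<noteq> 0"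
  shows "classified S"
proof -
  have m: "A \<in> S" "B \<in> S" "D \<in> S" "X \<in> S" "Y \<in> S" using S by auto
  have D': "D \<in> open_segment B A" using D by (simp add: open_segment_commute)
  have legs: "framed legs_frame S" if o: "0 < orient A B X * orient A B Y" "orient A X Y = 0" and D: "D \<in> open_segment A B"
    and S: "S = {A, B, D, X, Y}" for A B
  proof -
    have nz: "orient A B X \<noteq> 0" "orient A B Y \<noteq> 0" using o by auto
    from same_ray_cases[OF o(2,1) \<open>X \<noteq> Y\<close>] show ?thesis
    proof
      assume "X \<in> open_segment A Y"
      then show ?thesis using S by (intro two_sides_classified[OF _ nz(2) D]) auto
    next
      assume "Y \<in> open_segment A X"
      then show ?thesis using S by (intro two_sides_classified[OF _ nz(1) D]) auto
    qed
  qed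
  have cross: "crossing_diagonals S A X B Y D" if o: "0 < orient A B X" "orient A B Y < 0" and d: "orient D X Y = 0" and m: "X \<in> S" "Y \<in> S" for X Y
  proof unfold_locales
    note oX = open_segment_orient_pos[OF D o(1)]
    obtain t where "t < 1" "orient D B Y = (1 - t) * orient A B Y" using orient_open_segment[OF D] by metis
    then have "orient D B Y < 0" using o by (simp add: mult_less_0_iff)
    then show "D \<in> open_segment X Y"
      using oX d orient_perms[of D B Y] orient_perms[of D B X] orient_perms[of D X Y] by (intro between_of_orient[of _ _ _ B]) auto
    show "orient A X B \<noteq> 0" using o orient_perms[of A X B] by auto
  qed (use S m D in auto)
  from pair_through[OF m S(2) D o] show ?thesis
  proof (elim disjE conjE)
    assume s: "0 < orient A B X * orient A B Y" "orient A X Y = 0"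
    then show ?thesis using legs[OF s D S(1)] by (simp add: classified_def)
  next
    assume s: "0 < orient A B X * orient A B Y" "orient B X Y = 0"
    then have "0 < orient B A X * orient B A Y" by (simp add: orient_perms(4)[of B A])
    then show ?thesis using legs[OF _ s(2) D'] S by (auto simp: classified_def insert_commute)
  next
    assume s: "orient A B X * orient A B Y < 0" "orient D X Y = 0"
    then consider "0 < orient A B X" "orient A B Y < 0" | "orient A B X < 0" "0 < orient A B Y" by (auto simp: mult_less_0_iff)
    then show ?thesis
    proof cases
      case 1
      have "S = {A, X, B, Y, D}" using S by auto
      from crossing_classified[OF cross[OF 1 s(2) m(4,5)] this] show ?thesis by (auto simp: classified_def)
    next
      case 2
      have "orient D Y X = 0" using s orient_perms[of D X Y] by simp
      moreover have "S = {A, Y, B, X, D}" using S by auto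
      ultimately show ?thesis using crossing_classified[OF cross[OF 2(2,1) _ m(5,4)]] by (auto simp: classified_def)
    qed
  qed
qed

lemma five_points_classified:
  assumes S: "finite S" "card S = 5" "\<not> collinear S"
  shows "classified S"
proof (cases "\<exists>a\<in>S. \<exists>b\<in>S. \<exists>c\<in>S. a \<noteq> b \<and> b \<noteq> c \<and> a \<noteq> c \<and> orient a b c = 0")
  case False
  then have "framed pentagon_frame S" using S by (intro general_position_classified) auto
  then show ?thesis by (simp add: classified_def)
next
  case True
  then obtain a b c where abc: "a \<in> S" "b \<in> S" "c \<in> S" "a \<noteq> b" "b \<noteq> c" "a \<noteq> c" "orient a b c = 0" by blast
  define T where "T = {x \<in> S. orient a b x = 0}"
  have "T \<subseteq> S" "finite T" using S by (auto simp: T_def)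
  have "{a, b, c} \<subseteq> T" using abc by (auto simp: T_def)
  then have "3 \<le> card T" using abc card_mono[OF \<open>finite T\<close>, of "{a, b, c}"] by simp
  obtain Q ls where Q: "Q \<in> S - T" and ls: "set ls = T" "length ls = card T" "distinct ls"
      "sorted_wrt (\<lambda>x y. 0 < orient Q x y) ls"
    and line: "\<And>x y z. x \<in> T \<Longrightarrow> y \<in> T \<Longrightarrow> z \<in> T \<Longrightarrow> orient x y z = 0"
    and off: "\<And>x y z. x \<in> T \<Longrightarrow> y \<in> T \<Longrightarrow> x \<noteq> y \<Longrightarrow> z \<in> S - T \<Longrightarrow> orient x y z \<noteq> 0"
    and cd: "card (S - T) = card S - card T" "card T < card S"
    by (rule ex_points_on_line[OF S(1,3) abc(1,2,4) T_def], rule that)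
  consider "card T = 4" | "card T = 3" using \<open>3 \<le> card T\<close> cd S by linarith
  then show ?thesis
  proof cases
    case 1
    then obtain l1 l2 l3 l4 where l: "ls = [l1, l2, l3, l4]" using ls(2) by (auto simp: length_Suc_conv numeral_eq_Suc)
    have T: "T = {l1, l2, l3, l4}" using ls l by auto
    have "card (S - T) = 1" using cd 1 S by simp
    then have "S - T = {Q}" using Q by (metis card_1_singletonE singletonD)
    then have SS: "S = {Q, l1, l2, l3, l4}" using T \<open>T \<subseteq> S\<close> by auto
    have o: "0 < orient Q l1 l2" "0 < orient Q l2 l3" "0 < orient Q l3 l4" "0 < orient Q l2 l4" "0 < orient Q l1 l4" using ls l by auto
    have "l2 \<in> open_segment l1 l4" "l3 \<in> open_segment l2 l4"
      using between_of_orient[OF line, of l1 l2 l4 Q] between_of_orient[OF line, of l2 l3 l4 Q] T o by auto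
    then have "framed trisected_frame S" using four_on_line_classified[OF SS o(5)] by simp
    then show ?thesis by (simp add: classified_def)
  next
    case 2
    then obtain l1 l2 l3 where l: "ls = [l1, l2, l3]" using ls(2) by (auto simp: length_Suc_conv numeral_eq_Suc)
    have T: "T = {l1, l2, l3}" using ls l by auto
    have "card (S - T) = 2" using cd 2 S by simp
    then obtain X Y where XY: "S - T = {X, Y}" "X \<noteq> Y" by (auto simp: card_2_iff)
    have o: "0 < orient Q l1 l2" "0 < orient Q l2 l3" using ls l by auto
    have "l2 \<in> open_segment l1 l3" using between_of_orient[OF line, of l1 l2 l3 Q] T o by auto
    moreover have "orient l1 l3 X \<noteq> 0" "orient l1 l3 Y \<noteq> 0" using off[of l1 l3] T XY ls l by auto
    moreover have "S = {l1, l3, l2, X, Y}" using T XY \<open>T \<subseteq> S\<close> by auto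
    ultimately show ?thesis using XY(2) collinear_triple_classified by blast
  qed
qed

text \<open>With five points on a line, the sixth has too many directions. With exactly four on a line, the line through the other
  two meets the first line once; \<open>pair_through\<close> for the consecutive triples puts this point at \<open>l2\<close> or \<open>l3\<close>, and
  for the triples with ends \<open>l1\<close> and \<open>l4\<close> puts it at an end or at both inner points. With at most three on a line, the
  three pairs among the points \<open>X, Y, Z\<close> off the line \<open>A B\<close> give lines through different points of
  \<open>A, D, B\<close>, but the number of pairs on opposite sides, which are those through \<open>D\<close>, is 0 or 2,
  and in the first case the three lines share the points \<open>A\<close> and \<open>B\<close>.
  Without three on a line, an extreme point has five directions.\<close>
lemma not_six_points:
  assumes S: "finite S" "card S = 6" "\<not> collinear S"
  shows False
proof (cases "\<exists>a\<in>S. \<exists>b\<in>S. a \<noteq> b \<and> 4 \<le> card {x \<in> S. orient a b x = 0}")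
  case True
  then obtain a b where abc: "a \<in> S" "b \<in> S" "a \<noteq> b" "4 \<le> card {x \<in> S. orient a b x = 0}" by blast
  define T where "T = {x \<in> S. orient a b x = 0}"
  have "T \<subseteq> S" using S by (auto simp: T_def)
  obtain Q ls where Q: "Q \<in> S - T" and ls: "set ls = T" "length ls = card T" "distinct ls"
      "sorted_wrt (\<lambda>x y. 0 < orient Q x y) ls"
    and line: "\<And>x y z. x \<in> T \<Longrightarrow> y \<in> T \<Longrightarrow> z \<in> T \<Longrightarrow> orient x y z = 0"
    and off: "\<And>x y z. x \<in> T \<Longrightarrow> y \<in> T \<Longrightarrow> x \<noteq> y \<Longrightarrow> z \<in> S - T \<Longrightarrow> orient x y z \<noteq> 0"
    and cd: "card (S - T) = card S - card T" "card T < card S"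
    by (rule ex_points_on_line[OF S(1,3) abc(1,2,3) T_def], rule that)
  consider "card T = 4" | "card T = 5" using abc(4) cd S unfolding T_def[symmetric] by linarith
  then show False
  proof cases
    case 2
    then obtain l1 l2 l3 l4 l5 where l: "ls = [l1, l2, l3, l4, l5]" using ls(2) by (auto simp: length_Suc_conv numeral_eq_Suc)
    have "l1 \<in> S" "l2 \<in> S" "l3 \<in> S" "l4 \<in> S" "l5 \<in> S" using ls l \<open>T \<subseteq> S\<close> by auto
    then show False using no_five_rays[of Q l1 l2 l3 l4 l5] Q ls l by auto
  next
    case 1
    then obtain l1 l2 l3 l4 where l: "ls = [l1, l2, l3, l4]" using ls(2) by (auto simp: length_Suc_conv numeral_eq_Suc)
    have T: "T = {l1, l2, l3, l4}" using ls l by auto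
    have m: "l1 \<in> S" "l2 \<in> S" "l3 \<in> S" "l4 \<in> S" using T \<open>T \<subseteq> S\<close> by auto
    have "card (S - T) = 2" using cd 1 S by simp
    then obtain X Y where XY: "S - T = {X, Y}" "X \<noteq> Y" by (auto simp: card_2_iff)
    have mXY: "X \<in> S" "Y \<in> S" using XY by auto
    have o: "0 < orient Q l1 l2" "0 < orient Q l2 l3" "0 < orient Q l3 l4" "0 < orient Q l2 l4" "0 < orient Q l1 l3" using ls l by auto
    have seg: "l2 \<in> open_segment l1 l3" "l3 \<in> open_segment l2 l4" "l2 \<in> open_segment l1 l4" "l3 \<in> open_segment l1 l4"
      using between_of_orient[OF line, of l1 l2 l3 Q] between_of_orient[OF line, of l2 l3 l4 Q]
        between_of_orient[OF line, of l1 l2 l4 Q] between_of_orient[OF line, of l1 l3 l4 Q] T o by auto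
    have ne: "l1 \<noteq> l2" "l1 \<noteq> l3" "l1 \<noteq> l4" "l2 \<noteq> l3" "l2 \<noteq> l4" "l3 \<noteq> l4" using ls l by auto
    have nz: "orient p q X \<noteq> 0" "orient p q Y \<noteq> 0" if "p \<in> T" "q \<in> T" "p \<noteq> q" for p q using off that XY by auto
    have uniq: "p = q" if "p \<in> T" "q \<in> T" "orient p X Y = 0" "orient q X Y = 0" for p q
    proof (rule ccontr)
      assume "p \<noteq> q"
      have "orient X Y p = 0" "orient X Y q = 0" using that orient_perms[of X Y p] orient_perms[of X Y q] by auto
      then have "orient p q X = 0" using orient_zero_line3[of X Y p q X] XY by simp
      then show False using nz that \<open>p \<noteq> q\<close> by blast
    qed
    have Tm: "l1 \<in> T" "l2 \<in> T" "l3 \<in> T" "l4 \<in> T" using T by auto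
    note pt1 = pair_through[OF m(1,3,2) mXY XY(2) seg(1) nz[OF Tm(1,3) ne(2)]]
    note pt2 = pair_through[OF m(2,4,3) mXY XY(2) seg(2) nz[OF Tm(2,4) ne(5)]]
    note pt3 = pair_through[OF m(1,4,2) mXY XY(2) seg(3) nz[OF Tm(1,4) ne(3)]]
    note pt4 = pair_through[OF m(1,4,3) mXY XY(2) seg(4) nz[OF Tm(1,4) ne(3)]]
    have "orient l1 X Y = 0 \<or> orient l2 X Y = 0 \<or> orient l3 X Y = 0"
      "orient l2 X Y = 0 \<or> orient l3 X Y = 0 \<or> orient l4 X Y = 0" using pt1 pt2 by blast+
    then have "orient l2 X Y = 0 \<or> orient l3 X Y = 0" using uniq Tm ne by metis
    moreover have "(orient l1 X Y = 0 \<or> orient l4 X Y = 0) \<or> (orient l2 X Y = 0 \<and> orient l3 X Y = 0)"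
      using pt3 pt4 by argo
    ultimately show False using uniq Tm ne by metis
  qed
next
  case False
  have few: "card {x \<in> S. orient a b x = 0} \<le> 3" if "a \<in> S" "b \<in> S" "a \<noteq> b" for a b
  proof -
    have "\<not> 4 \<le> card {x \<in> S. orient a b x = 0}" using False that by blast
    then show ?thesis by linarith
  qed
  show False
  proof (cases "\<exists>a\<in>S. \<exists>b\<in>S. \<exists>c\<in>S. a \<noteq> b \<and> b \<noteq> c \<and> a \<noteq> c \<and> orient a b c = 0")
    case False
    then have gen: "\<And>x y z. x \<in> S \<Longrightarrow> y \<in> S \<Longrightarrow> z \<in> S \<Longrightarrow> x \<noteq> y \<Longrightarrow> y \<noteq> z \<Longrightarrow> x \<noteq> z \<Longrightarrow> orient x y z \<noteq> 0" by blast
    have "S \<noteq> {}" using S by auto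
    then obtain P qs where P: "P \<in> S" "set qs = S - {P}" "distinct qs" "sorted_wrt (\<lambda>q r. 0 < orient P q r) qs"
      using ex_radial_order[OF S(1) _ gen] by blast
    have "length qs = card (S - {P})" using P distinct_card by metis
    then have "length qs = 5" using P S by simp
    then obtain l1 l2 l3 l4 l5 where l: "qs = [l1, l2, l3, l4, l5]" by (auto simp: length_Suc_conv numeral_eq_Suc)
    have "l1 \<in> S" "l2 \<in> S" "l3 \<in> S" "l4 \<in> S" "l5 \<in> S" using P l by auto
    then show False using no_five_rays[of P l1 l2 l3 l4 l5] P l by auto
  next
    case True
    then obtain a b c where abc: "a \<in> S" "b \<in> S" "c \<in> S" "a \<noteq> b" "b \<noteq> c" "a \<noteq> c" "orient a b c = 0" by blast
    define T where "T = {x \<in> S. orient a b x = 0}"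
    have "T \<subseteq> S" "finite T" using S by (auto simp: T_def)
    have "{a, b, c} \<subseteq> T" using abc by (auto simp: T_def)
    then have "3 \<le> card T" using abc card_mono[OF \<open>finite T\<close>, of "{a, b, c}"] by simp
    then have cT: "card T = 3" using few[OF abc(1,2,4)] by (simp add: T_def)
    obtain Q ls where Q: "Q \<in> S - T" and ls: "set ls = T" "length ls = card T" "distinct ls"
        "sorted_wrt (\<lambda>x y. 0 < orient Q x y) ls"
      and line: "\<And>x y z. x \<in> T \<Longrightarrow> y \<in> T \<Longrightarrow> z \<in> T \<Longrightarrow> orient x y z = 0"
      and off: "\<And>x y z. x \<in> T \<Longrightarrow> y \<in> T \<Longrightarrow> x \<noteq> y \<Longrightarrow> z \<in> S - T \<Longrightarrow> orient x y z \<noteq> 0"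
      and cd: "card (S - T) = card S - card T" "card T < card S"
      by (rule ex_points_on_line[OF S(1,3) abc(1,2,4) T_def], rule that)
    obtain A D B where l: "ls = [A, D, B]" using ls(2) cT by (auto simp: length_Suc_conv numeral_eq_Suc)
    have T: "T = {A, D, B}" using ls l by auto
    have "card (S - T) = 3" using S cd cT by simp
    then obtain X Y Z where XYZ: "S - T = {X, Y, Z}" "X \<noteq> Y" "Y \<noteq> Z" "X \<noteq> Z" by (auto simp: card_3_iff)
    have m: "A \<in> S" "B \<in> S" "D \<in> S" using T \<open>T \<subseteq> S\<close> by auto
    have mX: "X \<in> S" "Y \<in> S" "Z \<in> S" using XYZ by auto
    have seg: "D \<in> open_segment A B" using between_of_orient[OF line, of A D B Q] T ls l by auto
    have nz: "orient A B X \<noteq> 0" "orient A B Y \<noteq> 0" "orient A B Z \<noteq> 0" using off[of A B] T XYZ ls l by auto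
    \<comment> \<open>two of the lines through \<open>X, Y, Z\<close> with a common point of \<open>T\<close> would put four points on a line\<close>
    have four: False if "p \<in> T" "U \<in> S - T" "V \<in> S - T" "W \<in> S - T" "U \<noteq> V" "U \<noteq> W" "V \<noteq> W" "orient p U V = 0" "orient p U W = 0" for p U V W
    proof -
      have "p \<noteq> U" "p \<noteq> V" "p \<noteq> W" using that by auto
      have "{p, U, V, W} \<subseteq> {x \<in> S. orient p U x = 0}" using that \<open>T \<subseteq> S\<close> by auto
      moreover have "card {p, U, V, W} = 4" using that \<open>p \<noteq> U\<close> \<open>p \<noteq> V\<close> \<open>p \<noteq> W\<close> by simp
      ultimately have "4 \<le> card {x \<in> S. orient p U x = 0}" using S(1) card_mono[of "{x \<in> S. orient p U x = 0}" "{p, U, V, W}"] by auto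
      then show False using few[of p U] that \<open>T \<subseteq> S\<close> \<open>p \<noteq> U\<close> by auto
    qed
    have no: "\<not> (orient p X Y = 0 \<and> orient p X Z = 0)" "\<not> (orient p X Y = 0 \<and> orient p Y Z = 0)" "\<not> (orient p X Z = 0 \<and> orient p Y Z = 0)"
      if p: "p \<in> T" for p
    proof -
      have e: "orient p Y X = - orient p X Y" "orient p Z X = - orient p X Z" "orient p Z Y = - orient p Y Z"
        by (rule orient_perms(3))+
      have d: "X \<in> S - T" "Y \<in> S - T" "Z \<in> S - T" unfolding XYZ(1) by simp_all
      show "\<not> (orient p X Y = 0 \<and> orient p X Z = 0)"
        using four[OF p d(1,2,3)] XYZ(2-4) by blast
      show "\<not> (orient p X Y = 0 \<and> orient p Y Z = 0)"
        using four[OF p d(2,1,3)] XYZ(2-4) e(1) by auto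
      show "\<not> (orient p X Z = 0 \<and> orient p Y Z = 0)"
        using four[OF p d(3,1,2)] XYZ(2-4) e(2,3) by auto
    qed
    note pt = pair_through[OF m mX(1,2) XYZ(2) seg nz(1,2)] pair_through[OF m mX(1,3) XYZ(4) seg nz(1,3)]
      pair_through[OF m mX(2,3) XYZ(3) seg nz(2,3)]
    have Tm: "A \<in> T" "B \<in> T" "D \<in> T" using T by auto
    \<comment> \<open>a line separates either none or two of the three pairs\<close>
    have sg: "\<not> (orient A B X * orient A B Y < 0 \<and> 0 < orient A B X * orient A B Z \<and> 0 < orient A B Y * orient A B Z)"
      "\<not> (0 < orient A B X * orient A B Y \<and> orient A B X * orient A B Z < 0 \<and> 0 < orient A B Y * orient A B Z)"
      "\<not> (0 < orient A B X * orient A B Y \<and> 0 < orient A B X * orient A B Z \<and> orient A B Y * orient A B Z < 0)"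
      by (auto simp: zero_less_mult_iff mult_less_0_iff)
    show False using pt sg no[OF Tm(1)] no[OF Tm(2)] no[OF Tm(3)] by argo
  qed
qed

end

section \<open>Similarities and normal forms\<close>

definition is_similarity :: "(real^2 \<Rightarrow> real^2) \<Rightarrow> bool" where
  "is_similarity g \<longleftrightarrow> (\<exists>r t f. r > 0 \<and> orthogonal_transformation f \<and> g = (\<lambda>x. t + r *\<^sub>R f x))"

lemma similarity_rel_iff: "(S, T) \<in> similarity_rel \<longleftrightarrow> (\<exists>g. is_similarity g \<and> T = g ` S)"
  unfolding similarity_rel_def is_similarity_def by auto

lemma is_similarityI: "r > 0 \<Longrightarrow> orthogonal_transformation f \<Longrightarrow> is_similarity (\<lambda>x. t + r *\<^sub>R f x)"
  unfolding is_similarity_def by blast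

lemma is_similarity_id: "is_similarity (\<lambda>x. x)"
  using is_similarityI[of 1 "\<lambda>x. x" 0] by simp

lemma is_similarity_comp:
  assumes "is_similarity g" "is_similarity h" shows "is_similarity (\<lambda>x. g (h x))"
proof -
  obtain r t f where g: "r > 0" "orthogonal_transformation f" "g = (\<lambda>x. t + r *\<^sub>R f x)"
    using assms(1) unfolding is_similarity_def by blast
  obtain r' t' f' where h: "r' > 0" "orthogonal_transformation f'" "h = (\<lambda>x. t' + r' *\<^sub>R f' x)"
    using assms(2) unfolding is_similarity_def by blast
  have l: "linear f" using g by (simp add: orthogonal_transformation_def)
  have "(\<lambda>x. g (h x)) = (\<lambda>x. (t + r *\<^sub>R f t') + (r * r') *\<^sub>R (f \<circ> f') x)"
    unfolding g(3) h(3) by (simp add: linear_add[OF l] linear_scale[OF l] algebra_simps)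
  then show ?thesis using g h is_similarityI[of "r * r'" "f \<circ> f'"] by (simp add: orthogonal_transformation_compose)
qed

lemma is_similarity_inverse:
  assumes "is_similarity g"
  shows "\<exists>h. is_similarity h \<and> (\<forall>x. h (g x) = x)"
proof -
  obtain r t f where g: "r > 0" "orthogonal_transformation f" "g = (\<lambda>x. t + r *\<^sub>R f x)"
    using assms unfolding is_similarity_def by blast
  define k where "k = inv f"
  have k: "orthogonal_transformation k" unfolding k_def using g orthogonal_transformation_inv by blast
  have kf: "k (f x) = x" for x unfolding k_def using orthogonal_transformation_inj[OF g(2)] by (simp add: inv_f_f)
  have l: "linear k" using k by (simp add: orthogonal_transformation_def)
  define h where "h = (\<lambda>x. (- (1 / r) *\<^sub>R k t) + (1 / r) *\<^sub>R k x)"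
  have "is_similarity h" unfolding h_def using g k by (intro is_similarityI) auto
  moreover have "h (g x) = x" for x
    unfolding h_def g(3) using g(1) by (simp add: linear_add[OF l] linear_scale[OF l] kf algebra_simps)
  ultimately show ?thesis by blast
qed

lemma similarity_rel_refl: "(S, S) \<in> similarity_rel"
  unfolding similarity_rel_iff using is_similarity_id by force

lemma similarity_rel_sym: "(S, T) \<in> similarity_rel \<Longrightarrow> (T, S) \<in> similarity_rel"
proof -
  assume "(S, T) \<in> similarity_rel"
  then obtain g where g: "is_similarity g" "T = g ` S" unfolding similarity_rel_iff by blast
  obtain h where h: "is_similarity h" "\<And>x. h (g x) = x" using is_similarity_inverse[OF g(1)] by blast
  have "S = h ` T" using g(2) h(2) by (simp add: image_image)
  then show ?thesis unfolding similarity_rel_iff using h by blast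
qed

lemma similarity_rel_trans: "(S, T) \<in> similarity_rel \<Longrightarrow> (T, U) \<in> similarity_rel \<Longrightarrow> (S, U) \<in> similarity_rel"
proof -
  assume "(S, T) \<in> similarity_rel" "(T, U) \<in> similarity_rel"
  then obtain g h where g: "is_similarity g" "T = g ` S" and h: "is_similarity h" "U = h ` T" unfolding similarity_rel_iff by blast
  have "U = (\<lambda>x. h (g x)) ` S" using g(2) h(2) by (simp add: image_image)
  then show ?thesis unfolding similarity_rel_iff using is_similarity_comp[OF h(1) g(1)] by blast
qed

lemma is_similarity_inj: "is_similarity g \<Longrightarrow> inj g"
  using is_similarity_inverse by (metis injI)

lemma angle_similarity:
  assumes "is_similarity g" shows "angle (g a) (g b) (g c) = angle a b c"
proof -
  obtain r t f where g: "r > 0" "orthogonal_transformation f" "g = (\<lambda>x. t + r *\<^sub>R f x)"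
    using assms unfolding is_similarity_def by blast
  have l: "linear f" using g by (simp add: orthogonal_transformation_def)
  have d: "g x - g y = r *\<^sub>R f (x - y)" for x y unfolding g(3) by (simp add: linear_diff[OF l] algebra_simps)
  have "f u \<bullet> f v = u \<bullet> v" "norm (f u) = norm u" for u v
    using g(2) orthogonal_transformation_norm by (auto simp: orthogonal_transformation_def)
  then show ?thesis unfolding angle_def d using g(1) by simp
qed

lemma angles_similarity:
  assumes "is_similarity g" shows "angles (g ` S) = angles S"
proof -
  have "{angle a b c |a b c. a \<in> g ` S \<and> b \<in> g ` S \<and> c \<in> g ` S \<and> a \<noteq> b \<and> b \<noteq> c \<and> a \<noteq> c} =
    {angle a b c |a b c. a \<in> S \<and> b \<in> S \<and> c \<in> S \<and> a \<noteq> b \<and> b \<noteq> c \<and> a \<noteq> c}" (is "?L = ?R")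
  proof
    show "?L \<subseteq> ?R"
    proof
      fix x assume "x \<in> ?L"
      then obtain a b c where "x = angle (g a) (g b) (g c)" "a \<in> S" "b \<in> S" "c \<in> S" "g a \<noteq> g b" "g b \<noteq> g c" "g a \<noteq> g c"
        by blast
      then have "x = angle a b c" "a \<in> S" "b \<in> S" "c \<in> S" "a \<noteq> b" "b \<noteq> c" "a \<noteq> c"
        using angle_similarity[OF assms] by auto
      then show "x \<in> ?R" by blast
    qed
    show "?R \<subseteq> ?L"
    proof
      fix x assume "x \<in> ?R"
      then obtain a b c where abc: "x = angle a b c" "a \<in> S" "b \<in> S" "c \<in> S" "a \<noteq> b" "b \<noteq> c" "a \<noteq> c" by blast
      then have "x = angle (g a) (g b) (g c)" "g a \<in> g ` S" "g b \<in> g ` S" "g c \<in> g ` S" "g a \<noteq> g b" "g b \<noteq> g c" "g a \<noteq> g c"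
        using angle_similarity[OF assms] is_similarity_inj[OF assms] by (auto simp: inj_eq)
      then show "x \<in> ?L" by blast
    qed
  qed
  then show ?thesis unfolding angles_def by simp
qed

lemma similarity_image:
  assumes "is_similarity g" shows "g ` open_segment a b = open_segment (g a) (g b)"
    and "g ` closed_segment a b = closed_segment (g a) (g b)"
    and "g ` (affine hull X) = affine hull (g ` X)"
    and "collinear (g ` X) \<longleftrightarrow> collinear X"
proof -
  obtain r t f where g: "r > 0" "orthogonal_transformation f" "g = (\<lambda>x. t + r *\<^sub>R f x)"
    using assms unfolding is_similarity_def by blast
  define k where "k = (\<lambda>x. r *\<^sub>R f x)"
  have l: "linear k" unfolding k_def using g by (auto simp: orthogonal_transformation_def intro: linear_compose_scale_right)
  have gk: "g = (\<lambda>x. t + k x)" using g by (simp add: k_def)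
  have gc: "g = (+) t \<circ> k" by (auto simp: gk)
  have inj: "inj k" unfolding k_def using g orthogonal_transformation_inj[OF g(2)] by (auto simp: inj_on_def)
  have im: "g ` X = (+) t ` (k ` X)" for X by (auto simp: gk)
  show "g ` open_segment a b = open_segment (g a) (g b)"
    unfolding im[of "open_segment a b"] open_segment_linear_image[OF l inj, symmetric] by (simp add: gk open_segment_translation)
  show "g ` closed_segment a b = closed_segment (g a) (g b)"
    unfolding im[of "closed_segment a b"] closed_segment_linear_image[OF l, symmetric] by (simp add: gk closed_segment_translation)
  have "k ` (affine hull X) = affine hull (k ` X)" using l by (simp add: affine_hull_linear_image linear_linear)
  then show "g ` (affine hull X) = affine hull (g ` X)"
    unfolding im affine_hull_translation by simp
  show "collinear (g ` X) \<longleftrightarrow> collinear X"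
    unfolding im by (simp add: collinear_aff_dim aff_dim_translation_eq aff_dim_injective_linear_image[OF l inj])
qed

text \<open>The normal form: the base is the unit segment on the first axis and the apex with base angles \<open>\<alpha>\<close>, \<open>\<beta>\<close> is located by
  the law of sines.\<close>
definition base_points :: "(real \<times> real) list \<Rightarrow> (real^2) set" where
  "base_points ps = {0, vector [1, 0]} \<union>
     (\<lambda>(\<alpha>, \<beta>). (sin \<beta> / sin (\<alpha> + \<beta>)) *\<^sub>R vector [cos \<alpha>, sin \<alpha>]) ` set ps"

text \<open>Complex multiplication by \<open>Q - P\<close> in real coordinates, preceded by a reflection if \<open>\<sigma> = - 1\<close>.\<close>
lemma frame_similarity:
  fixes P Q :: "real^2"
  assumes "P \<noteq> Q" "\<sigma> = 1 \<or> \<sigma> = - 1"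
  shows "is_similarity (\<lambda>x. P + x$1 *\<^sub>R (Q - P) + (\<sigma> * x$2) *\<^sub>R vector [- (Q - P)$2, (Q - P)$1])"
proof -
  define r where "r = norm (Q - P)"
  have r: "0 < r" using assms by (simp add: r_def)
  define e where "e = (1 / r) *\<^sub>R (Q - P)"
  have e: "e \<bullet> e = 1" unfolding e_def r_def using assms by (simp add: dot_square_norm power2_eq_square)
  then have e': "e$1 * e$1 + e$2 * e$2 = 1" by (simp add: inner2)
  have QP: "Q - P = r *\<^sub>R e" using r by (simp add: e_def)
  define f :: "real^2 \<Rightarrow> real^2" where "f = (\<lambda>x. x$1 *\<^sub>R e + (\<sigma> * x$2) *\<^sub>R vector [- e$2, e$1])"
  have s: "\<sigma> * \<sigma> = 1" using assms by auto
  have "orthogonal_transformation f" unfolding orthogonal_transformation_def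
  proof (intro conjI allI)
    show "linear f" by (rule linearI) (simp_all add: f_def algebra_simps)
    fix v w :: "real^2"
    have "f v \<bullet> f w = (v$1 * w$1) * (e$1 * e$1 + e$2 * e$2) + (\<sigma> * \<sigma>) * (v$2 * w$2) * (e$1 * e$1 + e$2 * e$2)"
      unfolding inner2 f_def by (simp add: algebra_simps)
    then show "f v \<bullet> f w = v \<bullet> w" using e' s by (simp add: inner2)
  qed
  from is_similarityI[OF r this, of P]
  have "is_similarity (\<lambda>x. P + r *\<^sub>R f x)" .
  moreover have "(\<lambda>x. P + r *\<^sub>R f x) = (\<lambda>x. P + x$1 *\<^sub>R (Q - P) + (\<sigma> * x$2) *\<^sub>R vector [- (Q - P)$2, (Q - P)$1])"
    unfolding QP f_def by (auto simp: fun_eq_iff vec2_eq_iff algebra_simps)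
  ultimately show ?thesis by simp
qed

text \<open>The vector \<open>X - P\<close> is \<open>Q - P\<close> turned by \<open>\<alpha>\<close> and stretched by a factor that the law of sines expresses in the base
  angles.\<close>
lemma locate_by_angles:
  fixes x :: "real^2"
  assumes o: "0 < \<sigma> * orient P Q X" and s: "\<sigma> = 1 \<or> \<sigma> = - 1"
    and a: "angle X P Q = \<alpha>" and b: "angle X Q P = \<beta>"
    and x: "x = (sin \<beta> / sin (\<alpha> + \<beta>)) *\<^sub>R vector [cos \<alpha>, sin \<alpha>]"
  shows "X = P + x$1 *\<^sub>R (Q - P) + (\<sigma> * x$2) *\<^sub>R vector [- (Q - P)$2, (Q - P)$1]"
proof -
  define u v where "u = Q - P" and "v = X - P"
  have oo: "orient P Q X = cross2 u v" by (simp add: orient_def u_def v_def)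
  have nz: "orient P Q X \<noteq> 0" using o by auto
  then have uv: "u \<noteq> 0" "v \<noteq> 0" using cross2_nonzero[of u v] oo by auto
  have ang: "vangle u v = \<alpha>" using a by (simp add: angle_vangle u_def v_def vangle_commute)
  have abs: "\<bar>cross2 u v\<bar> = \<sigma> * cross2 u v" using o s oo by auto
  have c: "norm u * norm v * cos \<alpha> = u \<bullet> v" and si: "norm u * norm v * sin \<alpha> = \<sigma> * cross2 u v"
    using cos_vangle[OF uv] sin_vangle[OF uv] ang abs by auto
  have ss: "\<sigma> * \<sigma> = 1" using s by auto
  have sum: "angle P X Q = pi - (\<alpha> + \<beta>)"
    using triangle_sum[OF nz] a b angle_commute[of X P Q] angle_commute[of X Q P] by simp
  have nz': "orient Q X P \<noteq> 0" using nz orient_perms[of P Q X] by auto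
  have g: "0 < sin (\<alpha> + \<beta>)"
  proof -
    have "orient P X Q \<noteq> 0" using nz orient_perms[of P Q X] by auto
    from angle_bounds[OF this] sum show ?thesis by (intro sin_gt_zero) auto
  qed
  have "dist P Q * sin \<beta> = dist P X * sin (\<alpha> + \<beta>)"
    using law_of_sines[OF nz'] b angle_commute[of X Q P] sum by simp
  then have len: "norm u * (sin \<beta> / sin (\<alpha> + \<beta>)) = norm v"
    using g by (simp add: u_def v_def dist_norm norm_minus_commute field_simps)
  define k where "k = sin \<beta> / sin (\<alpha> + \<beta>)"
  have x': "x$1 = k * cos \<alpha>" "x$2 = k * sin \<alpha>" by (simp_all add: x k_def)
  have n2: "norm u * norm u = u$1 * u$1 + u$2 * u$2" using norm2_sq[of u] by (simp add: power2_eq_square)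
  have x1: "(norm u * norm u) * x$1 = u \<bullet> v"
    unfolding x' c[symmetric] len[folded k_def, symmetric] by (simp add: mult_ac)
  have x2: "(norm u * norm u) * (\<sigma> * x$2) = cross2 u v"
  proof -
    have "(norm u * norm u) * (\<sigma> * x$2) = \<sigma> * (norm u * norm v * sin \<alpha>)"
      unfolding x' len[folded k_def, symmetric] by (simp add: mult_ac)
    also have "\<dots> = cross2 u v" unfolding si using ss by (simp add: mult.assoc[symmetric])
    finally show ?thesis .
  qed
  have "(norm u * norm u) * v$1 = (norm u * norm u) * (x$1 * u$1 - (\<sigma> * x$2) * u$2)"
  proof -
    have "(norm u * norm u) * (x$1 * u$1 - (\<sigma> * x$2) * u$2) = (u \<bullet> v) * u$1 - cross2 u v * u$2"
      unfolding x1[symmetric] x2[symmetric] by (simp add: algebra_simps)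
    also have "\<dots> = (norm u * norm u) * v$1" unfolding n2 inner2 cross2_def by (simp add: algebra_simps)
    finally show ?thesis by (rule sym)
  qed
  moreover have "(norm u * norm u) * v$2 = (norm u * norm u) * (x$1 * u$2 + (\<sigma> * x$2) * u$1)"
  proof -
    have "(norm u * norm u) * (x$1 * u$2 + (\<sigma> * x$2) * u$1) = (u \<bullet> v) * u$2 + cross2 u v * u$1"
      unfolding x1[symmetric] x2[symmetric] by (simp add: algebra_simps)
    also have "\<dots> = (norm u * norm u) * v$2" unfolding n2 inner2 cross2_def by (simp add: algebra_simps)
    finally show ?thesis by (rule sym)
  qed
  moreover have "norm u * norm u \<noteq> 0" using uv by simp
  ultimately have "v$1 = x$1 * u$1 - (\<sigma> * x$2) * u$2" "v$2 = x$1 * u$2 + (\<sigma> * x$2) * u$1"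
    using mult_left_cancel by blast+
  then have "v = x$1 *\<^sub>R u + (\<sigma> * x$2) *\<^sub>R vector [- u$2, u$1]" by (simp add: vec2_eq_iff)
  then show ?thesis unfolding u_def v_def by (simp add: algebra_simps)
qed

lemma framed_similar:
  assumes "framed ps S" "ps \<noteq> []"
  shows "(base_points ps, S) \<in> similarity_rel"
proof -
  obtain P Q Xs \<epsilon> where S: "S = {P, Q} \<union> set Xs" and
    X: "list_all2 (\<lambda>X (\<alpha>, \<beta>). 0 < \<epsilon> * orient P Q X \<and> angle X P Q = \<alpha> \<and> angle X Q P = \<beta>) Xs ps"
    using assms(1) unfolding framed_def by blast
  \<comment> \<open>only the sign of \<open>\<epsilon>\<close> matters\<close>
  define \<sigma> :: real where "\<sigma> = (if 0 < \<epsilon> then 1 else - 1)"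
  have s: "\<sigma> = 1 \<or> \<sigma> = - 1" by (simp add: \<sigma>_def)
  have so: "0 < \<sigma> * y" if "0 < \<epsilon> * y" for y using that by (auto simp: \<sigma>_def zero_less_mult_iff)
  define g where "g = (\<lambda>x::real^2. P + x$1 *\<^sub>R (Q - P) + (\<sigma> * x$2) *\<^sub>R vector [- (Q - P)$2, (Q - P)$1])"
  define apex :: "real \<times> real \<Rightarrow> real^2" where "apex = (\<lambda>(\<alpha>, \<beta>). (sin \<beta> / sin (\<alpha> + \<beta>)) *\<^sub>R vector [cos \<alpha>, sin \<alpha>])"
  have "Xs \<noteq> []" using X assms(2) by auto
  then have "0 < \<epsilon> * orient P Q (hd Xs)" using X assms(2) by (cases Xs; cases ps) auto
  then have "P \<noteq> Q" by auto
  then have g: "is_similarity g" unfolding g_def using s by (rule frame_similarity)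
  have l: "list_all2 (\<lambda>X p. X = g (apex p)) Xs ps"
    using X
  proof (rule list_all2_mono)
    fix X p assume "case p of (\<alpha>, \<beta>) \<Rightarrow> 0 < \<epsilon> * orient P Q X \<and> angle X P Q = \<alpha> \<and> angle X Q P = \<beta>"
    then show "X = g (apex p)" unfolding g_def
      by (intro locate_by_angles[where \<alpha> = "fst p" and \<beta> = "snd p"]) (auto simp: case_prod_beta s so apex_def)
  qed
  then have "set Xs = g ` apex ` set ps"
    by (induction Xs ps rule: list_all2_induct) auto
  moreover have "g 0 = P" "g (vector [1, 0]) = Q" by (simp_all add: g_def)
  ultimately have "S = g ` base_points ps" unfolding S base_points_def apex_def by (auto simp: image_Un)
  then show ?thesis using g unfolding similarity_rel_iff by blast
qed

definition rot :: "real \<Rightarrow> real^2 \<Rightarrow> real^2" where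
  "rot \<theta> x = vector [cos \<theta> * x$1 - sin \<theta> * x$2, sin \<theta> * x$1 + cos \<theta> * x$2]"

definition flip :: "real^2 \<Rightarrow> real^2" where
  "flip x = vector [x$1, - x$2]"

lemma orthogonal_rot: "orthogonal_transformation (rot \<theta>)"
  unfolding orthogonal_transformation_def
proof (intro conjI allI)
  show "linear (rot \<theta>)" by (rule linearI) (simp_all add: rot_def vec2_eq_iff algebra_simps)
  fix v w :: "real^2"
  define c s where "c = cos \<theta>" and "s = sin \<theta>"
  have cs: "c * c + s * s = 1" unfolding c_def s_def by simp
  have "rot \<theta> v \<bullet> rot \<theta> w = (c * c + s * s) * (v$1 * w$1 + v$2 * w$2)"
    unfolding inner2 rot_def c_def[symmetric] s_def[symmetric] by (simp add: algebra_simps)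
  then show "rot \<theta> v \<bullet> rot \<theta> w = v \<bullet> w" by (simp add: inner2 cs)
qed

text \<open>The images of the two basis vectors are orthogonal unit vectors; \<open>k = 1\<close> or \<open>k = - 1\<close> is the determinant.\<close>
lemma orthogonal_cases:
  fixes f :: "real^2 \<Rightarrow> real^2"
  assumes "orthogonal_transformation f"
  shows "\<exists>\<theta>. f = rot \<theta> \<or> f = (\<lambda>x. rot \<theta> (flip x))"
proof -
  have l: "linear f" and in': "\<And>v w. f v \<bullet> f w = v \<bullet> w" using assms by (auto simp: orthogonal_transformation_def)
  define a b where "a = f (vector [1, 0])" and "b = f (vector [0, 1])"
  have ab: "a$1 * a$1 + a$2 * a$2 = 1" "b$1 * b$1 + b$2 * b$2 = 1" "a$1 * b$1 + a$2 * b$2 = 0"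
    using in'[of "vector [1, 0]" "vector [1, 0]"] in'[of "vector [0, 1]" "vector [0, 1]"]
      in'[of "vector [1, 0]" "vector [0, 1]"] by (simp_all add: a_def b_def inner2)
  have fx: "f x = x$1 *\<^sub>R a + x$2 *\<^sub>R b" for x
  proof -
    have "x = x$1 *\<^sub>R vector [1, 0] + x$2 *\<^sub>R vector [0, 1]" by (simp add: vec2_eq_iff)
    then have "f x = f (x$1 *\<^sub>R vector [1, 0] + x$2 *\<^sub>R vector [0, 1])" by simp
    then show ?thesis by (simp add: linear_add[OF l] linear_scale[OF l] a_def b_def)
  qed
  have "(a$1)\<^sup>2 + (a$2)\<^sup>2 = 1" using ab by (simp add: power2_eq_square)
  then obtain \<theta> where t: "a$1 = cos \<theta>" "a$2 = sin \<theta>" using sincos_total_2pi by metis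
  define k where "k = a$1 * b$2 - a$2 * b$1"
  have b: "b$1 = - k * a$2" "b$2 = k * a$1"
    using ab unfolding k_def by algebra+
  have "k * k = 1" using ab(1,2) b by algebra
  then have "k = 1 \<or> k = - 1" by (simp add: square_eq_1_iff)
  then show ?thesis
  proof
    assume "k = 1"
    then have "f = rot \<theta>" by (auto simp: fun_eq_iff fx rot_def vec2_eq_iff b t mult.commute)
    then show ?thesis by blast
  next
    assume "k = - 1"
    then have "f = (\<lambda>x. rot \<theta> (flip x))" by (auto simp: fun_eq_iff fx rot_def flip_def vec2_eq_iff b t mult.commute)
    then show ?thesis by blast
  qed
qed

text \<open>The vertices of regular polygons are given with a fixed sense of rotation, whereas similarity allows
  reflections. For sets with a mirror symmetry this makes no difference.\<close>
lemma similar_symmetric_iff: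
  assumes "flip ` U = U"
  shows "(U, S) \<in> similarity_rel \<longleftrightarrow> (\<exists>z r \<theta>. r > 0 \<and> S = (\<lambda>x. z + r *\<^sub>R rot \<theta> x) ` U)"
proof
  assume "(U, S) \<in> similarity_rel"
  then obtain r t f where f: "r > 0" "orthogonal_transformation f" "S = (\<lambda>x. t + r *\<^sub>R f x) ` U"
    unfolding similarity_rel_def by auto
  obtain \<theta> where "f = rot \<theta> \<or> f = (\<lambda>x. rot \<theta> (flip x))" using orthogonal_cases[OF f(2)] by blast
  then have "S = (\<lambda>x. t + r *\<^sub>R rot \<theta> x) ` U"
  proof
    assume "f = rot \<theta>" then show ?thesis using f by simp
  next
    assume "f = (\<lambda>x. rot \<theta> (flip x))"
    then have "S = (\<lambda>x. t + r *\<^sub>R rot \<theta> x) ` flip ` U" using f by (simp add: image_image)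
    then show ?thesis using assms by simp
  qed
  then show "\<exists>z r \<theta>. r > 0 \<and> S = (\<lambda>x. z + r *\<^sub>R rot \<theta> x) ` U" using f by blast
next
  assume "\<exists>z r \<theta>. r > 0 \<and> S = (\<lambda>x. z + r *\<^sub>R rot \<theta> x) ` U"
  then show "(U, S) \<in> similarity_rel" unfolding similarity_rel_def using orthogonal_rot by blast
qed

section \<open>Directions that are multiples of a fixed angle\<close>

definition dirn :: "nat \<Rightarrow> int \<Rightarrow> real^2" where
  "dirn n k = vector [cos (k * pi / n), sin (k * pi / n)]"

text \<open>Folding the circle: the residue of \<open>k\<close> modulo \<open>2 * n\<close> is reflected into the upper half.\<close>
lemma arccos_cos_multiple:
  fixes k :: int and n :: nat
  assumes "0 < n"
  shows "\<exists>i\<le>n. arccos (cos (k * pi / n)) = i * pi / n \<and> (int i = k mod (2 * n) \<or> int i = 2 * n - k mod (2 * n))"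
proof -
  define m where "m = k mod (2 * int n)"
  have m: "0 \<le> m" "m < 2 * int n" using assms by (auto simp: m_def)
  have k: "k = m + 2 * int n * (k div (2 * int n))" by (simp add: m_def)
  have "k * pi / n = m * pi / n + 2 * pi * of_int (k div (2 * int n))"
    using assms by (subst k) (simp add: field_simps)
  then have c: "cos (k * pi / n) = cos (m * pi / n)"
    using cos_int_2pin[of "k div (2 * int n)"] sin_int_2pin[of "k div (2 * int n)"] by (simp add: cos_add)
  have n: "0 < real n" using assms by simp
  show ?thesis
  proof (cases "m \<le> int n")
    case True
    have "0 \<le> m * pi / n" using m by simp
    moreover have "m * pi / n \<le> pi" using True n by (simp add: divide_le_eq mult.commute)
    ultimately have "arccos (cos (k * pi / n)) = nat m * pi / n" unfolding c using m by (simp add: arccos_cos)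
    moreover have "nat m \<le> n" "int (nat m) = k mod (2 * n)" using m True by (auto simp: m_def)
    ultimately show ?thesis by blast
  next
    case False
    define j where "j = 2 * int n - m"
    have j: "0 \<le> j" "j \<le> int n" using m False by (auto simp: j_def)
    have "m * pi / n = 2 * pi - j * pi / n" using n by (simp add: j_def field_simps)
    then have c': "cos (m * pi / n) = cos (j * pi / n)" by (simp add: cos_diff)
    have "0 \<le> j * pi / n" using j by simp
    moreover have "j * pi / n \<le> pi" using j n by (simp add: divide_le_eq mult.commute)
    ultimately have "arccos (cos (k * pi / n)) = nat j * pi / n" unfolding c c' using j by (simp add: arccos_cos)
    moreover have "nat j \<le> n" "int (nat j) = 2 * n - k mod (2 * n)" using j by (auto simp: j_def m_def)
    ultimately show ?thesis by blast
  qed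
qed

lemma angle_of_directions:
  assumes "a - b = \<rho> *\<^sub>R dirn n j" "c - b = \<tau> *\<^sub>R dirn n k" "0 < \<rho>" "0 < \<tau>"
  shows "angle a b c = arccos (cos ((j - k) * pi / n))"
proof -
  have n: "norm (dirn n i) = 1" for i
  proof -
    have "(norm (dirn n i))\<^sup>2 = 1" unfolding norm2_sq by (simp add: dirn_def)
    then show ?thesis by (simp add: power2_eq_1_iff) (smt (verit) norm_ge_zero)
  qed
  have "dirn n j \<bullet> dirn n k = cos (j * pi / n - k * pi / n)" by (simp add: inner2 dirn_def cos_diff)
  also have "j * pi / n - k * pi / n = (j - k) * pi / n" by (simp add: left_diff_distrib diff_divide_distrib)
  finally show ?thesis unfolding angle_def assms(1,2) using assms(3,4) by (simp add: n)
qed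

definition in_direction :: "real^2 \<Rightarrow> real^2 \<Rightarrow> int \<Rightarrow> bool" where
  "in_direction b a k \<longleftrightarrow> (\<exists>\<rho>>0. a - b = \<rho> *\<^sub>R dirn 5 k)"

text \<open>Differences \<open>4\<close> and \<open>6\<close> modulo \<open>10\<close> are the ones that produce the angle \<open>4 * pi / 5\<close>; all other differences of
  multiples of \<open>pi / 5\<close> give an angle in the set of three, or \<open>0\<close> or \<open>pi\<close>, which do not count.\<close>
definition sees_allowed :: "(real^2) set \<Rightarrow> real^2 \<Rightarrow> int set \<Rightarrow> bool" where
  "sees_allowed S b K \<longleftrightarrow> (\<forall>j\<in>K. \<forall>k\<in>K. (j - k) mod 10 \<noteq> 4 \<and> (j - k) mod 10 \<noteq> 6) \<and>
     (\<forall>a\<in>S - {b}. \<exists>k\<in>K. in_direction b a k)"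

definition decagonal :: "(real^2) set \<Rightarrow> bool" where
  "decagonal S \<longleftrightarrow> (\<forall>b\<in>S. \<exists>K. sees_allowed S b K)"

lemma decagonal_angles:
  assumes "decagonal S" shows "angles S \<subseteq> {pi / 5, 2 * pi / 5, 3 * pi / 5}"
proof
  fix x assume x: "x \<in> angles S"
  then obtain a b c where abc: "x = angle a b c" "a \<in> S" "b \<in> S" "c \<in> S" "a \<noteq> b" "b \<noteq> c"
    and r: "0 < x" "x < pi" unfolding angles_def by auto
  obtain K where K: "sees_allowed S b K" using assms abc unfolding decagonal_def by blast
  then obtain j k where jk: "j \<in> K" "k \<in> K" "in_direction b a j" "in_direction b c k"
    unfolding sees_allowed_def using abc by (metis DiffI singletonD)
  then have "x = arccos (cos ((j - k) * pi / 5))"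
    using angle_of_directions[of a b _ 5 j c _ k] abc unfolding in_direction_def by auto
  moreover have "(j - k) mod 10 \<noteq> 4" "(j - k) mod 10 \<noteq> 6" using K jk unfolding sees_allowed_def by auto
  moreover obtain i where i: "i \<le> 5" "arccos (cos (of_int (j - k) * pi / real 5)) = i * pi / 5"
    "int i = (j - k) mod 10 \<or> int i = 10 - (j - k) mod 10"
    using arccos_cos_multiple[of 5 "j - k"] by auto
  ultimately have "x = i * pi / 5" "i \<noteq> 4" by auto
  moreover have "i \<noteq> 0" "i \<noteq> 5" using r calculation by (auto simp: zero_less_mult_iff)
  ultimately have "i = 1 \<or> i = 2 \<or> i = 3" using i by auto
  then show "x \<in> {pi / 5, 2 * pi / 5, 3 * pi / 5}" using \<open>x = i * pi / 5\<close> by auto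
qed

section \<open>Coordinates in terms of the golden ratio\<close>

definition phi :: real where "phi = 2 * cos (pi / 5)"
definition sin36 :: real where "sin36 = sin (pi / 5)"

lemma sin36_pos: "0 < sin36"
  unfolding sin36_def by (rule sin_gt_zero) (use pi_gt_zero in linarith)+

lemma sin36_sq': "sin36 * sin36 = 1 - (phi / 2) * (phi / 2)"
  using sin_squared_eq[of "pi / 5"] by (simp add: sin36_def phi_def power2_eq_square)

lemma sin_2pi5: "sin (2 * pi / 5) = phi * sin36"
  using sin_double[of "pi / 5"] by (simp add: phi_def sin36_def)

text \<open>For \<open>x = pi / 5\<close>, the equation \<open>sin (3 * x) = sin (2 * x)\<close> divided by \<open>sin x\<close> is the equation of the golden ratio.\<close>
lemma phi_sq: "phi * phi = phi + 1"
proof -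
  have "sin (3 * pi / 5) = sin (2 * pi / 5)"
    using sin_pi_minus[of "2 * pi / 5"] by (simp add: field_simps)
  moreover have "sin (3 * pi / 5) = sin (2 * pi / 5) * cos (pi / 5) + cos (2 * pi / 5) * sin (pi / 5)"
    using sin_add[of "2 * pi / 5" "pi / 5"] by (simp add: field_simps)
  moreover have "cos (2 * pi / 5) = 2 * (cos (pi / 5))\<^sup>2 - 1"
    using cos_double_cos[of "pi / 5"] by simp
  ultimately have "phi * sin36 = phi * sin36 * (phi / 2) + (2 * (phi / 2)\<^sup>2 - 1) * sin36"
    unfolding sin_2pi5 by (simp add: phi_def sin36_def)
  then have "sin36 * phi = sin36 * (phi * phi - 1)" by (simp add: algebra_simps power2_eq_square)
  then have "phi = phi * phi - 1" using sin36_pos mult_left_cancel by (metis less_irrefl)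
  then show ?thesis by simp
qed

text \<open>Together with \<open>phi_sq\<close> this rewrites all polynomials in \<open>phi\<close> to degree at most 1.\<close>
lemma phi_sq2: "phi * (phi * x) = phi * x + x"
  using phi_sq by (simp add: mult.assoc[symmetric] algebra_simps)

lemma sin36_sq: "sin36 * sin36 = (3 - phi) / 4"
  using sin36_sq' phi_sq by (simp add: field_simps)

lemma phi_bounds: "3 / 2 < phi" "phi < 2"
proof -
  have p: "0 < phi" unfolding phi_def using cos_gt_zero[of "pi / 5"] pi_gt_zero by simp
  show "3 / 2 < phi"
  proof (rule ccontr)
    assume "\<not> 3 / 2 < phi"
    then have "phi * phi \<le> 3 / 2 * phi" using p by (intro mult_right_mono) auto
    then show False using phi_sq \<open>\<not> 3 / 2 < phi\<close> p by linarith
  qed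
  show "phi < 2"
  proof (rule ccontr)
    assume "\<not> phi < 2"
    then have "2 * phi \<le> phi * phi" using p by (intro mult_right_mono) auto
    then show False using phi_sq \<open>\<not> phi < 2\<close> by linarith
  qed
qed

lemma trig_values:
  "cos (pi / 5) = phi / 2" "sin (pi / 5) = sin36"
  "cos (2 * pi / 5) = (phi - 1) / 2" "sin (2 * pi / 5) = phi * sin36"
  "cos (3 * pi / 5) = (1 - phi) / 2" "sin (3 * pi / 5) = phi * sin36"
  "cos (4 * pi / 5) = - phi / 2" "sin (4 * pi / 5) = sin36"
proof -
  show 1: "cos (pi / 5) = phi / 2" "sin (pi / 5) = sin36" by (simp_all add: phi_def sin36_def)
  show 2: "cos (2 * pi / 5) = (phi - 1) / 2"
    using cos_double_cos[of "pi / 5"] phi_sq by (simp add: 1 power2_eq_square)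
  show 3: "sin (2 * pi / 5) = phi * sin36" by (rule sin_2pi5)
  have "3 * pi / 5 = pi - 2 * pi / 5" "4 * pi / 5 = pi - pi / 5" by simp_all
  then show "cos (3 * pi / 5) = (1 - phi) / 2" "sin (3 * pi / 5) = phi * sin36"
    "cos (4 * pi / 5) = - phi / 2" "sin (4 * pi / 5) = sin36"
    by (simp_all only: cos_pi_minus sin_pi_minus 1 2 3) (simp add: field_simps)
qed

text \<open>All points of the normal forms have coordinates of this shape with \<open>p, q\<close> in the field generated by the golden ratio, so
  nested radicals never appear.\<close>
definition pt :: "real \<Rightarrow> real \<Rightarrow> real^2" where "pt p q = vector [p, q * sin36]"

lemma pt_simps: "pt p q - pt p' q' = pt (p - p') (q - q')" "\<rho> *\<^sub>R pt p q = pt (\<rho> * p) (\<rho> * q)"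
  "- pt p q = pt (- p) (- q)" "pt p q $ 1 = p" "pt p q $ 2 = q * sin36"
  by (simp_all add: pt_def vec2_eq_iff algebra_simps)

lemma pt_eq_iff: "pt p q = pt p' q' \<longleftrightarrow> p = p' \<and> q = q'"
  using sin36_pos by (auto simp: pt_def vec2_eq_iff)

lemma dirn_add_half: "dirn 5 (k + 5) = - dirn 5 k"
proof -
  have e: "real_of_int (k + 5) * pi / real 5 = real_of_int k * pi / 5 + pi" by (simp add: field_simps)
  show ?thesis unfolding dirn_def e by (simp add: vec2_eq_iff)
qed

lemma dir_values:
  "dirn 5 0 = pt 1 0" "dirn 5 1 = pt (phi / 2) 1" "dirn 5 2 = pt ((phi - 1) / 2) phi"
  "dirn 5 3 = pt ((1 - phi) / 2) phi" "dirn 5 4 = pt (- phi / 2) 1"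
  "dirn 5 5 = pt (- 1) 0" "dirn 5 6 = pt (- phi / 2) (- 1)" "dirn 5 7 = pt ((1 - phi) / 2) (- phi)"
  "dirn 5 8 = pt ((phi - 1) / 2) (- phi)" "dirn 5 9 = pt (phi / 2) (- 1)"
proof -
  show 1: "dirn 5 0 = pt 1 0" "dirn 5 1 = pt (phi / 2) 1" "dirn 5 2 = pt ((phi - 1) / 2) phi"
    "dirn 5 3 = pt ((1 - phi) / 2) phi" "dirn 5 4 = pt (- phi / 2) 1"
    by (simp_all add: dirn_def pt_def trig_values)
  show "dirn 5 5 = pt (- 1) 0" "dirn 5 6 = pt (- phi / 2) (- 1)" "dirn 5 7 = pt ((1 - phi) / 2) (- phi)"
    "dirn 5 8 = pt ((phi - 1) / 2) (- phi)" "dirn 5 9 = pt (phi / 2) (- 1)"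
    using dirn_add_half[of 0] dirn_add_half[of 1] dirn_add_half[of 2] dirn_add_half[of 3] dirn_add_half[of 4]
    by (simp_all add: 1 pt_simps pt_eq_iff diff_divide_distrib)
qed

lemma in_directionI: "0 < \<rho> \<Longrightarrow> a - b = \<rho> *\<^sub>R dirn 5 k \<Longrightarrow> in_direction b a k"
  unfolding in_direction_def by blast

lemma in_direction_reverse:
  assumes "in_direction b a k" shows "in_direction a b (k + 5)" "in_direction a b (k - 5)"
proof -
  obtain \<rho> where r: "0 < \<rho>" "a - b = \<rho> *\<^sub>R dirn 5 k" using assms unfolding in_direction_def by blast
  have "b - a = \<rho> *\<^sub>R (- dirn 5 k)" using r(2) by (simp add: algebra_simps)
  then show "in_direction a b (k + 5)" "in_direction a b (k - 5)"
    using dirn_add_half[of k] dirn_add_half[of "k - 5"] r unfolding in_direction_def by auto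
qed

text \<open>\<open>pO pI pA pT pB\<close> is a regular pentagon with unit side. Its diagonals meet in \<open>pX\<close> (on \<open>pO pA\<close> and \<open>pI pB\<close>), \<open>pD\<close>
  (on \<open>pO pT\<close> and \<open>pI pB\<close>) and \<open>pE\<close> (on \<open>pI pT\<close> and \<open>pO pA\<close>). All configurations other than the square
  consist of such vertices and crossing points.\<close>
abbreviation "pO \<equiv> pt 0 0"
abbreviation "pI \<equiv> pt 1 0"
definition "pA = pt ((phi + 1) / 2) phi"
definition "pT = pt (1 / 2) (phi + 1)"
definition "pB = pt ((1 - phi) / 2) phi"
definition "pX = pt (1 / 2) (phi - 1)"
definition "pD = pt ((2 - phi) / 2) 1"
definition "pE = pt (phi / 2) 1"
lemmas base_point_defs = pA_def pT_def pB_def pX_def pD_def pE_def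

lemma phi_order: "0 < phi" "1 < phi" "phi < 2"
  using phi_bounds by auto

lemmas direction_simps = dir_values base_point_defs pt_simps pt_eq_iff field_simps phi_sq phi_sq2 phi_order

text \<open>The number stands for the direction as a multiple of \<open>pi / 5\<close>; the length of the vector is the factor given in the
  proof.\<close>
lemma base_directions:
  "in_direction pO pI 0" "in_direction pO pA 1" "in_direction pO pT 2" "in_direction pO pB 3"
  "in_direction pI pA 2" "in_direction pI pT 3" "in_direction pI pB 4" "in_direction pA pT 4"
  "in_direction pA pB 5" "in_direction pT pB 6" "in_direction pO pX 1" "in_direction pI pX 4"
  "in_direction pB pX 9" "in_direction pA pX 6" "in_direction pO pD 2" "in_direction pO pE 1"
  "in_direction pI pD 4" "in_direction pI pE 3" "in_direction pT pD 7" "in_direction pT pE 8"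
  "in_direction pD pE 0" "in_direction pA pE 6" "in_direction pX pE 1"
proof -
  show "in_direction pO pI 0" "in_direction pO pB 3" "in_direction pI pA 2" "in_direction pA pT 4"
    "in_direction pT pB 6" "in_direction pB pX 9" "in_direction pA pX 6" "in_direction pO pE 1"
    "in_direction pI pD 4" "in_direction pT pD 7" "in_direction pT pE 8"
    by (rule in_directionI[of "1"]; simp add: direction_simps)+
  show "in_direction pO pA 1" "in_direction pO pT 2" "in_direction pI pT 3" "in_direction pI pB 4"
    "in_direction pA pB 5"
    by (rule in_directionI[of "phi"]; simp add: direction_simps)+
  show "in_direction pO pX 1" "in_direction pI pX 4" "in_direction pO pD 2" "in_direction pI pE 3"
    "in_direction pD pE 0" "in_direction pA pE 6"
    by (rule in_directionI[of "phi - 1"]; simp add: direction_simps)+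
  show "in_direction pX pE 1"
    by (rule in_directionI[of "2 - phi"]; simp add: direction_simps)+
qed

lemmas base_direction_pairs = base_directions base_directions[THEN in_direction_reverse(1), simplified] base_directions[THEN in_direction_reverse(2), simplified]

lemma pentagon_directions: "decagonal {pO, pI, pA, pT, pB}" (is "decagonal ?S")
proof -
  have "sees_allowed ?S pO {0, 1, 2, 3}" "sees_allowed ?S pI {2, 3, 4, 5}" "sees_allowed ?S pA {4, 5, 6, 7}"
    "sees_allowed ?S pT {6, 7, 8, 9}" "sees_allowed ?S pB {0, 1, 8, 9}"
    by (auto simp: sees_allowed_def base_direction_pairs)
  then show ?thesis unfolding decagonal_def by blast
qed

lemma diagonals_directions: "decagonal {pO, pI, pB, pA, pX}" (is "decagonal ?S")
proof -
  have "sees_allowed ?S pO {0, 1, 3}" "sees_allowed ?S pI {2, 4, 5}" "sees_allowed ?S pB {0, 8, 9}"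
    "sees_allowed ?S pA {5, 6, 7}" "sees_allowed ?S pX {1, 4, 6, 9}"
    by (auto simp: sees_allowed_def base_direction_pairs)
  then show ?thesis unfolding decagonal_def by blast
qed

lemma legs_directions: "decagonal {pO, pI, pT, pD, pE}" (is "decagonal ?S")
proof -
  have "sees_allowed ?S pO {0, 1, 2}" "sees_allowed ?S pI {3, 4, 5}" "sees_allowed ?S pT {7, 8}"
    "sees_allowed ?S pD {0, 2, 7, 9}" "sees_allowed ?S pE {3, 5, 6, 8}"
    by (auto simp: sees_allowed_def base_direction_pairs)
  then show ?thesis unfolding decagonal_def by blast
qed

lemma trisected_directions: "decagonal {pO, pI, pA, pX, pE}" (is "decagonal ?S")
proof -
  have "sees_allowed ?S pO {0, 1}" "sees_allowed ?S pI {2, 3, 4, 5}" "sees_allowed ?S pA {6, 7}"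
    "sees_allowed ?S pX {1, 6, 9}" "sees_allowed ?S pE {1, 6, 8}"
    by (auto simp: sees_allowed_def base_direction_pairs)
  then show ?thesis unfolding decagonal_def by blast
qed

section \<open>The descriptions of the five configurations\<close>

lemma pO_eq: "pO = 0" and pI_eq: "pI = vector [1, 0]"
  by (simp_all add: pt_def vec2_eq_iff)

lemma apex_values:
  "(sin (3 * pi / 5) / sin (pi / 5 + 3 * pi / 5)) *\<^sub>R vector [cos (pi / 5), sin (pi / 5)] = pA"
  "(sin (2 * pi / 5) / sin (2 * pi / 5 + 2 * pi / 5)) *\<^sub>R vector [cos (2 * pi / 5), sin (2 * pi / 5)] = pT"
  "(sin (pi / 5) / sin (3 * pi / 5 + pi / 5)) *\<^sub>R vector [cos (3 * pi / 5), sin (3 * pi / 5)] = pB"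
  "(sin (pi / 5) / sin (pi / 5 + pi / 5)) *\<^sub>R vector [cos (pi / 5), sin (pi / 5)] = pX"
  "(sin (pi / 5) / sin (2 * pi / 5 + pi / 5)) *\<^sub>R vector [cos (2 * pi / 5), sin (2 * pi / 5)] = pD"
  "(sin (2 * pi / 5) / sin (pi / 5 + 2 * pi / 5)) *\<^sub>R vector [cos (pi / 5), sin (pi / 5)] = pE"
proof -
  have e: "pi / 5 + 3 * pi / 5 = 4 * pi / 5" "2 * pi / 5 + 2 * pi / 5 = 4 * pi / 5" "3 * pi / 5 + pi / 5 = 4 * pi / 5"
    "pi / 5 + pi / 5 = 2 * pi / 5" "2 * pi / 5 + pi / 5 = 3 * pi / 5" "pi / 5 + 2 * pi / 5 = 3 * pi / 5" by simp_all
  have s: "sin36 \<noteq> 0" and p: "phi \<noteq> 0" using sin36_pos phi_bounds by auto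
  have inv: "1 / phi = phi - 1" using p phi_sq by (simp add: field_simps)
  show "(sin (3 * pi / 5) / sin (pi / 5 + 3 * pi / 5)) *\<^sub>R vector [cos (pi / 5), sin (pi / 5)] = pA"
    "(sin (2 * pi / 5) / sin (2 * pi / 5 + 2 * pi / 5)) *\<^sub>R vector [cos (2 * pi / 5), sin (2 * pi / 5)] = pT"
    "(sin (pi / 5) / sin (3 * pi / 5 + pi / 5)) *\<^sub>R vector [cos (3 * pi / 5), sin (3 * pi / 5)] = pB"
    "(sin (pi / 5) / sin (pi / 5 + pi / 5)) *\<^sub>R vector [cos (pi / 5), sin (pi / 5)] = pX"
    "(sin (pi / 5) / sin (2 * pi / 5 + pi / 5)) *\<^sub>R vector [cos (2 * pi / 5), sin (2 * pi / 5)] = pD"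
    "(sin (2 * pi / 5) / sin (pi / 5 + 2 * pi / 5)) *\<^sub>R vector [cos (pi / 5), sin (pi / 5)] = pE"
    unfolding e trig_values using s p
    by (simp_all add: base_point_defs pt_def vec2_eq_iff field_simps phi_sq phi_sq2)
qed

lemma base_points_values:
  "base_points pentagon_frame = {pO, pI, pA, pT, pB}"
  "base_points diagonals_frame = {pO, pI, pB, pA, pX}"
  "base_points legs_frame = {pO, pI, pT, pD, pE}"
  "base_points trisected_frame = {pO, pI, pA, pX, pE}"
  unfolding base_points_def pO_eq pI_eq
  by (simp_all only: list.set image_insert image_empty case_prod_conv apex_values) auto

lemma base_points_square:
  "base_points square_frame = {0, vector [1, 0], vector [1 / 2, 1 / 2], vector [1, 1], vector [0, 1]}"
proof -
  have e: "pi / 4 + pi / 4 = pi / 2" "pi / 4 + pi / 2 = pi - pi / 4" "pi / 2 + pi / 4 = pi - pi / 4" by simp_all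
  have "(sin (pi / 4) / sin (pi / 4 + pi / 4)) *\<^sub>R vector [cos (pi / 4), sin (pi / 4)] = (vector [1 / 2, 1 / 2] :: real^2)"
    "(sin (pi / 2) / sin (pi / 4 + pi / 2)) *\<^sub>R vector [cos (pi / 4), sin (pi / 4)] = (vector [1, 1] :: real^2)"
    "(sin (pi / 4) / sin (pi / 2 + pi / 4)) *\<^sub>R vector [cos (pi / 2), sin (pi / 2)] = (vector [0, 1] :: real^2)"
    unfolding e sin_pi_minus sin_45 cos_45 sin_pi_half cos_pi_half by (simp_all add: vec2_eq_iff)
  then show ?thesis unfolding base_points_def
    by (simp only: list.set image_insert image_empty case_prod_conv) auto
qed

lemma rot_dirn: "rot \<theta> (dirn n k) = vector [cos (\<theta> + k * pi / n), sin (\<theta> + k * pi / n)]"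
  by (simp add: rot_def dirn_def vec2_eq_iff cos_add sin_add)

definition turn :: "real^2 \<Rightarrow> real \<Rightarrow> real \<Rightarrow> real^2 \<Rightarrow> real^2" where
  "turn z r \<theta> = (\<lambda>x. z + r *\<^sub>R rot \<theta> x)"

lemma turn_similarity: "0 < r \<Longrightarrow> is_similarity (turn z r \<theta>)"
  unfolding turn_def using is_similarityI orthogonal_rot by blast

lemma regular_polygon_iff:
  "regular_polygon n z v \<longleftrightarrow> n \<ge> 3 \<and> (\<exists>r \<theta>. r > 0 \<and> (\<forall>i. v i = turn z r \<theta> (dirn n (2 * int i))))"
  unfolding regular_polygon_def turn_def rot_dirn by (simp add: mult.commute mult.left_commute)

lemma turn_shift: "0 < n \<Longrightarrow> turn z r \<theta> (dirn n (2 * int (m + j))) = turn z r (\<theta> + 2 * pi * m / n) (dirn n (2 * int j))"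
  unfolding turn_def rot_dirn by (simp add: field_simps)

lemma unit_pentagon:
  "dirn 5 0 = pt 1 0" "dirn 5 2 = pt ((phi - 1) / 2) phi" "dirn 5 4 = pt (- phi / 2) 1"
  "dirn 5 6 = pt (- phi / 2) (- 1)" "dirn 5 8 = pt ((phi - 1) / 2) (- phi)"
  by (rule dir_values)+

text \<open>Versions inscribed in the unit circle around the origin. They match the definition of regular polygons and are
  symmetric about the first axis; vertex number \<open>i\<close> is \<open>dirn 5 (2 * i)\<close>, and the vertex at angle \<open>0\<close> is the omitted one.\<close>
definition "unit_pentagon_set = {dirn 5 0, dirn 5 2, dirn 5 4, dirn 5 6, dirn 5 8}"
definition "unit_diagonals_set = {dirn 5 2, dirn 5 4, dirn 5 6, dirn 5 8, pt (phi - 2) 0}"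
definition "unit_legs_set = {dirn 5 2, dirn 5 4, dirn 5 6, dirn 5 8, pt (- phi - 1) 0}"
definition "unit_square_set = {0, dirn 4 0, dirn 4 2, dirn 4 4, dirn 4 6}"

lemma dirn4: "dirn 4 0 = vector [1, 0]" "dirn 4 2 = vector [0, 1]" "dirn 4 4 = vector [- 1, 0]" "dirn 4 6 = vector [0, - 1]"
proof -
  have "6 * pi / 4 = 3 / 2 * pi" by simp
  then have "cos (6 * pi / 4) = 0" "sin (6 * pi / 4) = - 1" using cos_3over2_pi sin_3over2_pi by (simp_all only:)
  then show "dirn 4 0 = vector [1, 0]" "dirn 4 2 = vector [0, 1]" "dirn 4 4 = vector [- 1, 0]" "dirn 4 6 = vector [0, - 1]"
    by (simp_all add: dirn_def)
qed

lemma flip_pt: "flip (pt p q) = pt p (- q)"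
  by (simp add: flip_def pt_def vec2_eq_iff)

lemma flip_sets:
  "flip ` unit_pentagon_set = unit_pentagon_set" "flip ` unit_diagonals_set = unit_diagonals_set"
  "flip ` unit_legs_set = unit_legs_set" "flip ` unit_square_set = unit_square_set"
  unfolding unit_pentagon_set_def unit_diagonals_set_def unit_legs_set_def unit_square_set_def unit_pentagon
  by (auto simp: flip_pt) (auto simp: flip_def dirn4 vec2_eq_iff)

lemma ex_regular_polygon_iff:
  "(\<exists>z v. regular_polygon n z v \<and> P z v) \<longleftrightarrow>
    n \<ge> 3 \<and> (\<exists>z r \<theta>. r > 0 \<and> P z (\<lambda>i. turn z r \<theta> (dirn n (2 * int i))))"
  unfolding regular_polygon_iff fun_eq_iff[symmetric] by blast

lemma pentagon_iff: "pentagon S \<longleftrightarrow> (unit_pentagon_set, S) \<in> similarity_rel"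
proof -
  have "(\<lambda>i. turn z r \<theta> (dirn 5 (2 * int i))) ` {..<5} = turn z r \<theta> ` unit_pentagon_set" for z r \<theta>
    by (simp add: lessThan_Suc numeral_eq_Suc unit_pentagon_set_def insert_commute)
  then show ?thesis
    unfolding similar_symmetric_iff[OF flip_sets(1)] pentagon_def ex_regular_polygon_iff turn_def[symmetric] by simp
qed

lemma square_iff: "square_with_center S \<longleftrightarrow> (unit_square_set, S) \<in> similarity_rel"
proof -
  have "turn z r \<theta> 0 = z" for z r \<theta> by (simp add: turn_def rot_def vec2_eq_iff)
  then have "insert z ((\<lambda>i. turn z r \<theta> (dirn 4 (2 * int i))) ` {..<4}) = turn z r \<theta> ` unit_square_set" for z r \<theta>
    by (simp add: lessThan_Suc numeral_eq_Suc unit_square_set_def insert_commute)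
  then show ?thesis
    unfolding similar_symmetric_iff[OF flip_sets(4)] square_with_center_def ex_regular_polygon_iff turn_def[symmetric] by simp
qed

lemma affine_hull_orient:
  assumes "p \<in> affine hull {a, b :: real^2}" shows "orient a b p = 0"
proof -
  obtain u v where u: "p = u *\<^sub>R a + v *\<^sub>R b" "u + v = 1" using assms by (auto simp: affine_hull_2)
  have v: "v = 1 - u" using u by simp
  show ?thesis unfolding u(1) v by (simp add: orient_coords algebra_simps)
qed

lemma affine_hull_2I:
  "p = u *\<^sub>R a + v *\<^sub>R b \<Longrightarrow> u + v = 1 \<Longrightarrow> p \<in> affine hull {a, b}"
  by (auto simp: affine_hull_2)

text \<open>Used to determine the meeting points without solving for parameters: it suffices to exhibit one common point.\<close>
lemma lines_meet_once:
  assumes "orient a b p = 0" "orient a b q = 0" "orient c d p = 0" "orient c d q = 0" "cross2 (b - a) (d - c) \<noteq> 0"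
  shows "p = q"
proof -
  have "(p$1 - q$1) * cross2 (b - a) (d - c) = 0" "(p$2 - q$2) * cross2 (b - a) (d - c) = 0"
    using assms(1-4) unfolding orient_coords cross2_def vector_minus_component by algebra+
  then show ?thesis using assms(5) by (simp add: vec2_eq_iff)
qed

lemma unit_diagonals_meet:
  "closed_segment (dirn 5 2) (dirn 5 6) \<inter> closed_segment (dirn 5 4) (dirn 5 8) = {pt (phi - 2) 0}"
proof
  have x: "pt (phi - 2) 0 = (1 - (phi - 1)) *\<^sub>R pt ((phi - 1) / 2) phi + (phi - 1) *\<^sub>R pt (- phi / 2) (- 1)"
    "pt (phi - 2) 0 = (1 - (2 - phi)) *\<^sub>R pt (- phi / 2) 1 + (2 - phi) *\<^sub>R pt ((phi - 1) / 2) (- phi)"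
    by (simp_all add: vec2_eq_iff pt_def field_simps phi_sq phi_sq2)
  have "pt (phi - 2) 0 \<in> closed_segment (dirn 5 2) (dirn 5 6)"
    unfolding unit_pentagon in_segment by (rule exI[of _ "phi - 1"]) (use x(1) phi_bounds in auto)
  moreover have "pt (phi - 2) 0 \<in> closed_segment (dirn 5 4) (dirn 5 8)"
    unfolding unit_pentagon in_segment by (rule exI[of _ "2 - phi"]) (use x(2) phi_bounds in auto)
  ultimately show "{pt (phi - 2) 0} \<subseteq> closed_segment (dirn 5 2) (dirn 5 6) \<inter> closed_segment (dirn 5 4) (dirn 5 8)" by simp
  have o: "orient a b p = 0" if "p \<in> closed_segment a b" for a b p :: "real^2"
    using that affine_hull_orient convex_hull_subset_affine_hull[of "{a, b}"] by (auto simp: segment_convex_hull)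
  show "closed_segment (dirn 5 2) (dirn 5 6) \<inter> closed_segment (dirn 5 4) (dirn 5 8) \<subseteq> {pt (phi - 2) 0}"
  proof
    fix p assume p: "p \<in> closed_segment (dirn 5 2) (dirn 5 6) \<inter> closed_segment (dirn 5 4) (dirn 5 8)"
    have "0 < sin36 * 4 + phi * (sin36 * 12)" using phi_bounds sin36_pos by (intro add_pos_pos mult_pos_pos) auto
    then have "cross2 (dirn 5 6 - dirn 5 2) (dirn 5 8 - dirn 5 4) \<noteq> 0"
      unfolding unit_pentagon cross2_def pt_simps by (auto simp: field_simps phi_sq phi_sq2)
    then have "p = pt (phi - 2) 0"
      using p \<open>pt (phi - 2) 0 \<in> closed_segment (dirn 5 2) (dirn 5 6)\<close> \<open>pt (phi - 2) 0 \<in> closed_segment (dirn 5 4) (dirn 5 8)\<close>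
      by (intro lines_meet_once[of "dirn 5 2" "dirn 5 6" _ _ "dirn 5 4" "dirn 5 8"] o) auto
    then show "p \<in> {pt (phi - 2) 0}" by simp
  qed
qed

lemma unit_legs_meet:
  "affine hull {dirn 5 2, dirn 5 4} \<inter> affine hull {dirn 5 6, dirn 5 8} = {pt (- phi - 1) 0}"
proof
  have x: "pt (- phi - 1) 0 = (- phi) *\<^sub>R pt ((phi - 1) / 2) phi + (1 + phi) *\<^sub>R pt (- phi / 2) 1"
    "pt (- phi - 1) 0 = (1 + phi) *\<^sub>R pt (- phi / 2) (- 1) + (- phi) *\<^sub>R pt ((phi - 1) / 2) (- phi)"
    by (simp_all add: vec2_eq_iff pt_def field_simps phi_sq phi_sq2)
  have 1: "pt (- phi - 1) 0 \<in> affine hull {dirn 5 2, dirn 5 4}" "pt (- phi - 1) 0 \<in> affine hull {dirn 5 6, dirn 5 8}"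
    unfolding unit_pentagon by (rule affine_hull_2I[OF x(1)], simp) (rule affine_hull_2I[OF x(2)], simp)
  then show "{pt (- phi - 1) 0} \<subseteq> affine hull {dirn 5 2, dirn 5 4} \<inter> affine hull {dirn 5 6, dirn 5 8}" by simp
  show "affine hull {dirn 5 2, dirn 5 4} \<inter> affine hull {dirn 5 6, dirn 5 8} \<subseteq> {pt (- phi - 1) 0}"
  proof
    fix p assume p: "p \<in> affine hull {dirn 5 2, dirn 5 4} \<inter> affine hull {dirn 5 6, dirn 5 8}"
    have "cross2 (dirn 5 4 - dirn 5 2) (dirn 5 8 - dirn 5 6) \<noteq> 0"
      unfolding unit_pentagon cross2_def pt_simps using phi_bounds sin36_pos by (simp add: field_simps phi_sq phi_sq2)
    then have "p = pt (- phi - 1) 0"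
      using p 1 by (intro lines_meet_once[of "dirn 5 2" "dirn 5 4" _ _ "dirn 5 6" "dirn 5 8"] affine_hull_orient) auto
    then show "p \<in> {pt (- phi - 1) 0}" by simp
  qed
qed

text \<open>Common to both trapezoids. \<open>I\<close> is the construction of the additional point, which commutes with similarities. Turning
  by a multiple of \<open>2 * pi / 5\<close> makes the omitted vertex the one with number \<open>0\<close>.\<close>
lemma omitted_vertex_iff:
  assumes meet: "\<And>g. is_similarity g \<Longrightarrow>
      I (g (dirn 5 2)) (g (dirn 5 4)) (g (dirn 5 6)) (g (dirn 5 8)) = {g x0}"
    and U: "U = {dirn 5 2, dirn 5 4, dirn 5 6, dirn 5 8, x0}" and flip: "flip ` U = U"
  shows "(\<exists>z v m x. regular_polygon 5 z v \<and> m < 5 \<and> I (v (m+1)) (v (m+2)) (v (m+3)) (v (m+4)) = {x} \<and>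
      S = {v (m+1), v (m+2), v (m+3), v (m+4), x}) \<longleftrightarrow> (U, S) \<in> similarity_rel" (is "?L = ?R")
proof
  assume ?L
  then obtain z v m x r \<theta> where v: "r > 0" "\<And>i. v i = turn z r \<theta> (dirn 5 (2 * int i))" "(m::nat) < 5"
    and x: "I (v (m+1)) (v (m+2)) (v (m+3)) (v (m+4)) = {x}" and S: "S = {v (m+1), v (m+2), v (m+3), v (m+4), x}"
    unfolding regular_polygon_iff by blast
  define g where "g = turn z r (\<theta> + 2 * pi * m / 5)"
  have g: "is_similarity g" unfolding g_def using v(1) by (rule turn_similarity)
  have "v (m + j) = g (dirn 5 (2 * int j))" for j unfolding v(2) g_def using turn_shift[of 5 z r \<theta> m j] by simp
  from this[of 1] this[of 2] this[of 3] this[of 4]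
  have vg: "v (m+1) = g (dirn 5 2)" "v (m+2) = g (dirn 5 4)" "v (m+3) = g (dirn 5 6)" "v (m+4) = g (dirn 5 8)" by simp_all
  have "x = g x0" using x meet[OF g] unfolding vg by simp
  then have "S = g ` U" unfolding S vg U by simp
  then show ?R using g unfolding similarity_rel_iff by blast
next
  assume ?R
  then obtain z r \<theta> where r: "r > 0" "S = turn z r \<theta> ` U" unfolding similar_symmetric_iff[OF flip] turn_def by blast
  define v where "v = (\<lambda>i. turn z r \<theta> (dirn 5 (2 * int i)))"
  have "regular_polygon 5 z v" unfolding regular_polygon_iff v_def using r by auto
  moreover have "I (v (0+1)) (v (0+2)) (v (0+3)) (v (0+4)) = {turn z r \<theta> x0}"
    using meet[OF turn_similarity[OF r(1)], of z \<theta>] by (simp add: v_def)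
  moreover have "S = {v (0+1), v (0+2), v (0+3), v (0+4), turn z r \<theta> x0}"
    unfolding r(2) U by (simp add: v_def)
  ultimately show ?L by (intro exI[of _ z] exI[of _ v] exI[of _ 0] exI[of _ "turn z r \<theta> x0"]) simp
qed

lemma diagonals_iff: "trapezoid_with_diagonals_point S \<longleftrightarrow> (unit_diagonals_set, S) \<in> similarity_rel"
  unfolding trapezoid_with_diagonals_point_def
proof (rule omitted_vertex_iff[OF _ unit_diagonals_set_def flip_sets(2), where I = "\<lambda>a b c d. closed_segment a c \<inter> closed_segment b d"])
  fix g assume g: "is_similarity g"
  show "closed_segment (g (dirn 5 2)) (g (dirn 5 6)) \<inter> closed_segment (g (dirn 5 4)) (g (dirn 5 8)) = {g (pt (phi - 2) 0)}"
    unfolding similarity_image(2)[OF g, symmetric] image_Int[OF is_similarity_inj[OF g], symmetric] unit_diagonals_meet by simp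
qed

lemma legs_iff: "trapezoid_with_legs_point S \<longleftrightarrow> (unit_legs_set, S) \<in> similarity_rel"
  unfolding trapezoid_with_legs_point_def
proof (rule omitted_vertex_iff[OF _ unit_legs_set_def flip_sets(3), where I = "\<lambda>a b c d. affine hull {a, b} \<inter> affine hull {c, d}"])
  fix g assume g: "is_similarity g"
  have h: "affine hull {g a, g b} = g ` (affine hull {a, b})" for a b using similarity_image(3)[OF g, of "{a, b}"] by simp
  show "affine hull {g (dirn 5 2), g (dirn 5 4)} \<inter> affine hull {g (dirn 5 6), g (dirn 5 8)} = {g (pt (- phi - 1) 0)}"
    unfolding h image_Int[OF is_similarity_inj[OF g], symmetric] unit_legs_meet by simp
qed

lemma similar_by_frame:
  assumes "P \<noteq> Q" "\<sigma> = 1 \<or> \<sigma> = - 1"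
    "U = (\<lambda>x. P + x$1 *\<^sub>R (Q - P) + (\<sigma> * x$2) *\<^sub>R vector [- (Q - P)$2, (Q - P)$1]) ` B"
  shows "(B, U) \<in> similarity_rel"
  unfolding similarity_rel_iff using frame_similarity[OF assms(1,2)] assms(3) by blast

text \<open>The base is the vertical side from vertex 3 to vertex 2. The other points are to its right, hence the sign \<open>- 1\<close>.\<close>
lemma pentagon_base: "(base_points pentagon_frame, unit_pentagon_set) \<in> similarity_rel"
  and diagonals_base: "(base_points diagonals_frame, unit_diagonals_set) \<in> similarity_rel"
proof -
  define P Q where "P = pt (- phi / 2) (- 1)" and "Q = pt (- phi / 2) 1"
  define g where "g = (\<lambda>x::real^2. P + x$1 *\<^sub>R (Q - P) + (- 1 * x$2) *\<^sub>R vector [- (Q - P)$2, (Q - P)$1])"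
  have "P \<noteq> Q" by (simp add: P_def Q_def pt_eq_iff)
  have g: "g (pt p q) = pt (- phi / 2 + q * (3 - phi) / 2) (2 * p - 1)" for p q
  proof -
    have "g (pt p q) $ 1 = - phi / 2 + 2 * q * (sin36 * sin36)" by (simp add: g_def P_def Q_def pt_simps vec2_eq_iff algebra_simps)
    moreover have "g (pt p q) $ 2 = (2 * p - 1) * sin36" by (simp add: g_def P_def Q_def pt_simps vec2_eq_iff algebra_simps)
    ultimately show ?thesis unfolding sin36_sq by (simp add: vec2_eq_iff pt_simps)
  qed
  have v: "g pO = dirn 5 6" "g pI = dirn 5 4" "g pA = dirn 5 2" "g pT = dirn 5 0" "g pB = dirn 5 8" "g pX = pt (phi - 2) 0"
    unfolding base_point_defs g unit_pentagon pt_eq_iff by (simp_all add: field_simps phi_sq phi_sq2)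
  have "unit_pentagon_set = g ` base_points pentagon_frame" "unit_diagonals_set = g ` base_points diagonals_frame"
    unfolding base_points_values unit_pentagon_set_def unit_diagonals_set_def by (auto simp: v)
  then show "(base_points pentagon_frame, unit_pentagon_set) \<in> similarity_rel"
    "(base_points diagonals_frame, unit_diagonals_set) \<in> similarity_rel"
    unfolding g_def using similar_by_frame[OF \<open>P \<noteq> Q\<close>, of "- 1"] by blast+
qed

text \<open>Here the base is the diagonal between the vertices 4 and 1, the long base of the trapezoid.\<close>
lemma legs_base: "(base_points legs_frame, unit_legs_set) \<in> similarity_rel"
proof -
  define P Q where "P = pt ((phi - 1) / 2) (- phi)" and "Q = pt ((phi - 1) / 2) phi"
  define g where "g = (\<lambda>x::real^2. P + x$1 *\<^sub>R (Q - P) + (1 * x$2) *\<^sub>R vector [- (Q - P)$2, (Q - P)$1])"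
  have "P \<noteq> Q" using phi_bounds by (simp add: P_def Q_def pt_eq_iff)
  have g: "g (pt p q) = pt ((phi - 1) / 2 - q * (phi * (3 - phi)) / 2) (phi * (2 * p - 1))" for p q
  proof -
    have "g (pt p q) $ 1 = (phi - 1) / 2 - 2 * phi * q * (sin36 * sin36)" by (simp add: g_def P_def Q_def pt_simps vec2_eq_iff algebra_simps)
    moreover have "g (pt p q) $ 2 = phi * (2 * p - 1) * sin36" by (simp add: g_def P_def Q_def pt_simps vec2_eq_iff algebra_simps)
    ultimately show ?thesis unfolding sin36_sq by (simp add: vec2_eq_iff pt_simps)
  qed
  have v: "g pO = dirn 5 8" "g pI = dirn 5 2" "g pT = pt (- phi - 1) 0" "g pD = dirn 5 6" "g pE = dirn 5 4"
    unfolding base_point_defs g unit_pentagon pt_eq_iff by (simp_all add: field_simps phi_sq phi_sq2)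
  have "unit_legs_set = g ` base_points legs_frame"
    unfolding base_points_values unit_legs_set_def by (auto simp: v)
  then show "(base_points legs_frame, unit_legs_set) \<in> similarity_rel"
    unfolding g_def using similar_by_frame[OF \<open>P \<noteq> Q\<close>, of 1] by blast
qed

lemma square_base: "(base_points square_frame, unit_square_set) \<in> similarity_rel"
proof -
  define P Q :: "real^2" where "P = vector [0, - 1]" and "Q = vector [1, 0]"
  define g where "g = (\<lambda>x::real^2. P + x$1 *\<^sub>R (Q - P) + (1 * x$2) *\<^sub>R vector [- (Q - P)$2, (Q - P)$1])"
  have "P \<noteq> Q" by (simp add: P_def Q_def vec2_eq_iff)
  have v: "g 0 = dirn 4 6" "g (vector [1, 0]) = dirn 4 0" "g (vector [1 / 2, 1 / 2]) = 0" "g (vector [1, 1]) = dirn 4 2"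
    "g (vector [0, 1]) = dirn 4 4"
    unfolding g_def P_def Q_def dirn4 by (simp_all add: vec2_eq_iff)
  have "unit_square_set = g ` base_points square_frame"
    unfolding base_points_square unit_square_set_def image_insert image_empty v by auto
  then show "(base_points square_frame, unit_square_set) \<in> similarity_rel"
    unfolding g_def using similar_by_frame[OF \<open>P \<noteq> Q\<close>, of 1] by blast
qed

lemma open_segmentI:
  fixes a b :: "real^2"
  assumes "d = a + t *\<^sub>R (b - a)" "0 < t" "t < 1" "a \<noteq> b"
  shows "d \<in> open_segment a b"
  using assms open_segment_param by blast

lemma pt_add: "pt p q + pt p' q' = pt (p + p') (q + q')"
  by (simp add: pt_def vec2_eq_iff algebra_simps)

lemma open_segment_initial:
  fixes a b c d :: "real^2"
  assumes "c \<in> open_segment a b" "d \<in> open_segment c b"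
  shows "c \<in> open_segment a d"
proof -
  obtain t where t: "0 < t" "t < 1" "c = a + t *\<^sub>R (b - a)" and "a \<noteq> b"
    using assms open_segment_param by auto
  obtain u where u: "0 < u" "u < 1" "d = c + u *\<^sub>R (b - c)" using assms open_segment_param by auto
  define e where "e = t + u * (1 - t)"
  have d: "d = a + e *\<^sub>R (b - a)"
    unfolding u(3) t(3) e_def by (simp add: vec2_eq_iff algebra_simps)
  have "0 < u * (1 - t)" using t u by simp
  then have e: "t < e" "0 < e" using t by (simp_all add: e_def)
  have "c = a + (t / e) *\<^sub>R (d - a)" unfolding d t(3) using e by simp
  moreover have "a \<noteq> d" unfolding d using \<open>a \<noteq> b\<close> e by simp
  ultimately show ?thesis using t e by (intro open_segmentI[of c a "t / e" d]) auto
qed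

text \<open>Each diagonal of a regular pentagon is divided in the golden ratio by each of its crossing points, and so is the longer part
  by the other one, whence the common parameter \<open>2 - phi\<close>.\<close>
lemma base_betweenness:
  "pX \<in> open_segment pO pA" "pX \<in> open_segment pI pB" "pD \<in> open_segment pO pT" "pE \<in> open_segment pX pA"
  "pE \<in> open_segment pI pT"
  by (rule open_segmentI[of _ _ "2 - phi"];
      use phi_bounds in \<open>auto simp: pt_eq_iff pt_add base_point_defs pt_simps field_simps phi_sq phi_sq2\<close>)+

lemma angle_in_directions:
  assumes "in_direction b a j" "in_direction b c k" "\<bar>j - k\<bar> \<le> 5"
  shows "angle a b c = of_int \<bar>j - k\<bar> * pi / 5"
proof -
  have "angle a b c = arccos (cos ((j - k) * pi / 5))"
    using angle_of_directions[of a b _ 5 j c _ k] assms unfolding in_direction_def by auto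
  also have "cos ((j - k) * pi / 5) = cos (of_int \<bar>j - k\<bar> * pi / 5)"
    using cos_minus[of "(j - k) * pi / 5"] by (auto simp: abs_if algebra_simps minus_divide_left)
  also have "arccos \<dots> = of_int \<bar>j - k\<bar> * pi / 5"
  proof (rule arccos_cos)
    have "real_of_int \<bar>j - k\<bar> \<le> 5" using assms(3) by linarith
    then have "of_int \<bar>j - k\<bar> * pi \<le> 5 * pi" using pi_gt_zero by (intro mult_right_mono) auto
    then show "of_int \<bar>j - k\<bar> * pi / 5 \<le> pi" by simp
  qed simp
  finally show ?thesis .
qed

text \<open>The trisected triangle is described by angles, so one direction is an instance of \<open>framed_similar\<close> with base \<open>A C\<close>. For
  the other, all parts of the description are invariant under similarity and hold for the normal form.\<close>
lemma trisected_iff: "trisected_isosceles_triangle S \<longleftrightarrow> (base_points trisected_frame, S) \<in> similarity_rel"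
proof
  assume "trisected_isosceles_triangle S"
  then obtain A B C D E where nc: "\<not> collinear {A, B, C}"
    and a: "angle A C B = 3 * pi / 5" "angle C A B = pi / 5" "angle C B A = pi / 5"
    and D: "D \<in> open_segment A B" and E: "E \<in> open_segment D B"
    and b: "angle A C D = pi / 5" "angle D C E = pi / 5" "angle E C B = pi / 5"
    and S: "S = {A, B, C, D, E}" unfolding trisected_isosceles_triangle_def by blast
  have "A \<noteq> B" using nc by auto
  then have o: "orient A B C \<noteq> 0" using collinear_orient[of A "{A, B, C}" B] nc by auto
  have E2: "E \<in> open_segment A B" using open_segment_shrink[OF D E] .
  obtain u where u: "0 < u" "orient A D C = u * orient A B C" using orient_open_segment[OF D] by metis
  obtain v where v: "0 < v" "orient A E C = v * orient A B C" using orient_open_segment[OF E2] by metis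
  have oe: "orient A E C \<noteq> 0" using o v by simp
  from angle_add_segment[OF open_segment_initial[OF D E] oe] have e: "angle A C E = 2 * pi / 5" using b by simp
  have p: "0 < orient A C B * orient A C B" using o orient_perms(3)[of A B C] by (simp add: zero_less_mult_iff linorder_neq_iff disj_commute)
  have "orient A C D = u * orient A C B" "orient A C E = v * orient A C B"
    using u v orient_perms(3)[of A C D] orient_perms(3)[of A C E] orient_perms(3)[of A C B] by simp_all
  then have q: "0 < orient A C B * orient A C D" "0 < orient A C B * orient A C E"
    using p u v by (auto simp: zero_less_mult_iff mult_less_0_iff)
  have "angle B A C = pi / 5" "angle D A C = pi / 5" "angle E A C = pi / 5"
    using a(2) angle_same_ray[OF D, of C] angle_same_ray[OF E2, of C] by (simp_all add: angle_commute[of B A C])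
  moreover have "angle B C A = 3 * pi / 5" "angle D C A = pi / 5" "angle E C A = 2 * pi / 5"
    using a(1) b(1) e by (simp_all only: angle_commute[of _ C A])
  ultimately have "framed trisected_frame S" using p q S
    by (intro framedI3[where P = A and Q = C and X = B and Y = D and Z = E and \<epsilon> = "orient A C B"]) auto
  then show "(base_points trisected_frame, S) \<in> similarity_rel" by (rule framed_similar) simp
next
  assume "(base_points trisected_frame, S) \<in> similarity_rel"
  then obtain g where g: "is_similarity g" "S = g ` {pO, pI, pA, pX, pE}"
    unfolding similarity_rel_iff base_points_values by blast
  note d = base_direction_pairs
  have "angle pO pI pA = 3 * pi / 5" "angle pI pO pA = pi / 5" "angle pI pA pO = pi / 5"
    "angle pO pI pX = pi / 5" "angle pX pI pE = pi / 5" "angle pE pI pA = pi / 5"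
    using angle_in_directions[of pI pO 5 pA 2] angle_in_directions[of pO pI 0 pA 1] angle_in_directions[of pA pI 7 pO 6]
      angle_in_directions[of pI pO 5 pX 4] angle_in_directions[of pI pX 4 pE 3] angle_in_directions[of pI pE 3 pA 2] d
    by simp_all
  moreover have "\<not> collinear {pO, pA, pI}"
  proof -
    have "pO \<noteq> pA" using phi_bounds by (simp add: pA_def pt_eq_iff)
    moreover have "orient pO pA pI \<noteq> 0" using phi_bounds sin36_pos by (simp add: orient_coords pA_def pt_simps)
    ultimately show ?thesis using collinear_orient[of pO "{pO, pA, pI}" pA] by auto
  qed
  then have "\<not> collinear {g pO, g pA, g pI}" using similarity_image(4)[OF g(1), of "{pO, pA, pI}"] by simp
  moreover have "g pX \<in> open_segment (g pO) (g pA)" "g pE \<in> open_segment (g pX) (g pA)"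
    using similarity_image(1)[OF g(1)] base_betweenness by blast+
  ultimately show "trisected_isosceles_triangle S" unfolding trisected_isosceles_triangle_def g(2)
    by (intro exI[of _ "g pO"] exI[of _ "g pA"] exI[of _ "g pI"] exI[of _ "g pX"] exI[of _ "g pE"])
      (auto simp: angle_similarity[OF g(1)])
qed

lemma base_classes:
  "square_with_center S \<longleftrightarrow> (base_points square_frame, S) \<in> similarity_rel"
  "pentagon S \<longleftrightarrow> (base_points pentagon_frame, S) \<in> similarity_rel"
  "trapezoid_with_diagonals_point S \<longleftrightarrow> (base_points diagonals_frame, S) \<in> similarity_rel"
  "trapezoid_with_legs_point S \<longleftrightarrow> (base_points legs_frame, S) \<in> similarity_rel"
proof -
  have *: "(U, S) \<in> similarity_rel \<longleftrightarrow> (B, S) \<in> similarity_rel" if "(B, U) \<in> similarity_rel" for B U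
    using that similarity_rel_sym similarity_rel_trans by blast
  show "square_with_center S \<longleftrightarrow> (base_points square_frame, S) \<in> similarity_rel"
    "pentagon S \<longleftrightarrow> (base_points pentagon_frame, S) \<in> similarity_rel"
    "trapezoid_with_diagonals_point S \<longleftrightarrow> (base_points diagonals_frame, S) \<in> similarity_rel"
    "trapezoid_with_legs_point S \<longleftrightarrow> (base_points legs_frame, S) \<in> similarity_rel"
    unfolding square_iff pentagon_iff diagonals_iff legs_iff
    by (rule *[OF square_base] *[OF pentagon_base] *[OF diagonals_base] *[OF legs_base])+
qed

section \<open>Optimality and inequivalence\<close>

lemma num_angles_few: "num_angles S \<le> enat 3 \<longleftrightarrow> few_angles S"
  by (auto simp: num_angles_def ecard_def few_angles_def)

lemma anglesI:
  "a \<in> S \<Longrightarrow> b \<in> S \<Longrightarrow> c \<in> S \<Longrightarrow> a \<noteq> b \<Longrightarrow> b \<noteq> c \<Longrightarrow> a \<noteq> c \<Longrightarrow>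
    0 < angle a b c \<Longrightarrow> angle a b c < pi \<Longrightarrow> angle a b c \<in> angles S"
  by (auto simp: angles_def)

lemma unit_square_angles: "angles unit_square_set \<subseteq> {pi / 4, pi / 2, 3 * pi / 4}" "pi / 2 \<in> angles unit_square_set"
proof -
  have dir: "\<exists>k. \<exists>\<rho>>0. a - b = \<rho> *\<^sub>R dirn 4 k" if "a \<in> unit_square_set" "b \<in> unit_square_set" "a \<noteq> b" for a b
  proof -
    have odd: "dirn 4 1 = vector [sqrt 2 / 2, sqrt 2 / 2]" "dirn 4 3 = vector [- sqrt 2 / 2, sqrt 2 / 2]"
      "dirn 4 5 = vector [- sqrt 2 / 2, - sqrt 2 / 2]" "dirn 4 7 = vector [sqrt 2 / 2, - sqrt 2 / 2]"
    proof -
      have e: "3 * pi / 4 = pi - pi / 4" "5 * pi / 4 = pi + pi / 4" "7 * pi / 4 = 2 * pi - pi / 4" by simp_all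
      have t: "cos (3 * pi / 4) = - sqrt 2 / 2" "sin (3 * pi / 4) = sqrt 2 / 2"
        "cos (5 * pi / 4) = - sqrt 2 / 2" "sin (5 * pi / 4) = - sqrt 2 / 2"
        "cos (7 * pi / 4) = sqrt 2 / 2" "sin (7 * pi / 4) = - sqrt 2 / 2"
        unfolding e cos_pi_minus sin_pi_minus cos_add sin_add cos_diff sin_diff by (simp_all add: cos_45 sin_45)
      show "dirn 4 1 = vector [sqrt 2 / 2, sqrt 2 / 2]" "dirn 4 3 = vector [- sqrt 2 / 2, sqrt 2 / 2]"
        "dirn 4 5 = vector [- sqrt 2 / 2, - sqrt 2 / 2]" "dirn 4 7 = vector [sqrt 2 / 2, - sqrt 2 / 2]"
        by (simp_all add: dirn_def t cos_45 sin_45)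
    qed
    have w: "\<exists>k. \<exists>\<rho>>0. a - b = \<rho> *\<^sub>R dirn 4 k" if "a - b = \<rho> *\<^sub>R dirn 4 k" "0 < \<rho>" for \<rho> k using that by blast
    have P: "unit_square_set = {0, vector [1, 0], vector [0, 1], vector [- 1, 0], vector [0, - 1]}"
      unfolding unit_square_set_def dirn4 ..
    have ax: "x \<in> unit_square_set \<Longrightarrow> x = 0 \<or> x = vector [1, 0] \<or> x = vector [0, 1] \<or> x = vector [- 1, 0] \<or> x = vector [0, - 1]" for x
      unfolding P by blast
    have s: "0 < sqrt (2::real)" by simp
    have d: "a - b = 1 *\<^sub>R dirn 4 0 \<or> a - b = 1 *\<^sub>R dirn 4 2 \<or> a - b = 1 *\<^sub>R dirn 4 4 \<or> a - b = 1 *\<^sub>R dirn 4 6 \<or>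
       a - b = 2 *\<^sub>R dirn 4 0 \<or> a - b = 2 *\<^sub>R dirn 4 2 \<or> a - b = 2 *\<^sub>R dirn 4 4 \<or> a - b = 2 *\<^sub>R dirn 4 6 \<or>
       a - b = sqrt 2 *\<^sub>R dirn 4 1 \<or> a - b = sqrt 2 *\<^sub>R dirn 4 3 \<or> a - b = sqrt 2 *\<^sub>R dirn 4 5 \<or> a - b = sqrt 2 *\<^sub>R dirn 4 7"
      using ax[OF that(1)] ax[OF that(2)] that(3) unfolding dirn4 odd
      by (elim disjE) (simp_all add: vec2_eq_iff)
    then show ?thesis using w s by (elim disjE) (use zero_less_one zero_less_numeral in blast)+
  qed
  show "angles unit_square_set \<subseteq> {pi / 4, pi / 2, 3 * pi / 4}"
  proof
    fix x assume "x \<in> angles unit_square_set"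
    then obtain a b c where abc: "x = angle a b c" "a \<in> unit_square_set" "b \<in> unit_square_set" "c \<in> unit_square_set" "a \<noteq> b" "b \<noteq> c"
      and r: "0 < x" "x < pi" unfolding angles_def by auto
    obtain j \<rho> k \<tau> where jk: "\<rho> > 0" "a - b = \<rho> *\<^sub>R dirn 4 j" "\<tau> > 0" "c - b = \<tau> *\<^sub>R dirn 4 k"
      using dir abc by metis
    have "x = arccos (cos (of_int (j - k) * pi / real 4))" using angle_of_directions[OF jk(2,4,1,3)] abc by simp
    moreover obtain i :: nat where i: "i \<le> 4" "arccos (cos (of_int (j - k) * pi / real 4)) = i * pi / 4"
      using arccos_cos_multiple[of 4 "j - k"] by auto
    ultimately have x: "x = i * pi / 4" by simp
    have "i \<noteq> 0" "i \<noteq> 4" using r x by (auto simp: zero_less_mult_iff)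
    then have "i = 1 \<or> i = 2 \<or> i = 3" using i by auto
    then show "x \<in> {pi / 4, pi / 2, 3 * pi / 4}" using x by auto
  qed
  have e: "angle (dirn 4 0) 0 (dirn 4 2) = pi / 2" by (simp add: angle_def dirn4 inner2)
  have "dirn 4 0 \<noteq> 0" "dirn 4 2 \<noteq> 0" "dirn 4 0 \<noteq> dirn 4 2" by (simp_all add: dirn4 vec2_eq_iff)
  then have "angle (dirn 4 0) 0 (dirn 4 2) \<in> angles unit_square_set"
    by (intro anglesI) (simp_all only: e, auto simp: unit_square_set_def)
  then show "pi / 2 \<in> angles unit_square_set" by (simp only: e)
qed

lemma base_angles:
  "angles (base_points square_frame) \<subseteq> {pi / 4, pi / 2, 3 * pi / 4}"
  "pi / 2 \<in> angles (base_points square_frame)"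
  "angles (base_points pentagon_frame) \<subseteq> {pi / 5, 2 * pi / 5, 3 * pi / 5}"
  "angles (base_points diagonals_frame) \<subseteq> {pi / 5, 2 * pi / 5, 3 * pi / 5}"
  "angles (base_points legs_frame) \<subseteq> {pi / 5, 2 * pi / 5, 3 * pi / 5}"
  "angles (base_points trisected_frame) \<subseteq> {pi / 5, 2 * pi / 5, 3 * pi / 5}"
proof -
  obtain g where "is_similarity g" "unit_square_set = g ` base_points square_frame"
    using square_base unfolding similarity_rel_iff by blast
  then have "angles (base_points square_frame) = angles unit_square_set" using angles_similarity[of g "base_points square_frame"] by simp
  then show "angles (base_points square_frame) \<subseteq> {pi / 4, pi / 2, 3 * pi / 4}"
    "pi / 2 \<in> angles (base_points square_frame)" using unit_square_angles by simp_all
  show "angles (base_points pentagon_frame) \<subseteq> {pi / 5, 2 * pi / 5, 3 * pi / 5}"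
    "angles (base_points diagonals_frame) \<subseteq> {pi / 5, 2 * pi / 5, 3 * pi / 5}"
    "angles (base_points legs_frame) \<subseteq> {pi / 5, 2 * pi / 5, 3 * pi / 5}"
    "angles (base_points trisected_frame) \<subseteq> {pi / 5, 2 * pi / 5, 3 * pi / 5}"
    unfolding base_points_values
    by (intro decagonal_angles pentagon_directions diagonals_directions legs_directions trisected_directions)+
qed

lemma base_few: "f \<in> frames \<Longrightarrow> few_angles (base_points f)"
proof -
  have c: "few_angles S" if "angles S \<subseteq> {x, y, z}" for S x y z
  proof -
    have "finite (angles S)" using that finite_subset by blast
    moreover have "card (angles S) \<le> card {x, y, z}" using that by (intro card_mono) auto
    moreover have "card {x, y, z} \<le> 3" by (simp add: card_insert_if)
    ultimately show ?thesis by (simp add: few_angles_def)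
  qed
  show "f \<in> frames \<Longrightarrow> few_angles (base_points f)"
    using base_angles(1,3-6)[THEN c] by blast
qed

lemma base_card: "f \<in> frames \<Longrightarrow>
    finite (base_points f) \<and> card (base_points f) = 5"
proof -
  have fin: "finite (base_points f)" for f by (simp add: base_points_def)
  have "card (base_points square_frame) = 5" unfolding base_points_square by (simp add: vec2_eq_iff)
  moreover have "card (base_points pentagon_frame) = 5" "card (base_points diagonals_frame) = 5"
    "card (base_points legs_frame) = 5" "card (base_points trisected_frame) = 5"
    unfolding base_points_values base_point_defs using phi_bounds by (simp_all add: pt_eq_iff)
  ultimately show "f \<in> frames \<Longrightarrow>
    finite (base_points f) \<and> card (base_points f) = 5"
    using fin by blast
qed

lemma not_collinear_of_triple:
  assumes "a \<in> S" "b \<in> S" "c \<in> S" "orient a b c \<noteq> 0" shows "\<not> collinear S"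
  using assms collinear_orient[of a S b] orient_distinct[of a b c] by auto

lemma base_noncollinear: "f \<in> frames \<Longrightarrow> \<not> collinear (base_points f)"
proof -
  have n: "orient pO pI pA \<noteq> 0" "orient pO pI pT \<noteq> 0" using phi_bounds sin36_pos by (auto simp: orient_coords base_point_defs pt_simps)
  have sq: "orient 0 (vector [1, 0]) (vector [0, 1]) \<noteq> 0" by (simp add: orient_coords)
  have "\<not> collinear (base_points square_frame)" unfolding base_points_square
    by (rule not_collinear_of_triple[OF _ _ _ sq]) auto
  moreover have "\<not> collinear (base_points pentagon_frame)" "\<not> collinear (base_points diagonals_frame)" "\<not> collinear (base_points trisected_frame)"
    unfolding base_points_values by (rule not_collinear_of_triple[OF _ _ _ n(1)]; auto)+
  moreover have "\<not> collinear (base_points legs_frame)"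
    unfolding base_points_values by (rule not_collinear_of_triple[OF _ _ _ n(2)]; auto)
  ultimately show "f \<in> frames \<Longrightarrow> \<not> collinear (base_points f)" by blast
qed

text \<open>A larger set, finite or not, contains six points among which are three that are not collinear.\<close>
lemma ecard_le_5:
  assumes "\<not> collinear S" "few_angles S" shows "finite S \<and> card S \<le> 5"
proof (rule ccontr)
  assume n: "\<not> (finite S \<and> card S \<le> 5)"
  have "\<exists>a\<in>S. \<exists>b\<in>S. a \<noteq> b"
  proof (rule ccontr)
    assume "\<not> ?thesis"
    then have "S = {} \<or> (\<exists>a. S = {a})" by blast
    then show False using assms(1) by auto
  qed
  then obtain a b where ab: "a \<in> S" "b \<in> S" "a \<noteq> b" by blast
  then obtain c where c: "c \<in> S" "orient a b c \<noteq> 0" using collinear_orient assms(1) by blast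
  have "c \<noteq> a" "c \<noteq> b" using c by auto
  then have F: "card {a, b, c} = 3" "{a, b, c} \<subseteq> S" using ab c by auto
  have "\<exists>G\<subseteq>S - {a, b, c}. finite G \<and> card G = 3"
  proof (cases "finite S")
    case True
    then have "3 \<le> card (S - {a, b, c})" using n F by (simp add: card_Diff_subset)
    then show ?thesis using True by (meson finite_Diff obtain_subset_with_card_n)
  next
    case False
    then have "infinite (S - {a, b, c})" by simp
    then show ?thesis by (meson infinite_arbitrarily_large)
  qed
  then obtain G where G: "G \<subseteq> S - {a, b, c}" "finite G" "card G = 3" by blast
  define T where "T = {a, b, c} \<union> G"
  have "card T = 6" unfolding T_def using G F by (subst card_Un_disjoint) auto
  moreover have "finite T" "T \<subseteq> S" using G F by (auto simp: T_def)
  moreover have "\<not> collinear T" using c by (intro not_collinear_of_triple[of a _ b c]) (auto simp: T_def)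
  ultimately show False using few_angles.not_six_points[OF few_angles_subset[OF assms(2)]] by blast
qed

lemma max_points_3: "max_points 3 = 5"
proof (rule antisym)
  show "max_points 3 \<le> 5" unfolding max_points_def
  proof (rule SUP_least)
    fix S assume "S \<in> {S. \<not> collinear S \<and> num_angles S \<le> enat 3}"
    then have "finite S \<and> card S \<le> 5" using ecard_le_5 num_angles_few by blast
    then show "ecard S \<le> 5" by (simp add: ecard_def numeral_eq_enat)
  qed
  have "base_points pentagon_frame \<in> {S. \<not> collinear S \<and> num_angles S \<le> enat 3}"
    using base_noncollinear[of pentagon_frame] base_few[of pentagon_frame] num_angles_few by auto
  then have "ecard (base_points pentagon_frame) \<le> max_points 3" unfolding max_points_def by (rule SUP_upper)
  moreover have "ecard (base_points pentagon_frame) = 5"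
    using base_card[of pentagon_frame] by (simp add: ecard_def numeral_eq_enat)
  ultimately show "5 \<le> max_points 3" by simp
qed

lemma optimal_3_iff: "optimal 3 S \<longleftrightarrow> \<not> collinear S \<and> few_angles S \<and> finite S \<and> card S = 5"
  unfolding optimal_def num_angles_few max_points_3 by (auto simp: ecard_def numeral_eq_enat)

lemma optimal_3_base:
  "optimal 3 S \<longleftrightarrow> (\<exists>f \<in> frames.
    (base_points f, S) \<in> similarity_rel)" (is "_ = (\<exists>f\<in>?F. _)")
proof
  assume "optimal 3 S"
  then have "classified S" using few_angles.five_points_classified unfolding optimal_3_iff by blast
  then obtain f where "f \<in> ?F" "framed f S" unfolding classified_def by blast
  moreover from this have "f \<noteq> []" by blast
  ultimately show "\<exists>f\<in>?F. (base_points f, S) \<in> similarity_rel" using framed_similar by blast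
next
  assume "\<exists>f\<in>?F. (base_points f, S) \<in> similarity_rel"
  then obtain f g where f: "f \<in> ?F" and g: "is_similarity g" "S = g ` base_points f" unfolding similarity_rel_iff by blast
  have "few_angles S" using base_few[OF f] angles_similarity[OF g(1)] unfolding g(2) few_angles_def by simp
  moreover have "\<not> collinear S" using base_noncollinear[OF f] similarity_image(4)[OF g(1)] unfolding g(2) by simp
  moreover have "finite S" "card S = 5"
    using base_card[OF f] card_image[of g "base_points f"] is_similarity_inj[OF g(1)] inj_on_subset unfolding g(2) by fastforce+
  ultimately show "optimal 3 S" unfolding optimal_3_iff by blast
qed

text \<open>Together with the set of angles, the next two notions are similarity invariants that separate the five classes.\<close>
definition middle_points :: "(real^2) set \<Rightarrow> (real^2) set" where
  "middle_points S = {b \<in> S. \<exists>a\<in>S. \<exists>c\<in>S. b \<in> open_segment a c}"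

definition almost_collinear :: "(real^2) set \<Rightarrow> bool" where
  "almost_collinear S \<longleftrightarrow> (\<exists>p\<in>S. collinear (S - {p}))"

lemma similarity_invariants:
  assumes "(S, T) \<in> similarity_rel"
  shows "angles S = angles T" "card (middle_points S) = card (middle_points T)"
    "almost_collinear S \<longleftrightarrow> almost_collinear T"
proof -
  obtain g where g: "is_similarity g" "T = g ` S" using assms unfolding similarity_rel_iff by blast
  note inj = is_similarity_inj[OF g(1)]
  have os: "g b \<in> open_segment (g a) (g c) \<longleftrightarrow> b \<in> open_segment a c" for a b c
    unfolding similarity_image(1)[OF g(1), symmetric] using inj by (rule inj_image_mem_iff)
  have d: "g ` S - {g p} = g ` (S - {p})" for p using inj by (auto simp: inj_eq)
  show "angles S = angles T" using angles_similarity[OF g(1)] g(2) by simp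
  have "g b \<in> middle_points T \<longleftrightarrow> b \<in> middle_points S" for b
    unfolding middle_points_def g(2) by (simp add: os inj_image_mem_iff[OF inj])
  moreover have "middle_points T \<subseteq> g ` S" unfolding middle_points_def g(2) by blast
  moreover have "middle_points S \<subseteq> S" unfolding middle_points_def by blast
  ultimately have "middle_points T = g ` middle_points S" by blast
  then show "card (middle_points S) = card (middle_points T)"
    using card_image[of g "middle_points S"] inj inj_on_subset by fastforce
  show "almost_collinear S \<longleftrightarrow> almost_collinear T"
    unfolding almost_collinear_def g(2) by (simp add: d similarity_image(4)[OF g(1)])
qed

text \<open>Strict convexity of the unit ball; it shows that points on the unit circle are not between other points of the disc.\<close>
lemma norm_open_segment_less:
  fixes a c :: "'a :: real_inner"
  assumes "norm a \<le> 1" "norm c \<le> 1" "b \<in> open_segment a c"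
  shows "norm b < 1"
proof -
  obtain t where t: "0 < t" "t < 1" "b = (1 - t) *\<^sub>R a + t *\<^sub>R c" and "a \<noteq> c"
    using assms(3) by (auto simp: in_segment)
  have "b \<bullet> b = (1 - t) * (a \<bullet> a) + t * (c \<bullet> c) - t * (1 - t) * ((c - a) \<bullet> (c - a))"
    unfolding t(3) by (simp add: inner_add_left inner_add_right inner_diff_left inner_diff_right inner_commute algebra_simps)
  also have "\<dots> < (1 - t) * (a \<bullet> a) + t * (c \<bullet> c)" using t \<open>a \<noteq> c\<close> by simp
  also have "\<dots> \<le> (1 - t) * 1 + t * 1"
    using t assms(1,2) power_le_one[of "norm a" 2] power_le_one[of "norm c" 2]
    by (intro add_mono mult_left_mono) (simp_all add: power2_norm_eq_inner)
  finally have "b \<bullet> b < 1" by simp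
  then show ?thesis by (simp add: norm_eq_sqrt_inner)
qed

text \<open>In the inscribed versions of the pentagon and of the trapezoid with crossing diagonals all points but the crossing point are on the
  unit circle, and that point is inside; so there are few middle points.\<close>
lemma middle_points_base:
  "card (middle_points (base_points pentagon_frame)) = 0"
  "card (middle_points (base_points diagonals_frame)) = 1"
  "2 \<le> card (middle_points (base_points legs_frame))"
  "2 \<le> card (middle_points (base_points trisected_frame))"
proof -
  have unit: "norm (dirn 5 k) = 1" for k by (simp add: norm_eq_sqrt_inner inner2 dirn_def)
  have small: "norm (pt (phi - 2) 0) < 1"
    using phi_bounds by (simp add: norm_eq_sqrt_inner inner2 pt_simps abs_if flip: power2_eq_square)
  have "middle_points unit_pentagon_set = {}"
  proof (rule equals0I)
    fix b assume "b \<in> middle_points unit_pentagon_set"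
    then obtain a c where "a \<in> unit_pentagon_set" "b \<in> unit_pentagon_set" "c \<in> unit_pentagon_set" "b \<in> open_segment a c"
      unfolding middle_points_def by blast
    moreover have "norm x = 1" if "x \<in> unit_pentagon_set" for x using that unit by (auto simp: unit_pentagon_set_def)
    ultimately show False using norm_open_segment_less[of a c b] by force
  qed
  then show "card (middle_points (base_points pentagon_frame)) = 0"
    using similarity_invariants(2)[OF pentagon_base] by simp
  have ball: "norm x \<le> 1 \<and> (norm x = 1 \<or> x = pt (phi - 2) 0)" if "x \<in> unit_diagonals_set" for x
    using that unit small by (auto simp: unit_diagonals_set_def)
  have "middle_points unit_diagonals_set \<subseteq> {pt (phi - 2) 0}"
  proof
    fix b assume "b \<in> middle_points unit_diagonals_set"
    then obtain a c where "a \<in> unit_diagonals_set" "b \<in> unit_diagonals_set" "c \<in> unit_diagonals_set" "b \<in> open_segment a c"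
      unfolding middle_points_def by blast
    then show "b \<in> {pt (phi - 2) 0}" using norm_open_segment_less[of a c b] ball by force
  qed
  then have "card (middle_points unit_diagonals_set) \<le> card {pt (phi - 2) 0}" by (intro card_mono) auto
  then have le: "card (middle_points (base_points diagonals_frame)) \<le> 1"
    using similarity_invariants(2)[OF diagonals_base] by simp
  have fin: "finite (middle_points (base_points f))" for f by (simp add: middle_points_def base_points_def)
  have "pX \<in> middle_points (base_points diagonals_frame)"
    unfolding middle_points_def base_points_values using base_betweenness by blast
  then have "card (middle_points (base_points diagonals_frame)) \<noteq> 0" using fin by (metis card_0_eq empty_iff)
  then show "card (middle_points (base_points diagonals_frame)) = 1" using le by simp
  have two: "2 \<le> card (middle_points (base_points f))"
    if "x \<in> middle_points (base_points f)" "y \<in> middle_points (base_points f)" "x \<noteq> y" for x y f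
    using card_mono[OF fin, of "{x, y}" f] that by simp
  have "pD \<in> middle_points (base_points legs_frame)" "pE \<in> middle_points (base_points legs_frame)"
    unfolding middle_points_def base_points_values using base_betweenness by blast+
  moreover have "pD \<noteq> pE" using phi_bounds by (simp add: base_point_defs pt_eq_iff)
  ultimately show "2 \<le> card (middle_points (base_points legs_frame))" by (rule two)
  have "pX \<in> middle_points (base_points trisected_frame)" "pE \<in> middle_points (base_points trisected_frame)"
    unfolding middle_points_def base_points_values using base_betweenness by blast+
  moreover have "pX \<noteq> pE" using phi_bounds by (simp add: base_point_defs pt_eq_iff)
  ultimately show "2 \<le> card (middle_points (base_points trisected_frame))" by (rule two)
qed

lemma almost_collinear_base:
  "\<not> almost_collinear (base_points legs_frame)" "almost_collinear (base_points trisected_frame)"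
proof -
  have "0 < phi * sin36" using phi_bounds sin36_pos by simp
  then have ps: "- sin36 \<noteq> phi * sin36" "sin36 + phi * sin36 \<noteq> 0" using sin36_pos by linarith+
  have o: "orient pO pI pT \<noteq> 0" "orient pI pT pD \<noteq> 0" "orient pO pT pE \<noteq> 0" "orient pO pI pD \<noteq> 0"
    using phi_bounds sin36_pos ps
    by (auto simp: orient_coords base_point_defs pt_simps field_simps phi_sq phi_sq2)
  have ne: "pO \<noteq> pI" "pO \<noteq> pA" "pI \<noteq> pA" "pI \<noteq> pX" "pI \<noteq> pE"
    "pO \<noteq> pT" "pO \<noteq> pD" "pO \<noteq> pE" "pI \<noteq> pT" "pI \<noteq> pD" "pT \<noteq> pD" "pT \<noteq> pE" "pD \<noteq> pE"
    using phi_bounds by (auto simp: base_point_defs pt_eq_iff)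
  show "\<not> almost_collinear (base_points legs_frame)"
  proof
    assume "almost_collinear (base_points legs_frame)"
    then obtain p where p: "p \<in> {pO, pI, pT, pD, pE}" "collinear ({pO, pI, pT, pD, pE} - {p})"
      unfolding almost_collinear_def base_points_values by blast
    have no: False if "a \<in> {pO, pI, pT, pD, pE} - {p}" "b \<in> {pO, pI, pT, pD, pE} - {p}" "c \<in> {pO, pI, pT, pD, pE} - {p}" "orient a b c \<noteq> 0" for a b c
      using not_collinear_of_triple[OF that] p(2) by blast
    have "p = pO \<or> p = pI \<or> p = pT \<or> p = pD \<or> p = pE" using p by blast
    then consider "p = pO" | "p = pI" | "p = pT" | "p = pD \<or> p = pE" by blast
    then show False
    proof cases
      case 1 show False by (rule no[OF _ _ _ o(2)]) (use 1 ne in auto)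
    next
      case 2 show False by (rule no[OF _ _ _ o(3)]) (use 2 ne in auto)
    next
      case 3 show False by (rule no[OF _ _ _ o(4)]) (use 3 ne in auto)
    next
      case 4 show False by (rule no[OF _ _ _ o(1)]) (use 4 ne in auto)
    qed
  qed
  have "orient pO pA pX = 0" "orient pO pA pE = 0"
    by (simp_all add: orient_coords base_point_defs pt_simps field_simps phi_sq phi_sq2)
  then have "collinear {pO, pA, pX, pE}" using collinear_orient[of pO "{pO, pA, pX, pE}" pA] ne by simp
  moreover have "{pO, pI, pA, pX, pE} - {pI} = {pO, pA, pX, pE}" using ne by auto
  ultimately show "almost_collinear (base_points trisected_frame)"
    unfolding almost_collinear_def base_points_values by (intro bexI[of _ pI]) auto
qed

text \<open>The quotient of a set that is a union of classes with known representatives.\<close>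
lemma quotient_classes:
  fixes C :: "'b \<Rightarrow> 'a"
  assumes sym: "\<And>x y. (x, y) \<in> R \<Longrightarrow> (y, x) \<in> R" and trans: "\<And>x y z. (x, y) \<in> R \<Longrightarrow> (y, z) \<in> R \<Longrightarrow> (x, z) \<in> R"
    and refl: "\<And>x. (x, x) \<in> R" and A: "\<And>x. x \<in> A \<longleftrightarrow> (\<exists>f\<in>F. (C f, x) \<in> R)"
  shows "A // R = (\<lambda>f. {x. (C f, x) \<in> R}) ` F"
proof
  show "A // R \<subseteq> (\<lambda>f. {x. (C f, x) \<in> R}) ` F"
  proof
    fix X assume "X \<in> A // R"
    then obtain x where x: "x \<in> A" "X = R `` {x}" by (auto elim: quotientE)
    then obtain f where f: "f \<in> F" "(C f, x) \<in> R" using A by blast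
    have "X = {y. (C f, y) \<in> R}" unfolding x(2) using f sym trans by blast
    then show "X \<in> (\<lambda>f. {x. (C f, x) \<in> R}) ` F" using f by blast
  qed
  show "(\<lambda>f. {x. (C f, x) \<in> R}) ` F \<subseteq> A // R"
  proof
    fix X assume "X \<in> (\<lambda>f. {x. (C f, x) \<in> R}) ` F"
    then obtain f where f: "f \<in> F" "X = {x. (C f, x) \<in> R}" by blast
    then have "C f \<in> A" "X = R `` {C f}" using A refl by auto
    then show "X \<in> A // R" by (auto intro: quotientI)
  qed
qed

theorem theorem1p6:
  shows "max_points 3 = 5 \<and>
    {S. optimal 3 S} // similarity_rel =
      {{S. square_with_center S},
       {S. pentagon S},
       {S. trapezoid_with_diagonals_point S},
       {S. trapezoid_with_legs_point S},
       {S. trisected_isosceles_triangle S}} \<and>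
    card ({S. optimal 3 S} // similarity_rel) = 5"
proof -
  define cl where "cl = (\<lambda>f. {S. (base_points f, S) \<in> similarity_rel})"
  have q: "{S. optimal 3 S} // similarity_rel =
      cl ` frames"
    unfolding cl_def
    by (rule quotient_classes) (use similarity_rel_sym similarity_rel_trans similarity_rel_refl optimal_3_base in blast)+
  have ne: "cl f \<noteq> cl h" if "(base_points h, base_points f) \<notin> similarity_rel" for f h
  proof -
    have "base_points f \<in> cl f" by (simp add: cl_def similarity_rel_refl)
    moreover have "base_points f \<notin> cl h" using that by (simp add: cl_def)
    ultimately show ?thesis by blast
  qed
  have "pi / 2 \<notin> {pi / 5, 2 * pi / 5, 3 * pi / 5}" using pi_gt_zero by simp
  then have "pi / 2 \<notin> angles (base_points f)" if "f \<in> {pentagon_frame, diagonals_frame, legs_frame, trisected_frame}" for f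
    using that base_angles(3-6) by blast
  then have n1: "cl square_frame \<noteq> cl f" if "f \<in> {pentagon_frame, diagonals_frame, legs_frame, trisected_frame}" for f
    using that base_angles(2) similarity_invariants(1) by (intro ne) metis
  have n2: "cl pentagon_frame \<noteq> cl diagonals_frame" "cl pentagon_frame \<noteq> cl legs_frame"
    "cl pentagon_frame \<noteq> cl trisected_frame" "cl diagonals_frame \<noteq> cl legs_frame" "cl diagonals_frame \<noteq> cl trisected_frame"
    by (rule ne, rule notI, drule similarity_invariants(2), use middle_points_base in linarith)+
  have n3: "cl legs_frame \<noteq> cl trisected_frame"
    using almost_collinear_base similarity_invariants(3) by (intro ne) blast
  have img: "cl ` frames =
    {cl square_frame, cl pentagon_frame, cl diagonals_frame, cl legs_frame, cl trisected_frame}"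
    by (simp only: image_insert image_empty)
  have eq: "cl square_frame = {S. square_with_center S}" "cl pentagon_frame = {S. pentagon S}"
    "cl diagonals_frame = {S. trapezoid_with_diagonals_point S}" "cl legs_frame = {S. trapezoid_with_legs_point S}"
    "cl trisected_frame = {S. trisected_isosceles_triangle S}"
    unfolding cl_def base_classes trisected_iff by (rule refl)+
  have "card {cl square_frame, cl pentagon_frame, cl diagonals_frame, cl legs_frame, cl trisected_frame} = 5"
  proof -
    have "cl square_frame \<noteq> cl pentagon_frame" "cl square_frame \<noteq> cl diagonals_frame"
      "cl square_frame \<noteq> cl legs_frame" "cl square_frame \<noteq> cl trisected_frame" by (rule n1; blast)+
    with n2 n3 show ?thesis
      by (simp only: card_insert_if finite_insert finite.emptyI insert_iff empty_iff card.empty if_False simp_thms)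
  qed
  then show ?thesis unfolding q img unfolding eq using max_points_3 by simp
qed

end
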